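(* Let $A\in\mathfrak{her}_N$ and let $P^*\in\mathrm{Gr}^{\times r}(\mathbf m,\mathbf n)$ be a non-degenerate critical point of the generalized Rayleigh-quotient $\rho_A$ (i.e. the Riemannian Hessian $\mathbf H_{\rho_A}(P^* )$ is invertible). Then the sequence generated by the Newton-like (N-like) algorithm described in the context converges locally quadratically to $P^*$; that is, there is a neighborhood $V\subset\mathrm{Gr}^{\times r}(\mathbf m,\mathbf n)$ of $P^*$ such that for every initial point $P\in V$ the sequence of iterates converges quadratically to $P^*$.
   Context: Let $r\ge 1$, $1\le m_j\le n_j$ be integers for $j=1,\dots,r$, $N:=n_1\cdots n_r$, $(\mathbf m,\mathbf n):=((m_1,n_1),\dots,(m_r,n_r))$. $\mathfrak{her}_n$ is the real vector space of Hermitian $n\times n$ complex matrices. $\mathrm{Gr}_{m,n}:=\{P\in\mathbb{C}^{n\times n}\mid P=P^\dagger=P^2,\ \operatorname{tr}P=m\}$, a smooth submanifold of $\mathfrak{her}_n$, and $\mathrm{Gr}^{\times r}(\mathbf m,\mathbf n):=\mathrm{Gr}_{m_1,n_1}\times\cdots\times\mathrm{Gr}_{m_r,n_r}\subset\mathfrak{her}_{n_1}\times\cdots\times\mathfrak{her}_{n_r}$, with the Riemannian metric induced by $\langle (X_j),(Y_j)\rangle=\sum_j\operatorname{tr}(X_jY_j)$. The generalized Rayleigh-quotient is $\rho_A:\mathrm{Gr}^{\times r}(\mathbf m,\mathbf n)\to\mathbb{R}$, $\rho_A(P_1,\dots,P_r)=\operatorname{tr}(A(P_1\otimes\cdots\otimes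 P_r))$, with $\otimes$ the Kronecker product. $\operatorname{grad}\rho_A$ is its Riemannian gradient and $\mathbf H_{\rho_A}(P)\xi=\boldsymbol\nabla_\xi\operatorname{grad}\rho_A(P)$ its Riemannian Hessian ($\boldsymbol\nabla$ the Levi-Civita connection). N-like algorithm. One iteration maps $P=(P_1,\dots,P_r)$ to $P^{\mathrm{new}}$ as follows. Let $\Theta_j\in\mathrm{SU}_{n_j}$ satisfy $P_j=\Theta_j\Pi_j\Theta_j^\dagger$, where $\Pi_j=\begin{bmatrix}I_{m_j}&0\\0&0\end{bmatrix}$. Let $\xi=(\xi_1,\dots,\xi_r)\in\mathrm T_P\mathrm{Gr}^{\times r}(\mathbf m,\mathbf n)$ be the solution of the Newton equation $$\mathbf H_{\rho_A}(P)\xi=-\operatorname{grad}\rho_A(P),$$ written as $\xi_j=\Theta_j\begin{bmatrix}0&Z_j\\Z_j^\dagger&0\end{bmatrix}\Theta_j^\dagger$ with $Z_j\in\mathbb{C}^{m_j\times(n_j-m_j)}$ (every tangent vector at $P$ has this form). Then set $$\Theta_j^{\mathrm{new}}:=\Theta_j\begin{bmatrix}I_{m_j}&-Z_j\\Z_j^\dagger&I_{n_j-m_j}\end{bmatrix}_Q,\qquad P_j^{\mathrm{new}}:=\Theta_j^{\mathrm{new}}\Pi_j(\Theta_j^{\mathrm{new}})^\dagger,\qquad j=1,\dots,r,$$ where $[X]_Q$ denotes the unitary factor $Q$ of the unique QR decomposition $X=QR$ of an invertible matrix $X$ ($R$ upper triangular with positive diagonal). The iteration is then repeated with $P:=P^{\mathrm{new}}$,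 $\Theta:=\Theta^{\mathrm{new}}$ (without a stopping criterion). Quadratic convergence of $P^{(k)}$ to $P^*$ means that $P^{(k)}\to P^*$ and there is a constant $C$ with $\|P^{(k+1)}-P^*\|\le C\|P^{(k)}-P^*\|^2$ for all $k$ (for the norm of $\mathfrak{her}_{n_1}\times\cdots\times\mathfrak{her}_{n_r}$). *)

theory Defs
  imports Complex_Main "Jordan_Normal_Form.Schur_Decomposition"
begin

section \<open>Matrices\<close>

text \<open>\<open>mat_adjoint\<close> is the conjugate transpose.\<close>

definition mtrace :: "complex mat \<Rightarrow> complex" where
  "mtrace X = (\<Sum>i<dim_row X. X $$ (i, i))"

definition herm :: "nat \<Rightarrow> complex mat set" where
  "herm n = {X \<in> carrier_mat n n. mat_adjoint X = X}"

definition unitary :: "nat \<Rightarrow> complex mat \<Rightarrow> bool" where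
  "unitary n U \<longleftrightarrow> U \<in> carrier_mat n n \<and> mat_adjoint U * U = 1\<^sub>m n \<and> U * mat_adjoint U = 1\<^sub>m n"

definition SU :: "nat \<Rightarrow> complex mat set" where
  "SU n = {U. unitary n U \<and> det U = 1}"

definition kronecker :: "complex mat \<Rightarrow> complex mat \<Rightarrow> complex mat" where
  "kronecker X Y = mat (dim_row X * dim_row Y) (dim_col X * dim_col Y)
     (\<lambda>(i, j). X $$ (i div dim_row Y, j div dim_col Y) * Y $$ (i mod dim_row Y, j mod dim_col Y))"

definition kronecker_list :: "complex mat list \<Rightarrow> complex mat" where
  "kronecker_list Xs = foldr kronecker Xs (1\<^sub>m 1)"

definition is_qr :: "nat \<Rightarrow> complex mat \<Rightarrow> complex mat \<Rightarrow> complex mat \<Rightarrow> bool" where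
  "is_qr n X Q R \<longleftrightarrow> unitary n Q \<and> R \<in> carrier_mat n n \<and> upper_triangular R
     \<and> (\<forall>i<n. R $$ (i, i) \<in> \<real> \<and> 0 < Re (R $$ (i, i))) \<and> X = Q * R"


section \<open>Tuples of Hermitian matrices as a Euclidean space\<close>

text \<open>An \<open>r\<close>-tuple of matrices, of sizes that may differ, is a list of length \<open>r\<close>.\<close>

type_synonym mtuple = "complex mat list"

definition her_prod :: "nat list \<Rightarrow> mtuple set" where
  "her_prod ns = {Xs. list_all2 (\<lambda>X n. X \<in> herm n) Xs ns}"

definition tadd :: "mtuple \<Rightarrow> mtuple \<Rightarrow> mtuple" where
  "tadd Xs Ys = map2 (+) Xs Ys"

definition tdiff :: "mtuple \<Rightarrow> mtuple \<Rightarrow> mtuple" where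
  "tdiff Xs Ys = map2 (-) Xs Ys"

definition tscale :: "real \<Rightarrow> mtuple \<Rightarrow> mtuple" where
  "tscale c Xs = map (\<lambda>X. complex_of_real c \<cdot>\<^sub>m X) Xs"

text \<open>The real part discards nothing: \<open>tr (X Y)\<close> is real for Hermitian \<open>X\<close> and \<open>Y\<close>.\<close>

definition tinner :: "mtuple \<Rightarrow> mtuple \<Rightarrow> real" where
  "tinner Xs Ys = Re (\<Sum>j<length Xs. mtrace (Xs ! j * Ys ! j))"

definition tnorm :: "mtuple \<Rightarrow> real" where
  "tnorm Xs = sqrt (tinner Xs Xs)"

definition tdist :: "mtuple \<Rightarrow> mtuple \<Rightarrow> real" where
  "tdist Xs Ys = tnorm (tdiff Xs Ys)"


section \<open>Submanifolds of a Euclidean space of tuples\<close>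

text \<open>
  Throughout, \<open>E\<close> is the ambient space (some \<open>her_prod ns\<close>) and \<open>M\<close> a smooth embedded
  submanifold of \<open>E\<close>, with the metric induced by \<open>tinner\<close>.
\<close>

definition open_in :: "mtuple set \<Rightarrow> mtuple set \<Rightarrow> bool" where
  "open_in E U \<longleftrightarrow> U \<subseteq> E \<and> (\<forall>X\<in>U. \<exists>e>0. \<forall>Y\<in>E. tdist Y X < e \<longrightarrow> Y \<in> U)"

definition continuous_fun_on :: "mtuple set \<Rightarrow> (mtuple \<Rightarrow> real) \<Rightarrow> bool" where
  "continuous_fun_on U f \<longleftrightarrow>
     (\<forall>X\<in>U. \<forall>e>0. \<exists>d>0. \<forall>Y\<in>U. tdist Y X < d \<longrightarrow> \<bar>f Y - f X\<bar> < e)"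

text \<open>
  Being \<open>C\<^sup>\<infinity>\<close> on an open subset \<open>U\<close> of \<open>E\<close>: all iterated directional derivatives exist and
  are continuous. \<open>F [v\<^sub>k, \<dots>, v\<^sub>1]\<close> is the derivative of \<open>f\<close> along \<open>v\<^sub>1\<close>, then \<open>v\<^sub>2\<close>, and so on.
\<close>

definition smooth_fun_open :: "mtuple set \<Rightarrow> mtuple set \<Rightarrow> (mtuple \<Rightarrow> real) \<Rightarrow> bool" where
  "smooth_fun_open E U f \<longleftrightarrow> (\<exists>F :: mtuple list \<Rightarrow> mtuple \<Rightarrow> real. F [] = f \<and>
     (\<forall>vs. set vs \<subseteq> E \<longrightarrow> continuous_fun_on U (F vs) \<and>
        (\<forall>v\<in>E. \<forall>X\<in>U.
           ((\<lambda>t. F vs (tadd X (tscale t v))) has_real_derivative F (v # vs) X) (at 0))))"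

definition smooth_fun :: "mtuple set \<Rightarrow> mtuple set \<Rightarrow> (mtuple \<Rightarrow> real) \<Rightarrow> bool" where
  "smooth_fun E M f \<longleftrightarrow>
     (\<forall>P\<in>M. \<exists>U g. open_in E U \<and> P \<in> U \<and> smooth_fun_open E U g \<and> (\<forall>Q\<in>M \<inter> U. g Q = f Q))"

definition has_velocity :: "(real \<Rightarrow> mtuple) \<Rightarrow> mtuple \<Rightarrow> real \<Rightarrow> bool" where
  "has_velocity c v t \<longleftrightarrow>
     ((\<lambda>s. tdist (tscale (1 / (s - t)) (tdiff (c s) (c t))) v) \<longlongrightarrow> 0) (at t)"

definition smooth_curve_on :: "mtuple set \<Rightarrow> real set \<Rightarrow> (real \<Rightarrow> mtuple) \<Rightarrow> bool" where
  "smooth_curve_on E S c \<longleftrightarrow> (\<exists>D :: nat \<Rightarrow> real \<Rightarrow> mtuple. D 0 = c \<and>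
     (\<forall>k. \<forall>t\<in>S. D k t \<in> E \<and> has_velocity (D k) (D (Suc k) t) t))"

definition curve_through ::
    "mtuple set \<Rightarrow> mtuple set \<Rightarrow> mtuple \<Rightarrow> mtuple \<Rightarrow> (real \<Rightarrow> mtuple) \<Rightarrow> bool" where
  "curve_through E M P v c \<longleftrightarrow>
     (\<exists>e>0. smooth_curve_on E {-e<..<e} c \<and> (\<forall>t\<in>{-e<..<e}. c t \<in> M))
     \<and> c 0 = P \<and> has_velocity c v 0"

definition tangent :: "mtuple set \<Rightarrow> mtuple set \<Rightarrow> mtuple \<Rightarrow> mtuple set" where
  "tangent E M P = {v \<in> E. \<exists>c. curve_through E M P v c}"

definition dir_deriv ::
    "mtuple set \<Rightarrow> mtuple set \<Rightarrow> (mtuple \<Rightarrow> real) \<Rightarrow> mtuple \<Rightarrow> mtuple \<Rightarrow> real" where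
  "dir_deriv E M f P v =
     (THE d. \<forall>c. curve_through E M P v c \<longrightarrow> ((\<lambda>t. f (c t)) has_real_derivative d) (at 0))"

text \<open>Fields and functions are total; only their values on \<open>M\<close> are meaningful.\<close>

definition vector_field :: "mtuple set \<Rightarrow> mtuple set \<Rightarrow> (mtuple \<Rightarrow> mtuple) \<Rightarrow> bool" where
  "vector_field E M X \<longleftrightarrow> (\<forall>P\<in>M. X P \<in> tangent E M P)
     \<and> (\<forall>v\<in>E. smooth_fun E M (\<lambda>P. tinner (X P) v))"


section \<open>Levi-Civita connection, gradient and Hessian\<close>

text \<open>
  \<open>nab P \<xi> Y\<close> stands for the covariant derivative of the field \<open>Y\<close> at \<open>P\<close> in direction \<open>\<xi>\<close>.
  Linearity over smooth functions in the first argument is built into the pointwise dependence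
  on \<open>\<xi>\<close>.
\<close>

type_synonym conn = "mtuple \<Rightarrow> mtuple \<Rightarrow> (mtuple \<Rightarrow> mtuple) \<Rightarrow> mtuple"

definition affine_connection :: "mtuple set \<Rightarrow> mtuple set \<Rightarrow> conn \<Rightarrow> bool" where
  "affine_connection E M nab \<longleftrightarrow>
     (\<forall>X Y. vector_field E M X \<and> vector_field E M Y \<longrightarrow> vector_field E M (\<lambda>P. nab P (X P) Y)) \<and>
     (\<forall>P\<in>M. \<forall>\<xi>\<in>tangent E M P. \<forall>Y. vector_field E M Y \<longrightarrow> nab P \<xi> Y \<in> tangent E M P) \<and>
     (\<forall>P\<in>M. \<forall>\<xi>\<in>tangent E M P. \<forall>\<eta>\<in>tangent E M P. \<forall>a b Y. vector_field E M Y \<longrightarrow>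
        nab P (tadd (tscale a \<xi>) (tscale b \<eta>)) Y
          = tadd (tscale a (nab P \<xi> Y)) (tscale b (nab P \<eta> Y))) \<and>
     (\<forall>P\<in>M. \<forall>\<xi>\<in>tangent E M P. \<forall>Y Z. vector_field E M Y \<and> vector_field E M Z \<longrightarrow>
        nab P \<xi> (\<lambda>Q. tadd (Y Q) (Z Q)) = tadd (nab P \<xi> Y) (nab P \<xi> Z)) \<and>
     (\<forall>P\<in>M. \<forall>\<xi>\<in>tangent E M P. \<forall>f Y. smooth_fun E M f \<and> vector_field E M Y \<longrightarrow>
        nab P \<xi> (\<lambda>Q. tscale (f Q) (Y Q))
          = tadd (tscale (dir_deriv E M f P \<xi>) (Y P)) (tscale (f P) (nab P \<xi> Y)))"

text \<open>
  Torsion-freeness, \<open>\<nabla>\<^sub>X Y - \<nabla>\<^sub>Y X = [X, Y]\<close>, is stated as an equality of derivations, with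
  \<open>[X, Y] f = X (Y f) - Y (X f)\<close>.
\<close>

definition torsion_free :: "mtuple set \<Rightarrow> mtuple set \<Rightarrow> conn \<Rightarrow> bool" where
  "torsion_free E M nab \<longleftrightarrow>
     (\<forall>X Y f. vector_field E M X \<and> vector_field E M Y \<and> smooth_fun E M f \<longrightarrow>
       (\<forall>P\<in>M. dir_deriv E M f P (tdiff (nab P (X P) Y) (nab P (Y P) X))
          = dir_deriv E M (\<lambda>Q. dir_deriv E M f Q (Y Q)) P (X P)
            - dir_deriv E M (\<lambda>Q. dir_deriv E M f Q (X Q)) P (Y P)))"

definition metric_compatible :: "mtuple set \<Rightarrow> mtuple set \<Rightarrow> conn \<Rightarrow> bool" where
  "metric_compatible E M nab \<longleftrightarrow>
     (\<forall>Y Z. vector_field E M Y \<and> vector_field E M Z \<longrightarrow>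
       (\<forall>P\<in>M. \<forall>\<xi>\<in>tangent E M P.
          dir_deriv E M (\<lambda>Q. tinner (Y Q) (Z Q)) P \<xi>
            = tinner (nab P \<xi> Y) (Z P) + tinner (Y P) (nab P \<xi> Z)))"

definition levi_civita :: "mtuple set \<Rightarrow> mtuple set \<Rightarrow> conn \<Rightarrow> bool" where
  "levi_civita E M nab \<longleftrightarrow>
     affine_connection E M nab \<and> torsion_free E M nab \<and> metric_compatible E M nab"

definition rgrad :: "mtuple set \<Rightarrow> mtuple set \<Rightarrow> (mtuple \<Rightarrow> real) \<Rightarrow> mtuple \<Rightarrow> mtuple" where
  "rgrad E M f P =
     (THE g. g \<in> tangent E M P \<and> (\<forall>\<xi>\<in>tangent E M P. tinner g \<xi> = dir_deriv E M f P \<xi>))"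

definition rhess ::
    "mtuple set \<Rightarrow> mtuple set \<Rightarrow> conn \<Rightarrow> (mtuple \<Rightarrow> real) \<Rightarrow> mtuple \<Rightarrow> mtuple \<Rightarrow> mtuple" where
  "rhess E M nab f P \<xi> = nab P \<xi> (rgrad E M f)"

definition critical_point :: "mtuple set \<Rightarrow> mtuple set \<Rightarrow> (mtuple \<Rightarrow> real) \<Rightarrow> mtuple \<Rightarrow> bool" where
  "critical_point E M f P \<longleftrightarrow> P \<in> M \<and> (\<forall>\<xi>\<in>tangent E M P. dir_deriv E M f P \<xi> = 0)"

definition nondegenerate_critical_point ::
    "mtuple set \<Rightarrow> mtuple set \<Rightarrow> conn \<Rightarrow> (mtuple \<Rightarrow> real) \<Rightarrow> mtuple \<Rightarrow> bool" where
  "nondegenerate_critical_point E M nab f P \<longleftrightarrow> critical_point E M f P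
     \<and> bij_betw (rhess E M nab f P) (tangent E M P) (tangent E M P)"


section \<open>Products of Grassmannians and the generalized Rayleigh-quotient\<close>

definition Gr :: "nat \<Rightarrow> nat \<Rightarrow> complex mat set" where
  "Gr m n = {P \<in> carrier_mat n n. mat_adjoint P = P \<and> P * P = P \<and> mtrace P = of_nat m}"

text \<open>The list \<open>mns\<close> is \<open>[(m\<^sub>1, n\<^sub>1), \<dots>, (m\<^sub>r, n\<^sub>r)]\<close>.\<close>

definition ambient :: "(nat \<times> nat) list \<Rightarrow> mtuple set" where
  "ambient mns = her_prod (map snd mns)"

definition Gr_prod :: "(nat \<times> nat) list \<Rightarrow> mtuple set" where
  "Gr_prod mns = {Ps. list_all2 (\<lambda>P (m, n). P \<in> Gr m n) Ps mns}"

text \<open>The trace is real for Hermitian \<open>A\<close>.\<close>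

definition rayleigh :: "complex mat \<Rightarrow> mtuple \<Rightarrow> real" where
  "rayleigh A Ps = Re (mtrace (A * kronecker_list Ps))"


section \<open>The N-like algorithm\<close>

definition std_proj :: "nat \<Rightarrow> nat \<Rightarrow> complex mat" where
  "std_proj m n = four_block_mat (1\<^sub>m m) (0\<^sub>m m (n - m)) (0\<^sub>m (n - m) m) (0\<^sub>m (n - m) (n - m))"

definition tangent_block :: "nat \<Rightarrow> nat \<Rightarrow> complex mat \<Rightarrow> complex mat" where
  "tangent_block m n Z = four_block_mat (0\<^sub>m m m) Z (mat_adjoint Z) (0\<^sub>m (n - m) (n - m))"

definition update_block :: "nat \<Rightarrow> nat \<Rightarrow> complex mat \<Rightarrow> complex mat" where
  "update_block m n Z = four_block_mat (1\<^sub>m m) (- Z) (mat_adjoint Z) (1\<^sub>m (n - m))"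

definition frame :: "(nat \<times> nat) list \<Rightarrow> mtuple \<Rightarrow> mtuple \<Rightarrow> bool" where
  "frame mns \<Theta> P \<longleftrightarrow> length \<Theta> = length mns \<and> length P = length mns \<and>
     (\<forall>j<length mns. case mns ! j of (m, n) \<Rightarrow>
        \<Theta> ! j \<in> SU n \<and> P ! j = \<Theta> ! j * std_proj m n * mat_adjoint (\<Theta> ! j))"

definition newton_solution ::
    "conn \<Rightarrow> (nat \<times> nat) list \<Rightarrow> complex mat \<Rightarrow> mtuple \<Rightarrow> mtuple \<Rightarrow> bool" where
  "newton_solution nab mns A P \<xi> \<longleftrightarrow>
     \<xi> \<in> tangent (ambient mns) (Gr_prod mns) P \<and>
     rhess (ambient mns) (Gr_prod mns) nab (rayleigh A) P \<xi>
       = tscale (-1) (rgrad (ambient mns) (Gr_prod mns) (rayleigh A) P)"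

text \<open>
  One iteration, from \<open>(\<Theta>, P)\<close> to \<open>(\<Theta>', P')\<close>. The algorithm speaks of ``the'' solution of the
  Newton equation, so a step is only possible where that equation is uniquely solvable.
\<close>

definition nlike_step ::
    "conn \<Rightarrow> (nat \<times> nat) list \<Rightarrow> complex mat \<Rightarrow> mtuple \<Rightarrow> mtuple \<Rightarrow> mtuple \<Rightarrow> mtuple \<Rightarrow> bool" where
  "nlike_step nab mns A \<Theta> P \<Theta>' P' \<longleftrightarrow>
     frame mns \<Theta> P \<and> (\<exists>!\<xi>. newton_solution nab mns A P \<xi>) \<and>
     length \<Theta>' = length mns \<and> length P' = length mns \<and>
     (\<exists>\<xi> Z. newton_solution nab mns A P \<xi> \<and> length Z = length mns \<and>
        (\<forall>j<length mns. case mns ! j of (m, n) \<Rightarrow>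
           Z ! j \<in> carrier_mat m (n - m) \<and>
           \<xi> ! j = \<Theta> ! j * tangent_block m n (Z ! j) * mat_adjoint (\<Theta> ! j) \<and>
           (\<exists>Q R. is_qr n (update_block m n (Z ! j)) Q R \<and> \<Theta>' ! j = \<Theta> ! j * Q) \<and>
           P' ! j = \<Theta>' ! j * std_proj m n * mat_adjoint (\<Theta>' ! j)))"

definition nlike_run ::
    "conn \<Rightarrow> (nat \<times> nat) list \<Rightarrow> complex mat \<Rightarrow> (nat \<Rightarrow> mtuple) \<Rightarrow> (nat \<Rightarrow> mtuple) \<Rightarrow> bool" where
  "nlike_run nab mns A \<Theta> P \<longleftrightarrow> (\<forall>k. nlike_step nab mns A (\<Theta> k) (P k) (\<Theta> (Suc k)) (P (Suc k)))"

definition converges_quadratically :: "(nat \<Rightarrow> mtuple) \<Rightarrow> mtuple \<Rightarrow> bool" where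
  "converges_quadratically P L \<longleftrightarrow>
     (\<lambda>k. tdist (P k) L) \<longlonglongrightarrow> 0 \<and> (\<exists>C. \<forall>k. tdist (P (Suc k)) L \<le> C * (tdist (P k) L)\<^sup>2)"

end

(*
  On the product of Grassmannians the Riemannian gradient is the tangential part of the Euclidean
  gradient, and comparing an arbitrary Levi-Civita connection with the tangential part of the
  ambient derivative shows that the two agree on polynomial vector fields. So the Newton equation
  is an explicit polynomial equation in P, and expanding the gradient at P* to second order shows
  that its solution approximates the tangential part of P* - P up to O(|P - P*|^2); the Hessian is
  uniformly invertible near P* by perturbation. The QR update is a second-order retraction: the
  new projector P' satisfies P' (1 + xi) P = (1 + xi) P, which together with equality of ranks
  gives P' = P + xi + O(|xi|^2).
*)

theory Submission
  imports Defs "HOL-Analysis.Convex"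
begin

text \<open>The connection is an arbitrary one satisfying the Levi-Civita axioms, and it acts only
  on vector fields defined on the whole manifold. Each tangent vector therefore has to be extended
  to a global field whose ambient derivative is known; \<open>tproj x u\<close> with constant
  \<open>u\<close> is such an extension, polynomial in \<open>x\<close>. Tangent vectors are in turn
  velocities of smooth curves, so actual curves must be supplied: v is the velocity at 0 of exp(t w)
  p exp(-t w) with w = v p - p v, because then w p - p w = v. Matrix sizes are data, so
  finite-dimensional facts are read off a finite orthonormal basis of matrix units. Equality of
  ranks enters through the norm: a projector satisfies |p|^2 = tr p, so all points of the manifold
  have the same norm, and then |p' - p|^2 = 2 |p' p - p|^2 controls the distance by what is visible
  on the range of p. The iteration also has to stay inside the special unitary group. The update
  block has positive determinant, so its unitary QR factor has determinant 1.\<close>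

lemma norm_sum_mult_square_le:
  fixes x y :: "nat \<Rightarrow> complex"
  shows "(norm (\<Sum>c\<in>S. x c * y c))\<^sup>2
      \<le> (\<Sum>c\<in>S. (norm (x c))\<^sup>2) * (\<Sum>c\<in>S. (norm (y c))\<^sup>2)"
proof -
  have "norm (\<Sum>c\<in>S. x c * y c) \<le> (\<Sum>c\<in>S. norm (x c) * norm (y c))"
    by (rule order_trans[OF norm_sum]) (simp add: norm_mult)
  then have "(norm (\<Sum>c\<in>S. x c * y c))\<^sup>2 \<le> (\<Sum>c\<in>S. norm (x c) * norm (y c))\<^sup>2"
    by (intro power_mono) auto
  also have "\<dots> \<le> (\<Sum>c\<in>S. (norm (x c))\<^sup>2) * (\<Sum>c\<in>S. (norm (y c))\<^sup>2)"
    by (rule Cauchy_Schwarz_ineq_sum)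
  finally show ?thesis .
qed

section \<open>An algebra containing all tuples of matrices\<close>

text \<open>
  The sizes of the matrices are not types, so tuples are embedded in one type: \<open>ent x j a b\<close> is
  entry \<open>(a, b)\<close> of the \<open>j\<close>-th matrix. This makes the class hierarchy of normed algebras and
  inner product spaces available; there is no unit, and the type is not complete.
\<close>

typedef fmat = "{f :: nat \<Rightarrow> nat \<Rightarrow> nat \<Rightarrow> complex.
    \<exists>N. \<forall>j a b. f j a b \<noteq> 0 \<longrightarrow> j < N \<and> a < N \<and> b < N}"
  morphisms ent Abs_fmat
  by (rule exI[of _ "\<lambda>j a b. 0"]) auto

setup_lifting type_definition_fmat

text \<open>An explicit bound on the support. Fixing one \<open>N\<close> for all elements of a
  computation replaces sums over varying supports by sums over one cube, which can be split and
  swapped.\<close>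

definition bnd :: "nat \<Rightarrow> fmat \<Rightarrow> bool" where
  "bnd N x \<longleftrightarrow> (\<forall>j a b. ent x j a b \<noteq> 0 \<longrightarrow> j < N \<and> a < N \<and> b < N)"

lemma bnd_ex: "\<exists>N. bnd N x"
  using ent[of x] by (auto simp: bnd_def)

lemma bnd_mono: "bnd N x \<Longrightarrow> N \<le> N' \<Longrightarrow> bnd N' x"
  unfolding bnd_def by (meson order_less_le_trans)

lemma bnd_ex2: "\<exists>N. bnd N x \<and> bnd N y"
proof -
  obtain N M where "bnd N x" "bnd M y" using bnd_ex by blast
  then have "bnd (max N M) x" "bnd (max N M) y" by (auto elim: bnd_mono)
  then show ?thesis by blast
qed

lemma bnd_ex3: "\<exists>N. bnd N x \<and> bnd N y \<and> bnd N z"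
proof -
  obtain N M where "bnd N x \<and> bnd N y" "bnd M z" using bnd_ex bnd_ex2 by blast
  then have "bnd (max N M) x" "bnd (max N M) y" "bnd (max N M) z" by (auto elim: bnd_mono)
  then show ?thesis by blast
qed

lemma fmat_eqI: "(\<And>j a b. ent x j a b = ent y j a b) \<Longrightarrow> x = y"
  by (metis ent_inject ext)

lemma bnd_zeroD: "bnd N x \<Longrightarrow> \<not> (j < N \<and> a < N \<and> b < N) \<Longrightarrow> ent x j a b = 0"
  by (auto simp: bnd_def)

instantiation fmat :: real_vector
begin

lift_definition zero_fmat :: fmat is "\<lambda>j a b. 0" by auto

lift_definition plus_fmat :: "fmat \<Rightarrow> fmat \<Rightarrow> fmat" is "\<lambda>f g j a b. f j a b + g j a b"
proof -
  fix f g :: "nat \<Rightarrow> nat \<Rightarrow> nat \<Rightarrow> complex"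
  assume "\<exists>N. \<forall>j a b. f j a b \<noteq> 0 \<longrightarrow> j < N \<and> a < N \<and> b < N"
    "\<exists>N. \<forall>j a b. g j a b \<noteq> 0 \<longrightarrow> j < N \<and> a < N \<and> b < N"
  then obtain N M where "\<forall>j a b. f j a b \<noteq> 0 \<longrightarrow> j < N \<and> a < N \<and> b < N"
    "\<forall>j a b. g j a b \<noteq> 0 \<longrightarrow> j < M \<and> a < M \<and> b < M" by blast
  then have "\<forall>j a b. f j a b + g j a b \<noteq> 0
      \<longrightarrow> j < max N M \<and> a < max N M \<and> b < max N M"
    by (metis add.right_neutral add.left_neutral less_max_iff_disj)
  then show "\<exists>N. \<forall>j a b. f j a b + g j a b \<noteq> 0
      \<longrightarrow> j < N \<and> a < N \<and> b < N" by blast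
qed

lift_definition uminus_fmat :: "fmat \<Rightarrow> fmat" is "\<lambda>f j a b. - f j a b" by auto

definition minus_fmat :: "fmat \<Rightarrow> fmat \<Rightarrow> fmat" where "minus_fmat x y = x + - y"

lift_definition scaleR_fmat :: "real \<Rightarrow> fmat \<Rightarrow> fmat" is
    "\<lambda>c f j a b. complex_of_real c * f j a b"
  by (simp only: mult_eq_0_iff de_Morgan_disj) blast

instance
proof
  fix x y z :: fmat and c d :: real
  note reps = plus_fmat.rep_eq uminus_fmat.rep_eq zero_fmat.rep_eq scaleR_fmat.rep_eq
  show "x + y + z = x + (y + z)" by (rule fmat_eqI) (simp add: reps)
  show "x + y = y + x" by (rule fmat_eqI) (simp add: reps)
  show "0 + x = x" by (rule fmat_eqI) (simp add: reps)
  show "- x + x = 0" by (rule fmat_eqI) (simp add: reps)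
  show "x - y = x + - y" by (rule minus_fmat_def)
  show "c *\<^sub>R (x + y) = c *\<^sub>R x + c *\<^sub>R y" by (rule fmat_eqI) (simp add: reps distrib_left)
  show "(c + d) *\<^sub>R x = c *\<^sub>R x + d *\<^sub>R x" by (rule fmat_eqI) (simp add: reps distrib_right)
  show "c *\<^sub>R d *\<^sub>R x = (c * d) *\<^sub>R x" by (rule fmat_eqI) (simp add: reps)
  show "1 *\<^sub>R x = x" by (rule fmat_eqI) (simp add: reps)
qed

end

lemma ent_simps [simp]: "ent 0 j a b = 0" "ent (x + y) j a b = ent x j a b + ent y j a b"
  "ent (- x) j a b = - ent x j a b" "ent (x - y) j a b = ent x j a b - ent y j a b"
  "ent (c *\<^sub>R x) j a b = complex_of_real c * ent x j a b"
  unfolding minus_fmat_def plus_fmat.rep_eq uminus_fmat.rep_eq zero_fmat.rep_eq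
      scaleR_fmat.rep_eq by simp_all

lemma bnd_iff: "bnd N x \<longleftrightarrow> (\<forall>j a b. \<not> (j < N \<and> a < N \<and> b < N) \<longrightarrow> ent x j a b = 0)"
  by (auto simp: bnd_def)

lemma bnd_simps: "bnd N 0" "bnd N x \<Longrightarrow> bnd N y
    \<Longrightarrow> bnd N (x + y)" "bnd N x \<Longrightarrow> bnd N (c *\<^sub>R x)"
  "bnd N x \<Longrightarrow> bnd N y \<Longrightarrow> bnd N (x - y)"
  by (simp_all add: bnd_iff)

abbreviation cube :: "nat \<Rightarrow> (nat \<times> nat \<times> nat) set" where
  "cube N \<equiv> {..<N} \<times> {..<N} \<times> {..<N}"

instantiation fmat :: real_normed_algebra
begin

text \<open>The sum runs over the support of a row of the left factor, which is finite without
  choosing a bound; \<open>ent_mult_bnd\<close> exchanges it for any bound of that factor.\<close>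

lift_definition times_fmat :: "fmat \<Rightarrow> fmat \<Rightarrow> fmat" is
  "\<lambda>f g j a b. \<Sum>c | f j a c \<noteq> 0. f j a c * g j c b"
proof -
  fix f g :: "nat \<Rightarrow> nat \<Rightarrow> nat \<Rightarrow> complex"
  assume "\<exists>N. \<forall>j a b. f j a b \<noteq> 0 \<longrightarrow> j < N \<and> a < N \<and> b < N"
    "\<exists>N. \<forall>j a b. g j a b \<noteq> 0 \<longrightarrow> j < N \<and> a < N \<and> b < N"
  then obtain N M where NM: "\<forall>j a b. f j a b \<noteq> 0 \<longrightarrow> j < N \<and> a < N \<and> b < N"
    "\<forall>j a b. g j a b \<noteq> 0 \<longrightarrow> j < M \<and> a < M \<and> b < M" by blast
  show "\<exists>N. \<forall>j a b. (\<Sum>c | f j a c \<noteq> 0. f j a c * g j c b) \<noteq> 0 \<longrightarrow> j < N \<and> a < N \<and> b < N"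
  proof (intro exI[of _ "max N M"] allI impI)
    fix j a b
    assume "(\<Sum>c | f j a c \<noteq> 0. f j a c * g j c b) \<noteq> 0"
    then obtain c where "f j a c * g j c b \<noteq> 0" by (meson sum.not_neutral_contains_not_neutral)
    then have "f j a c \<noteq> 0" "g j c b \<noteq> 0" by auto
    with NM show "j < max N M \<and> a < max N M \<and> b < max N M" by (meson less_max_iff_disj)
  qed
qed

text \<open>The Frobenius inner product. It has a name of its own because the norm, needed for the
  class of normed algebras, is derived from it before the inner product class is
  instantiated.\<close>

definition inner_sum_fmat :: "fmat \<Rightarrow> fmat \<Rightarrow> real" where
  "inner_sum_fmat x y = (\<Sum>(j, a, b) | ent x j a b \<noteq> 0. Re (ent x j a b * cnj (ent y j a b)))"

definition norm_fmat :: "fmat \<Rightarrow> real" where "norm_fmat x = sqrt (inner_sum_fmat x x)"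
definition dist_fmat :: "fmat \<Rightarrow> fmat \<Rightarrow> real" where "dist_fmat x y = norm (x - y)"
definition sgn_fmat :: "fmat \<Rightarrow> fmat" where "sgn_fmat x = x /\<^sub>R norm x"
definition uniformity_fmat :: "(fmat \<times> fmat) filter" where
  "uniformity_fmat = (INF e\<in>{0<..}. principal {(x, y). dist x y < e})"
definition open_fmat :: "fmat set \<Rightarrow> bool" where
  "open_fmat U \<longleftrightarrow> (\<forall>x\<in>U. \<forall>\<^sub>F (x', y) in uniformity. x'
      = x \<longrightarrow> y \<in> U)"

lemma inner_sum_eq:
  assumes "bnd N x"
  shows "inner_sum_fmat x y = (\<Sum>(j, a, b)\<in>cube N. Re (ent x j a b * cnj (ent y j a b)))"
  unfolding inner_sum_fmat_def
  using assms by (intro sum.mono_neutral_left) (auto simp: bnd_def)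

lemma ent_mult_bnd:
  assumes "bnd N x"
  shows "ent (x * y) j a b = (\<Sum>c<N. ent x j a c * ent y j c b)"
  unfolding times_fmat.rep_eq
  using assms by (intro sum.mono_neutral_left) (auto simp: bnd_def)

lemma bnd_mult: assumes "bnd N x" "bnd N y" shows "bnd N (x * y)"
  unfolding bnd_def
proof (intro allI impI)
  fix j a b
  assume "ent (x * y) j a b \<noteq> 0"
  then obtain c where "ent x j a c * ent y j c b \<noteq> 0"
    unfolding ent_mult_bnd[OF assms(1)] by (meson sum.not_neutral_contains_not_neutral)
  then have "ent x j a c \<noteq> 0" "ent y j c b \<noteq> 0" by auto
  with assms show "j < N \<and> a < N \<and> b < N" by (auto simp: bnd_def)
qed

lemma inner_sum_self:
  assumes "bnd N x"
  shows "inner_sum_fmat x x = (\<Sum>j<N. \<Sum>a<N. \<Sum>b<N. (norm (ent x j a b))\<^sup>2)"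
proof -
  have "Re (z * cnj z) = (norm z)\<^sup>2" for z
    by (simp only: cmod_power2) (simp add: power2_eq_square)
  then show ?thesis
    unfolding inner_sum_eq[OF assms] by (simp add: sum.cartesian_product split_def)
qed

lemma inner_sum_props:
  "inner_sum_fmat x y = inner_sum_fmat y x"
  "inner_sum_fmat (x + y) z = inner_sum_fmat x z + inner_sum_fmat y z"
  "inner_sum_fmat (c *\<^sub>R x) z = c * inner_sum_fmat x z"
  "0 \<le> inner_sum_fmat x x" "inner_sum_fmat x x = 0 \<longleftrightarrow> x = 0"
proof -
  obtain N where N: "bnd N x" "bnd N y" "bnd N z" using bnd_ex3 by blast
  show "inner_sum_fmat x y = inner_sum_fmat y x"
    by (simp add: inner_sum_eq[OF N(1)] inner_sum_eq[OF N(2)] mult.commute)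
  show "inner_sum_fmat (x + y) z = inner_sum_fmat x z + inner_sum_fmat y z"
    unfolding inner_sum_eq[OF N(1)] inner_sum_eq[OF N(2)] inner_sum_eq[OF bnd_simps(2)[OF N(1,2)]]
    by (simp only: ent_simps split_def distrib_right plus_complex.sel sum.distrib)
  show "inner_sum_fmat (c *\<^sub>R x) z = c * inner_sum_fmat x z"
    unfolding inner_sum_eq[OF N(1)] inner_sum_eq[OF bnd_simps(3)[OF N(1)]]
    by (simp add: sum_distrib_left split_def algebra_simps)
  show "0 \<le> inner_sum_fmat x x" unfolding inner_sum_self[OF N(1)] by (intro sum_nonneg) auto
  show "inner_sum_fmat x x = 0 \<longleftrightarrow> x = 0"
  proof
    assume "inner_sum_fmat x x = 0"
    then have "\<forall>j<N. \<forall>a<N. \<forall>b<N. ent x j a b = 0"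
      unfolding inner_sum_self[OF N(1)] by (simp add: sum_nonneg_eq_0_iff sum_nonneg)
    then show "x = 0" using N(1) by (intro fmat_eqI) (metis bnd_zeroD ent_simps(1))
  qed (simp add: inner_sum_fmat_def)
qed

text \<open>Cauchy-Schwarz for each entry bounds block j of the product by the squared norms of the
  two j-th blocks; bounding the block of \<open>y\<close> by all of \<open>y\<close> lets the sum
  over j factor.\<close>

lemma norm_fmat_mult: "norm (x * y) \<le> norm x * norm (y :: fmat)"
proof -
  obtain N where N: "bnd N x" "bnd N y" using bnd_ex2 by blast
  have "inner_sum_fmat (x * y) (x * y)
      \<le> (\<Sum>j<N. \<Sum>a<N. \<Sum>b<N. (\<Sum>c<N. (norm (ent x j a c))\<^sup>2) * (\<Sum>c<N. (norm (ent y j c b))\<^sup>2))"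
    unfolding inner_sum_self[OF bnd_mult[OF N]] ent_mult_bnd[OF N(1)]
    by (intro sum_mono norm_sum_mult_square_le)
  also have "\<dots> = (\<Sum>j<N. (\<Sum>a<N. \<Sum>c<N. (norm (ent x j a c))\<^sup>2) * (\<Sum>b<N. \<Sum>c<N. (norm (ent y j c b))\<^sup>2))"
    by (simp add: sum_product)
  also have "\<dots> = (\<Sum>j<N. (\<Sum>a<N. \<Sum>c<N. (norm (ent x j a c))\<^sup>2) * (\<Sum>c<N. \<Sum>b<N. (norm (ent y j c b))\<^sup>2))"
    by (intro sum.cong refl arg_cong2[where f = "(*)"] sum.swap)
  also have "\<dots> \<le> (\<Sum>j<N. (\<Sum>a<N. \<Sum>c<N. (norm (ent x j a c))\<^sup>2) * inner_sum_fmat y y)"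
    unfolding inner_sum_self[OF N(2)]
    by (intro sum_mono mult_left_mono member_le_sum sum_nonneg) (auto intro!: sum_nonneg)
  also have "\<dots> = inner_sum_fmat x x * inner_sum_fmat y y"
    unfolding inner_sum_self[OF N(1)] by (simp add: sum_distrib_right)
  finally show ?thesis
    unfolding norm_fmat_def by (metis real_sqrt_le_mono real_sqrt_mult)
qed

instance
proof
  fix x y z :: fmat and c :: real
  show "x * y * z = x * (y * z)"
  proof (rule fmat_eqI)
    fix j a b
    obtain N where N: "bnd N x" "bnd N y" using bnd_ex2 by blast
    show "ent (x * y * z) j a b = ent (x * (y * z)) j a b"
      unfolding ent_mult_bnd[OF N(1)] ent_mult_bnd[OF N(2)] ent_mult_bnd[OF bnd_mult[OF N]]
      sum_distrib_left sum_distrib_right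
      by (subst sum.swap) (simp add: mult.assoc)
  qed
  obtain N where N: "bnd N x" "bnd N y" using bnd_ex2 by blast
  show "(x + y) * z = x * z + y * z"
    by (rule fmat_eqI) (simp only: ent_simps ent_mult_bnd[OF N(1)] ent_mult_bnd[OF N(2)]
        ent_mult_bnd[OF bnd_simps(2)[OF N]] sum.distrib distrib_right)
  show "x * (y + z) = x * y + x * z"
    by (rule fmat_eqI) (simp only: ent_simps ent_mult_bnd[OF N(1)] sum.distrib distrib_left)
  show "(c *\<^sub>R x) * y = c *\<^sub>R (x * y)"
    by (rule fmat_eqI) (simp add: ent_mult_bnd[OF N(1)] ent_mult_bnd[OF bnd_simps(3)[OF N(1)]]
        sum_distrib_left mult.assoc)
  show "x * (c *\<^sub>R y) = c *\<^sub>R (x * y)"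
    by (rule fmat_eqI) (simp add: ent_mult_bnd[OF N(1)] sum_distrib_left mult_ac)
  show "norm x = 0 \<longleftrightarrow> x = 0" unfolding norm_fmat_def by (simp add: inner_sum_props)
  show "norm (c *\<^sub>R x) = \<bar>c\<bar> * norm x"
  proof -
    have "inner_sum_fmat (c *\<^sub>R x) (c *\<^sub>R x) = c\<^sup>2 * inner_sum_fmat x x"
      by (metis inner_sum_props(1,3) power2_eq_square mult.assoc)
    then show ?thesis unfolding norm_fmat_def by (simp add: real_sqrt_mult)
  qed
  show "norm (x * y) \<le> norm x * norm y" by (rule norm_fmat_mult)
  show "norm (x + y) \<le> norm x + norm y"
  proof -
    let ?i = inner_sum_fmat
    have expand: "?i (x + c *\<^sub>R y) (x + c *\<^sub>R y) = ?i x x + 2 * c * ?i x y + c\<^sup>2 * ?i y y" for c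
    proof -
      have r: "?i z (x + c *\<^sub>R y) = ?i z x + c * ?i z y" for z
        by (metis inner_sum_props(1,2,3))
      show ?thesis
        unfolding inner_sum_props(2)[of x] inner_sum_props(3)[of c y] r
        by (simp add: inner_sum_props(1)[of y x] power2_eq_square distrib_left)
    qed
    \<comment> \<open>The inner product class is not yet instantiated here, so Cauchy-Schwarz is
      obtained from nonnegativity of \<open>expand\<close> at its minimiser c = - <x, y> / <y,
      y>.\<close>
    have cs: "(?i x y)\<^sup>2 \<le> ?i x x * ?i y y"
    proof (cases "y = 0")
      case True
      then show ?thesis using inner_sum_props(1)[of x y] by (simp add: inner_sum_fmat_def)
    next
      case False
      then have pos: "?i y y > 0" using inner_sum_props(4,5)[of y] by linarith
      have "0 \<le> ?i x x + 2 * (- ?i x y / ?i y y) * ?i x y + (- ?i x y / ?i y y)\<^sup>2 * ?i y y"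
        unfolding expand[symmetric] by (rule inner_sum_props)
      also have "\<dots> = ?i x x - (?i x y)\<^sup>2 / ?i y y"
        using pos by (simp add: field_simps power2_eq_square)
      finally show ?thesis using pos by (simp add: field_simps)
    qed
    then have "?i x y \<le> sqrt (?i x x) * sqrt (?i y y)"
      unfolding real_sqrt_mult[symmetric] by (rule real_le_rsqrt)
    then have "?i (x + y) (x + y) \<le> (sqrt (?i x x) + sqrt (?i y y))\<^sup>2"
      using expand[of 1] inner_sum_props(4)[of x] inner_sum_props(4)[of y]
      by (simp add: power2_sum)
    then show ?thesis unfolding norm_fmat_def
      by (intro real_le_lsqrt add_nonneg_nonneg) (auto simp: inner_sum_props)
  qed
qed (rule dist_fmat_def sgn_fmat_def uniformity_fmat_def open_fmat_def)+

end

instantiation fmat :: real_inner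
begin

definition inner_fmat :: "fmat \<Rightarrow> fmat \<Rightarrow> real" where "inner_fmat = inner_sum_fmat"

instance
  by (standard; unfold inner_fmat_def) (rule inner_sum_props norm_fmat_def)+

end

section \<open>Adjoints and the trace form\<close>

lemma inner_fmat_eq:
  assumes "bnd N x"
  shows "inner x y = (\<Sum>j<N. \<Sum>a<N. \<Sum>b<N. Re (ent x j a b * cnj (ent y j a b)))"
  unfolding inner_fmat_def inner_sum_eq[OF assms]
  by (simp add: sum.cartesian_product split_def)

lift_definition adjf :: "fmat \<Rightarrow> fmat" is "\<lambda>f j a b. cnj (f j b a)"
  by (simp only: complex_cnj_zero_iff) blast

lemma ent_adjf [simp]: "ent (adjf x) j a b = cnj (ent x j b a)"
  by (rule adjf.rep_eq[THEN fun_cong, THEN fun_cong, THEN fun_cong])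

lemma bnd_adjf: "bnd N x \<Longrightarrow> bnd N (adjf x)"
  by (auto simp: bnd_def)

lemma adjf_simps [simp]: "adjf 0 = 0" "adjf (x + y) = adjf x + adjf y" "adjf (x - y) = adjf x - adjf y"
  "adjf (- x) = - adjf x" "adjf (c *\<^sub>R x) = c *\<^sub>R adjf x" "adjf (adjf x) = x"
  by (rule fmat_eqI, simp)+

lemma adjf_mult [simp]: "adjf (x * y) = adjf y * adjf x"
proof (rule fmat_eqI)
  fix j a b
  obtain N where N: "bnd N x" "bnd N y" using bnd_ex2 by blast
  show "ent (adjf (x * y)) j a b = ent (adjf y * adjf x) j a b"
    by (simp add: ent_mult_bnd[OF N(1)] ent_mult_bnd[OF bnd_adjf[OF N(2)]] mult.commute)
qed

lemma inner_adjf: "inner (adjf x) (adjf y) = inner x y"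
proof -
  obtain N where N: "bnd N x" using bnd_ex by blast
  have "inner (adjf x) (adjf y)
      = (\<Sum>j<N. \<Sum>a<N. \<Sum>b<N. Re (cnj (ent x j b a) * ent y j b a))"
    unfolding inner_fmat_eq[OF bnd_adjf[OF N]] by simp
  also have "\<dots> = (\<Sum>j<N. \<Sum>b<N. \<Sum>a<N. Re (cnj (ent x j b a) * ent y j b a))"
    by (intro sum.cong refl sum.swap)
  also have "\<dots> = inner x y"
    unfolding inner_fmat_eq[OF N] by (intro sum.cong refl) simp
  finally show ?thesis .
qed

text \<open>This and its right-handed twin carry the later orthogonality arguments: self-adjointness
  of \<open>tproj\<close>, contraction by complementary projectors, and conservation of the norm
  along commutator flows.\<close>

lemma inner_mult_left: "inner (a * x) y = inner x (adjf a * y)"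
proof -
  obtain N where N: "bnd N a" "bnd N x" using bnd_ex2 by blast
  have "inner (a * x) y
      = (\<Sum>j<N. \<Sum>p<N. \<Sum>q<N. \<Sum>c<N. Re (ent a j p c * ent x j c q * cnj (ent y j p q)))"
    unfolding inner_fmat_eq[OF bnd_mult[OF N]] ent_mult_bnd[OF N(1)]
    by (simp add: sum_distrib_right)
  also have "\<dots> = (\<Sum>j<N. \<Sum>p<N. \<Sum>c<N. \<Sum>q<N. Re (ent a j p c * ent x j c q * cnj (ent y j p q)))"
    by (intro sum.cong refl sum.swap)
  also have "\<dots> = (\<Sum>j<N. \<Sum>c<N. \<Sum>p<N. \<Sum>q<N. Re (ent a j p c * ent x j c q * cnj (ent y j p q)))"
    by (intro sum.cong refl sum.swap)
  also have "\<dots> = (\<Sum>j<N. \<Sum>c<N. \<Sum>q<N. \<Sum>p<N. Re (ent a j p c * ent x j c q * cnj (ent y j p q)))"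
    by (intro sum.cong refl sum.swap)
  also have "\<dots> = inner x (adjf a * y)"
    unfolding inner_fmat_eq[OF N(2)] ent_mult_bnd[OF bnd_adjf[OF N(1)]]
    by (intro sum.cong refl) (simp only: cnj_sum sum_distrib_left Re_sum complex_cnj_mult ent_adjf
        complex_cnj_cnj mult_ac)
  finally show ?thesis .
qed

lemma inner_mult_right: "inner (x * a) y = inner x (y * adjf a)"
proof -
  have "inner (x * a) y = inner (adjf a * adjf x) (adjf y)"
    by (metis inner_adjf adjf_mult)
  also have "\<dots> = inner (adjf x) (adjf (y * adjf a))"
    by (simp add: inner_mult_left)
  finally show ?thesis by (simp only: inner_adjf)
qed

lemma norm_adjf [simp]: "norm (adjf x) = norm x"
  by (simp add: norm_eq_sqrt_inner inner_adjf)

lemma bounded_linear_adjf: "bounded_linear adjf"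
  by (rule bounded_linear_intro[where K = 1]) auto

section \<open>Matrix units and coordinates\<close>

lift_definition single :: "nat \<Rightarrow> nat \<Rightarrow> nat \<Rightarrow> complex \<Rightarrow> fmat" is
  "\<lambda>j a b z j' a' b'. if j' = j \<and> a' = a \<and> b' = b then z else 0"
proof -
  fix j a b :: nat and z :: complex
  show "\<exists>N. \<forall>j' a' b'. (if j' = j \<and> a' = a \<and> b' = b then z else 0) \<noteq> 0
    \<longrightarrow> j' < N \<and> a' < N \<and> b' < N"
    by (rule exI[of _ "Suc (j + a + b)"]) auto
qed

lemma ent_single: "ent (single j a b z) j' a' b' = (if j' = j \<and> a' = a \<and> b' = b then z else 0)"
  by (simp add: single.rep_eq)

lemma inner_single: "inner (single j a b z) x = Re (z * cnj (ent x j a b))"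
proof -
  have "inner (single j a b z) x
    = (\<Sum>(j', a', b')\<in>{(j, a, b)}. Re (ent (single j a b z) j' a' b' * cnj (ent x j' a' b')))"
    unfolding inner_fmat_def inner_sum_fmat_def
    by (intro sum.mono_neutral_left) (auto simp: ent_single split: if_splits)
  then show ?thesis by (simp add: ent_single)
qed

lemma norm_single: "norm (single j a b z) = cmod z"
  by (subst norm_eq_sqrt_inner) (simp add: inner_single ent_single cmod_def power2_eq_square)

lemma bounded_linear_single: "bounded_linear (single j a b)"
  by (rule bounded_linear_intro[where K = 1])
    (auto simp: norm_single ent_single scaleR_conv_of_real intro!: fmat_eqI)

lemma norm_ent_le: "cmod (ent x j a b) \<le> norm x"
proof -
  have "(cmod (ent x j a b))\<^sup>2 = inner (single j a b (ent x j a b)) x"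
    by (simp only: inner_single complex_norm_square[symmetric] Re_complex_of_real)
  also have "\<dots> \<le> norm (single j a b (ent x j a b)) * norm x" by (rule norm_cauchy_schwarz)
  finally have "cmod (ent x j a b) * cmod (ent x j a b) \<le> cmod (ent x j a b) * norm x"
    by (simp add: norm_single power2_eq_square)
  then show ?thesis
    by (metis mult_left_le_imp_le norm_ge_zero less_eq_real_def)
qed

lemma bounded_linear_ent: "bounded_linear (\<lambda>x. ent x j a b)"
  by (rule bounded_linear_intro[where K = 1]) (auto simp: norm_ent_le scaleR_conv_of_real)

lemma ent_sum: "ent (sum f S) j a b = (\<Sum>i\<in>S. ent (f i) j a b)"
  by (induction S rule: infinite_finite_induct) auto

text \<open>Embeds the complex numbers as a subalgebra, so that products of matrix entries can be
  formed inside \<open>fmat\<close> and become polynomial maps.\<close>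

lemma single_mult_single: "single 0 0 0 z * single 0 0 0 w = single 0 0 0 (z * w)"
proof (rule fmat_eqI)
  fix j a b
  have "bnd 1 (single 0 0 0 z)" by (auto simp: bnd_def ent_single)
  then show "ent (single 0 0 0 z * single 0 0 0 w) j a b = ent (single 0 0 0 (z * w)) j a b"
    by (simp add: ent_mult_bnd ent_single)
qed

definition idx :: "nat list \<Rightarrow> (nat \<times> nat \<times> nat) set" where
  "idx ns = (SIGMA j:{..<length ns}. {..<ns ! j} \<times> {..<ns ! j})"

lemma idx_iff: "(j, a, b) \<in> idx ns \<longleftrightarrow> j < length ns \<and> a < ns ! j \<and> b < ns ! j"
  by (auto simp: idx_def)

lemma finite_idx [simp]: "finite (idx ns)" by (simp add: idx_def)

definition supp :: "nat list \<Rightarrow> fmat \<Rightarrow> bool" where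
  "supp ns x \<longleftrightarrow> (\<forall>j a b. (j, a, b) \<notin> idx ns \<longrightarrow> ent x j a b = 0)"

lemma supp_simps: "supp ns 0" "supp ns x \<Longrightarrow> supp ns y \<Longrightarrow> supp ns (x + y)"
  "supp ns x \<Longrightarrow> supp ns y \<Longrightarrow> supp ns (x - y)" "supp ns x \<Longrightarrow> supp ns (- x)"
  "supp ns x \<Longrightarrow> supp ns (c *\<^sub>R x)" "supp ns x \<Longrightarrow> supp ns (adjf x)"
  by (auto simp: supp_def idx_iff)

lemma supp_mult: assumes "supp ns x" "supp ns y" shows "supp ns (x * y)"
  unfolding supp_def
proof (intro allI impI)
  fix j a b
  assume "(j, a, b) \<notin> idx ns"
  then have "ent x j a c = 0 \<or> ent y j c b = 0" for c
    using assms unfolding supp_def idx_iff by blast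
  then show "ent (x * y) j a b = 0"
    using bnd_ex[of x] by (auto simp: ent_mult_bnd intro!: sum.neutral)
qed

text \<open>Indexed by \<open>unit_idx ns\<close>, these form a real orthonormal basis of the
  elements supported on \<open>idx ns\<close>: each matrix unit occurs once with factor 1 and once
  with the imaginary unit.\<close>

definition unit_vec :: "(nat \<times> nat \<times> nat) \<times> complex \<Rightarrow> fmat" where
  "unit_vec i = (case i of ((j, a, b), u) \<Rightarrow> single j a b u)"

definition unit_idx :: "nat list \<Rightarrow> ((nat \<times> nat \<times> nat) \<times> complex) set" where
  "unit_idx ns = idx ns \<times> {1, \<i>}"

lemma finite_unit_idx [simp]: "finite (unit_idx ns)" by (simp add: unit_idx_def)

text \<open>The orthogonal projection onto elements supported on \<open>idx ns\<close>. Its form as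
  a finite basis expansion is what later replaces finite-dimensionality of a type.\<close>

definition cproj :: "nat list \<Rightarrow> fmat \<Rightarrow> fmat" where
  "cproj ns y = (\<Sum>i\<in>unit_idx ns. inner y (unit_vec i) *\<^sub>R unit_vec i)"

lemma ent_cproj: "ent (cproj ns y) j a b = (if (j, a, b) \<in> idx ns then ent y j a b else 0)"
proof -
  have "cproj ns y = (\<Sum>(j, a, b)\<in>idx ns. \<Sum>u\<in>{1, \<i>}. inner y (single j a b u) *\<^sub>R single j a b u)"
    unfolding cproj_def unit_idx_def unit_vec_def by (simp only: sum.cartesian_product split_def fst_conv snd_conv)
  also have "\<dots> = (\<Sum>(j, a, b)\<in>idx ns. single j a b (ent y j a b))"
  proof (intro sum.cong refl, clarify)
    fix j a b
    \<comment> \<open>The index set has two distinct elements, so the sum over it has two terms, the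
      real and the imaginary part of the entry.\<close>
    have "i \<noteq> (1 :: complex)" if "i = \<i>" for i using that by (metis complex_i_not_one)
    then show "(\<Sum>u\<in>{1, \<i>}. inner y (single j a b u) *\<^sub>R single j a b u) = single j a b (ent y j a b)"
      by (intro fmat_eqI)
        (auto simp: ent_single inner_commute[of y] inner_single complex_eq_iff)
  qed
  finally have cproj: "cproj ns y = (\<Sum>(j, a, b)\<in>idx ns. single j a b (ent y j a b))" .
  have "ent (cproj ns y) j a b = (\<Sum>i\<in>idx ns. if i = (j, a, b) then ent y j a b else 0)"
    unfolding cproj ent_sum by (intro sum.cong refl) (auto simp: ent_single split: if_splits)
  then show ?thesis by simp
qed

lemma supp_cproj: "supp ns (cproj ns y)" by (simp add: supp_def ent_cproj)

lemma cproj_id: "supp ns y \<Longrightarrow> cproj ns y = y"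
  by (intro fmat_eqI) (auto simp: ent_cproj supp_def)

lemma inner_cproj: "inner (cproj ns x) y = inner x (cproj ns y)"
  by (simp add: cproj_def inner_sum_left inner_sum_right inner_commute mult.commute)

lemma bounded_linear_cproj: "bounded_linear (cproj ns)"
  unfolding cproj_def
  by (intro bounded_linear_sum bounded_linear_compose[OF bounded_linear_scaleR_left]
      bounded_linear_inner_left)

section \<open>Hermitian elements\<close>

definition herms :: "nat list \<Rightarrow> fmat set" where
  "herms ns = {x. supp ns x \<and> adjf x = x}"

lemma herms_simps: "0 \<in> herms ns" "x \<in> herms ns \<Longrightarrow> y \<in> herms ns
    \<Longrightarrow> x + y \<in> herms ns"
  "x \<in> herms ns \<Longrightarrow> y \<in> herms ns
      \<Longrightarrow> x - y \<in> herms ns" "x \<in> herms ns \<Longrightarrow> - x \<in> herms ns"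
  "x \<in> herms ns \<Longrightarrow> c *\<^sub>R x \<in> herms ns"
  by (auto simp: herms_def supp_simps)

definition hproj :: "nat list \<Rightarrow> fmat \<Rightarrow> fmat" where
  "hproj ns y = (1/2) *\<^sub>R (cproj ns y + adjf (cproj ns y))"

lemma hproj_in: "hproj ns y \<in> herms ns"
  by (auto simp: herms_def hproj_def supp_simps supp_cproj add.commute)

lemma bounded_linear_hproj: "bounded_linear (hproj ns)"
  unfolding hproj_def
  by (intro bounded_linear_compose[OF bounded_linear_scaleR_right] bounded_linear_add
      bounded_linear_cproj bounded_linear_compose[OF bounded_linear_adjf])

text \<open>Replacing a representative of a linear functional by its Hermitian part keeps all values
  on Hermitian directions; this makes the Euclidean gradient Hermitian.\<close>

lemma inner_hproj: assumes "v \<in> herms ns" shows "inner (hproj ns y) v = inner y v"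
proof -
  have v: "cproj ns v = v" "adjf v = v" using assms by (auto simp: herms_def cproj_id)
  have "inner (adjf (cproj ns y)) v = inner (cproj ns y) v" by (metis inner_adjf v(2))
  then show ?thesis unfolding hproj_def by (simp add: inner_add_left inner_cproj v)
qed

section \<open>Polynomial maps\<close>

text \<open>
  The differential is carried along explicitly, so that second-order Taylor bounds and closure
  under directional derivatives follow by rule induction; a Gateaux-smooth map on \<open>fmat\<close> need not
  be Frechet differentiable.
\<close>

inductive poly_map :: "(fmat \<Rightarrow> fmat) \<Rightarrow> (fmat \<Rightarrow> fmat \<Rightarrow> fmat) \<Rightarrow> bool" where
  poly_map_const: "poly_map (\<lambda>x. c) (\<lambda>x v. 0)"
| poly_map_id: "poly_map (\<lambda>x. x) (\<lambda>x v. v)"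
| poly_map_lin: "bounded_linear L \<Longrightarrow> poly_map f f'
    \<Longrightarrow> poly_map (\<lambda>x. L (f x)) (\<lambda>x v. L (f' x v))"
| poly_map_add: "poly_map f f' \<Longrightarrow> poly_map g g'
    \<Longrightarrow> poly_map (\<lambda>x. f x + g x) (\<lambda>x v. f' x v + g' x v)"
| poly_map_mult: "poly_map f f' \<Longrightarrow> poly_map g g'
    \<Longrightarrow> poly_map (\<lambda>x. f x * g x) (\<lambda>x v. f x * g' x v + f' x v * g x)"

lemma poly_map_cong: "poly_map f f' \<Longrightarrow> (\<And>x. f x = g x)
    \<Longrightarrow> (\<And>x v. f' x v = g' x v) \<Longrightarrow> poly_map g g'"
  by (metis ext)

lemma poly_map_scaleR: "poly_map f f' \<Longrightarrow> poly_map (\<lambda>x. c *\<^sub>R f x) (\<lambda>x v. c *\<^sub>R f' x v)"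
  by (rule poly_map_lin[OF bounded_linear_scaleR_right])

lemma poly_map_diff: "poly_map f f' \<Longrightarrow> poly_map g g'
    \<Longrightarrow> poly_map (\<lambda>x. f x - g x) (\<lambda>x v. f' x v - g' x v)"
  by (rule poly_map_cong[OF poly_map_add[OF _ poly_map_scaleR[where c = "-1"]]]) auto

lemma poly_map_sum:
  assumes "\<And>i. i \<in> S \<Longrightarrow> \<exists>f'. poly_map (f i) f'"
  shows "\<exists>f'. poly_map (\<lambda>x. \<Sum>i\<in>S. f i x) f'"
  using assms
proof (induction S rule: infinite_finite_induct)
  case (insert i S)
  then obtain g' f' where "poly_map (f i) g'" "poly_map (\<lambda>x. \<Sum>i\<in>S. f i x) f'" by blast
  then have "poly_map (\<lambda>x. f i x + (\<Sum>i\<in>S. f i x)) (\<lambda>x v. g' x v + f' x v)" by (rule poly_map_add)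
  with insert show ?case by auto
qed (use poly_map_const in auto)

lemma poly_map_sum_deriv:
  assumes "\<And>i. i \<in> S \<Longrightarrow> poly_map (f i) (f' i)"
  shows "poly_map (\<lambda>x. \<Sum>i\<in>S. f i x) (\<lambda>x v. \<Sum>i\<in>S. f' i x v)"
  using assms
proof (induction S rule: infinite_finite_induct)
  case (insert i S)
  then show ?case using poly_map_add[of "f i" "f' i"] by simp
qed (use poly_map_const in auto)

text \<open>For a fixed direction, each differential in the rules is built from \<open>f\<close>,
  \<open>g\<close> and directional differentials by the same rules. This yields derivatives of all
  orders.\<close>

lemma poly_map_directional: "poly_map f f' \<Longrightarrow> \<exists>g. poly_map (\<lambda>x. f' x v) g"
proof (induction rule: poly_map.induct)
  case (poly_map_add f f' g g')
  then obtain h k where "poly_map (\<lambda>x. f' x v) h" "poly_map (\<lambda>x. g' x v) k" by blast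
  from poly_map.poly_map_add[OF this] show ?case by blast
next
  case (poly_map_mult f f' g g')
  then obtain h k where "poly_map (\<lambda>x. f' x v) h" "poly_map (\<lambda>x. g' x v) k" by blast
  from poly_map.poly_map_add[OF poly_map.poly_map_mult[OF poly_map_mult(1) this(2)] poly_map.poly_map_mult[OF this(1) poly_map_mult(2)]]
  show ?case by blast
next
  case (poly_map_lin L f f')
  then obtain h where "poly_map (\<lambda>x. f' x v) h" by blast
  from poly_map.poly_map_lin[OF poly_map_lin(1) this] show ?case by blast
qed (use poly_map_const in blast)+

lemma poly_map_has_derivative: "poly_map f f' \<Longrightarrow> (f has_derivative f' x) (at x)"
proof (induction rule: poly_map.induct)
  case (poly_map_lin L f f')
  then show ?case using bounded_linear.has_derivative by blast
qed (auto intro: has_derivative_add has_derivative_mult)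

lemma poly_map_linear: "poly_map f f' \<Longrightarrow> bounded_linear (f' x)"
  by (rule has_derivative_bounded_linear[OF poly_map_has_derivative])

section \<open>Uniform Taylor bounds on balls\<close>

lemma norm_mult_le: "norm a \<le> A \<Longrightarrow> norm b \<le> B \<Longrightarrow> norm (a * b :: fmat) \<le> A * B"
  by (rule order_trans[OF norm_mult_ineq]) (simp add: mult_mono' )

text \<open>The Taylor remainder of a product involves the sizes and the Lipschitz bounds of both
  factors, so these are proved together in one induction. The Lipschitz bound for the differential
  is included for the perturbation of the Hessian.\<close>

definition poly_map_bounds :: "(fmat \<Rightarrow> fmat) \<Rightarrow> (fmat \<Rightarrow> fmat \<Rightarrow> fmat) \<Rightarrow> real \<Rightarrow> real \<Rightarrow> bool" where
  "poly_map_bounds f f' B K \<longleftrightarrow> 0 \<le> K \<and> (\<forall>x y v. norm x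
      \<le> B \<longrightarrow> norm y \<le> B \<longrightarrow>
     norm (f x) \<le> K \<and> norm (f' x v) \<le> K * norm v \<and> norm (f y - f x) \<le> K * norm (y - x) \<and>
     norm (f' y v - f' x v) \<le> K * norm (y - x) * norm v \<and>
     norm (f y - f x - f' x (y - x)) \<le> K * (norm (y - x))\<^sup>2)"

lemma poly_map_bounds_lin:
  assumes L: "bounded_linear L" and f: "poly_map_bounds f f' B K"
  shows "\<exists>K. poly_map_bounds (\<lambda>x. L (f x)) (\<lambda>x v. L (f' x v)) B K"
proof -
  interpret L: bounded_linear L by fact
  obtain M where M: "M \<ge> 0" "\<And>x. norm (L x) \<le> norm x * M" using L.nonneg_bounded by blast
  have le: "norm (L a) \<le> K * M * t" if "norm a \<le> K * t" for a t
  proof -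
    have "norm (L a) \<le> norm a * M" by (rule M)
    also have "\<dots> \<le> K * t * M" using M(1) that by (rule mult_right_mono[rotated])
    finally show ?thesis by (simp add: mult_ac)
  qed
  have "poly_map_bounds (\<lambda>x. L (f x)) (\<lambda>x v. L (f' x v)) B (K * M)"
    unfolding poly_map_bounds_def L.diff[symmetric]
    using f M(1) le le[where t = 1] unfolding poly_map_bounds_def
    by (simp add: mult.assoc[of "K * M"]) (metis mult.assoc)
  then show ?thesis by blast
qed

lemma poly_map_bounds_add:
  assumes f: "poly_map_bounds f f' B K1" and g: "poly_map_bounds g g' B K2"
  shows "poly_map_bounds (\<lambda>x. f x + g x) (\<lambda>x v. f' x v + g' x v) B (K1 + K2)"
proof -
  have tri: "norm (a + b) \<le> (K1 + K2) * t" if "norm a \<le> K1 * t" "norm b \<le> K2 * t" for a b :: fmat and t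
    using norm_triangle_mono[OF that] by (simp add: distrib_right)
  have e: "f y + g y - (f x + g x) = (f y - f x) + (g y - g x)"
    "f' y v + g' y v - (f' x v + g' x v) = (f' y v - f' x v) + (g' y v - g' x v)"
    "f y + g y - (f x + g x) - (f' x v + g' x v) = (f y - f x - f' x v) + (g y - g x - g' x v)"
    for x y v by simp_all
  have K: "0 \<le> K1 + K2" using f g by (simp add: poly_map_bounds_def)
  show ?thesis unfolding poly_map_bounds_def
  proof (intro conjI allI impI K)
    fix x y v :: fmat assume xy: "norm x \<le> B" "norm y \<le> B"
    note F = f[unfolded poly_map_bounds_def, THEN conjunct2, rule_format, OF xy, of v]
    note G = g[unfolded poly_map_bounds_def, THEN conjunct2, rule_format, OF xy, of v]
    show "norm (f x + g x) \<le> K1 + K2" using tri[of "f x" 1 "g x"] F G by simp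
    show "norm (f' x v + g' x v) \<le> (K1 + K2) * norm v" using tri F G by blast
    show "norm (f y + g y - (f x + g x)) \<le> (K1 + K2) * norm (y - x)"
      unfolding e(1) using tri F G by blast
    show "norm (f' y v + g' y v - (f' x v + g' x v)) \<le> (K1 + K2) * norm (y - x) * norm v"
      unfolding e(2) mult.assoc using tri F G by (metis mult.assoc)
    show "norm (f y + g y - (f x + g x) - (f' x (y - x) + g' x (y - x))) \<le> (K1 + K2) * (norm (y - x))\<^sup>2"
      unfolding e(3) using tri F G by blast
  qed
qed

text \<open>The factor 4 counts the terms in the telescoped difference of the two differentials, the
  longest of the splittings below.\<close>

lemma poly_map_bounds_mult:
  assumes f: "poly_map_bounds f f' B K1" and g: "poly_map_bounds g g' B K2"
  shows "poly_map_bounds (\<lambda>x. f x * g x) (\<lambda>x v. f x * g' x v + f' x v * g x) B (4 * (K1 * K2))"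
proof -
  have K: "0 \<le> K1" "0 \<le> K2" "0 \<le> K1 * K2" using f g by (simp_all add: poly_map_bounds_def)
  show ?thesis unfolding poly_map_bounds_def
  proof (intro conjI allI impI)
    show "0 \<le> 4 * (K1 * K2)" using K by simp
    fix x y v :: fmat assume xy: "norm x \<le> B" "norm y \<le> B"
    let ?d = "norm (y - x)"
    note F = f[unfolded poly_map_bounds_def, THEN conjunct2, rule_format, OF xy, of v]
    note G = g[unfolded poly_map_bounds_def, THEN conjunct2, rule_format, OF xy, of v]
    \<comment> \<open>With \<open>x\<close> and \<open>y\<close> exchanged, the same facts bound
      values and differentials at \<open>y\<close>.\<close>
    note F' = f[unfolded poly_map_bounds_def, THEN conjunct2, rule_format, OF xy(2) xy(1), of v]
    note G' = g[unfolded poly_map_bounds_def, THEN conjunct2, rule_format, OF xy(2) xy(1), of v]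
    have n: "0 \<le> K1 * K2 * t" if "0 \<le> t" for t using K that by simp
    show "norm (f x * g x) \<le> 4 * (K1 * K2)"
      using norm_mult_le[of "f x" K1 "g x" K2] F G K by linarith
    have 1: "norm (f x * g' x v) \<le> K1 * (K2 * norm v)" "norm (f' x v * g x) \<le> (K1 * norm v) * K2"
      using F G by (blast intro: norm_mult_le)+
    show "norm (f x * g' x v + f' x v * g x) \<le> 4 * (K1 * K2) * norm v"
      using norm_triangle_mono[OF 1] n[of "norm v"] by (simp add: mult_ac)
    have 2: "norm ((f y - f x) * g y) \<le> (K1 * ?d) * K2" "norm (f x * (g y - g x)) \<le> K1 * (K2 * ?d)"
      using F G G' by (blast intro: norm_mult_le)+
    have "f y * g y - f x * g x = (f y - f x) * g y + f x * (g y - g x)"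
      by (simp add: algebra_simps)
    then show "norm (f y * g y - f x * g x) \<le> 4 * (K1 * K2) * ?d"
      using norm_triangle_mono[OF 2] n[of ?d] by (simp add: mult_ac)
    have 3: "norm (f y * (g' y v - g' x v)) \<le> K1 * (K2 * ?d * norm v)"
      "norm ((f y - f x) * g' x v) \<le> (K1 * ?d) * (K2 * norm v)"
      "norm ((f' y v - f' x v) * g y) \<le> (K1 * ?d * norm v) * K2"
      "norm (f' x v * (g y - g x)) \<le> (K1 * norm v) * (K2 * ?d)"
      using F G F' G' by (blast intro: norm_mult_le)+
    have "f y * g' y v + f' y v * g y - (f x * g' x v + f' x v * g x)
      = f y * (g' y v - g' x v) + (f y - f x) * g' x v + (f' y v - f' x v) * g y
        + f' x v * (g y - g x)"
      by (simp add: algebra_simps)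
    then show "norm (f y * g' y v + f' y v * g y - (f x * g' x v + f' x v * g x))
        \<le> 4 * (K1 * K2) * ?d * norm v"
      using norm_triangle_mono[OF norm_triangle_mono[OF norm_triangle_mono[OF 3(1,2)] 3(3)] 3(4)]
      by (simp add: mult_ac)
    have 4: "norm ((f y - f x - f' x (y - x)) * g x) \<le> (K1 * ?d\<^sup>2) * K2"
      "norm (f x * (g y - g x - g' x (y - x))) \<le> K1 * (K2 * ?d\<^sup>2)"
      "norm ((f y - f x) * (g y - g x)) \<le> (K1 * ?d) * (K2 * ?d)"
      using F G F' G' by (blast intro: norm_mult_le)+
    have "f y * g y - f x * g x - (f x * g' x (y - x) + f' x (y - x) * g x)
      = (f y - f x - f' x (y - x)) * g x + f x * (g y - g x - g' x (y - x))
        + (f y - f x) * (g y - g x)"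
      by (simp add: algebra_simps)
    then show "norm (f y * g y - f x * g x - (f x * g' x (y - x) + f' x (y - x) * g x))
        \<le> 4 * (K1 * K2) * ?d\<^sup>2"
      using norm_triangle_mono[OF norm_triangle_mono[OF 4(1,2)] 4(3)] n[of "?d\<^sup>2"]
      by (simp add: mult_ac power2_eq_square)
  qed
qed

lemma poly_map_bounds_ex: "poly_map f f' \<Longrightarrow> \<exists>K. poly_map_bounds f f' B K"
proof (induction rule: poly_map.induct)
  case (poly_map_const c)
  show ?case by (rule exI[of _ "norm c"]) (simp add: poly_map_bounds_def)
next
  case poly_map_id
  \<comment> \<open>The constant must dominate \<open>B\<close> for the values and 1 for the
    differential, and stay nonnegative even if \<open>B\<close> is negative.\<close>
  show ?case
    by (rule exI[of _ "\<bar>B\<bar> + 1"])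
      (auto simp: poly_map_bounds_def distrib_right intro: add_increasing)
qed (use poly_map_bounds_lin poly_map_bounds_add poly_map_bounds_mult in blast)+

section \<open>Projectors and their tangent spaces\<close>

text \<open>The linearisation of \<open>p * p = p\<close> within the Hermitian elements. The traces
  impose no further condition, since every such \<open>v\<close> is the velocity of a curve along
  which they are constant.\<close>

definition tspace :: "nat list \<Rightarrow> fmat \<Rightarrow> fmat set" where
  "tspace ns p = {v \<in> herms ns. p * v + v * p = v}"

text \<open>
  For a projector \<open>p\<close> this is the double commutator \<open>[p, [p, y]]\<close>, the orthogonal projection of
  the Hermitian element \<open>y\<close> onto the tangent space at \<open>p\<close>.
\<close>

definition tproj :: "fmat \<Rightarrow> fmat \<Rightarrow> fmat" where
  "tproj p y = p * y + y * p - p * y * p - p * y * p"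

lemma idem_assoc: "p * p = p \<Longrightarrow> p * (p * z) = p * (z :: fmat)"
  by (simp flip: mult.assoc)

lemma herms_sandwich: "p \<in> herms ns \<Longrightarrow> y \<in> herms ns \<Longrightarrow> p * y * p \<in> herms ns"
  "p \<in> herms ns \<Longrightarrow> y \<in> herms ns \<Longrightarrow> p * y + y * p \<in> herms ns"
  by (auto simp: herms_def supp_mult supp_simps mult.assoc add.commute)

lemma tproj_herms: "p \<in> herms ns \<Longrightarrow> y \<in> herms ns \<Longrightarrow> tproj p y \<in> herms ns"
  unfolding tproj_def by (intro herms_simps herms_sandwich)

lemma tproj_eq: assumes "p * p = p" shows "p * tproj p y + tproj p y * p = tproj p y"
  by (simp add: tproj_def algebra_simps assms idem_assoc[OF assms])

lemma tproj_tspace: "p * p = p \<Longrightarrow> p \<in> herms ns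
    \<Longrightarrow> y \<in> herms ns \<Longrightarrow> tproj p y \<in> tspace ns p"
  by (simp add: tspace_def tproj_herms tproj_eq)

text \<open>Multiplying the tangency equation by \<open>p\<close> from the left cancels
  \<open>p * v\<close>. With respect to \<open>p\<close>, a tangent vector has only off-diagonal
  blocks.\<close>

lemma tangent_sandwich:
  assumes "p * p = p" "p * v + v * p = v" shows "p * v * p = (0 :: fmat)"
proof -
  have "p * (p * v + v * p) = p * v" using assms(2) by simp
  then show ?thesis by (simp add: distrib_left idem_assoc[OF assms(1)] mult.assoc)
qed

lemma tproj_id: "p * p = p \<Longrightarrow> p * v + v * p = v \<Longrightarrow> tproj p v = v"
  by (simp add: tproj_def tangent_sandwich)

lemma tproj_linear: "tproj p (x + y) = tproj p x + tproj p y" "tproj p (x - y) = tproj p x - tproj p y"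
  "tproj p (c *\<^sub>R x) = c *\<^sub>R tproj p x" "tproj p (- x) = - tproj p x" "tproj p 0 = 0"
  by (simp_all add: tproj_def algebra_simps)

lemma inner_tproj: assumes "adjf p = p" shows "inner (tproj p y) z = inner y (tproj p z)"
  by (simp add: tproj_def inner_add_left inner_diff_left inner_add_right inner_diff_right
      inner_mult_left[of p] inner_mult_right[of _ p] assms mult.assoc)

text \<open>The formula for \<open>tproj\<close> is polynomial in the base point and so makes sense
  away from projectors; the terms before the last one are its derivative in the base point.\<close>

lemma poly_map_tproj: assumes "poly_map f f'" shows "poly_map (\<lambda>x. tproj x (f x))
   (\<lambda>x v. v * f x + f x * v - v * f x * x - x * f x * v - v * f x * x - x * f x * v + tproj x (f' x v))"
proof -
  have "poly_map (\<lambda>x. x * f x * x) (\<lambda>x v. x * f x * v + (x * f' x v + v * f x) * x)"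
    by (intro poly_map_mult poly_map_id assms)
  from poly_map_diff[OF poly_map_diff[OF poly_map_add[OF poly_map_mult[OF poly_map_id assms] poly_map_mult[OF assms poly_map_id]] this] this]
  show ?thesis by (rule poly_map_cong) (simp_all add: tproj_def algebra_simps)
qed

lemma tspace_subspace: "subspace (tspace ns p)"
proof (rule subspaceI)
  fix x y c assume x: "x \<in> tspace ns p"
  show "c *\<^sub>R x \<in> tspace ns p"
    using x by (simp add: tspace_def herms_simps flip: scaleR_add_right)
  assume y: "y \<in> tspace ns p"
  have "p * (x + y) + (x + y) * p = (p * x + x * p) + (p * y + y * p)"
    by (simp add: algebra_simps)
  then show "x + y \<in> tspace ns p" using x y by (simp add: tspace_def herms_simps)
qed (simp add: tspace_def herms_simps)

section \<open>Estimates for projectors and their tangent spaces\<close>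

lemma norm_diff_mono: "norm a \<le> A \<Longrightarrow> norm b \<le> B \<Longrightarrow> norm (a - b) \<le> A + B"
  by (rule order_trans[OF norm_triangle_ineq4 add_mono])

lemma tproj_bounds:
  assumes "0 \<le> B"
  shows "\<exists>K\<ge>0. \<forall>x y w. norm x \<le> B \<longrightarrow> norm y \<le> B \<longrightarrow>
    norm (tproj x w) \<le> K * norm w \<and> norm (tproj y w - tproj x w) \<le> K * norm (y - x) * norm w"
\<comment> \<open>The first two summands bound the four terms of \<open>tproj x w\<close>, the last
  two the six terms of the telescoped difference; their sum serves for both claims.\<close>
proof (intro exI[of _ "2 * B + 2 * B * B + 2 + 4 * B"] conjI allI impI)
  show "0 \<le> 2 * B + 2 * B * B + 2 + 4 * B" using assms by simp
  fix x y w :: fmat assume xy: "norm x \<le> B" "norm y \<le> B"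
  let ?d = "norm (y - x)" and ?w = "norm w"
  have nn: "0 \<le> B * ?w" "0 \<le> B * B * ?w" "0 \<le> ?d * ?w" "0 \<le> B * ?d * ?w" "0 \<le> B * B * (?d * ?w)"
    using assms by simp_all
  have a: "norm (x * w) \<le> B * ?w" "norm (w * x) \<le> ?w * B" "norm (x * w * x) \<le> B * ?w * B"
    by (intro norm_mult_le xy order_refl)+
  have "norm (tproj x w) \<le> B * ?w + ?w * B + B * ?w * B + B * ?w * B"
    unfolding tproj_def by (intro norm_diff_mono norm_triangle_mono a)
  also have "\<dots> = (2 * B + 2 * B * B + 2 + 4 * B) * ?w - (2 * ?w + 4 * (B * ?w))"
    by (simp add: algebra_simps)
  also have "\<dots> \<le> (2 * B + 2 * B * B + 2 + 4 * B) * ?w"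
    using nn norm_ge_zero[of w] by linarith
  finally show "norm (tproj x w) \<le> (2 * B + 2 * B * B + 2 + 4 * B) * ?w" .
  have alg: "t * s + s * t + t * s * B + B * s * t + t * s * B + B * s * t
      = (2 * B + 2 * B * B + 2 + 4 * B) * (t * s) - (2 * (B * t * s) + 2 * (B * B * (t * s)))"
    for s t :: real by (simp add: algebra_simps)
  have b: "norm ((y - x) * w) \<le> ?d * ?w" "norm (w * (y - x)) \<le> ?w * ?d"
    "norm ((y - x) * w * y) \<le> ?d * ?w * B" "norm (x * w * (y - x)) \<le> B * ?w * ?d"
    by (intro norm_mult_le xy order_refl)+
  have "tproj y w - tproj x w = (y - x) * w + w * (y - x) - ((y - x) * w * y) - x * w * (y - x)
     - ((y - x) * w * y) - x * w * (y - x)"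
    by (simp add: tproj_def algebra_simps)
  also have "norm \<dots> \<le> ?d * ?w + ?w * ?d + ?d * ?w * B + B * ?w * ?d + ?d * ?w * B + B * ?w * ?d"
    by (intro norm_diff_mono norm_triangle_mono b)
  also have "\<dots> = (2 * B + 2 * B * B + 2 + 4 * B) * (?d * ?w)
      - (2 * (B * ?d * ?w) + 2 * (B * B * (?d * ?w)))"
    by (rule alg)
  also have "\<dots> \<le> (2 * B + 2 * B * B + 2 + 4 * B) * (?d * ?w)"
    using nn by linarith
  finally show "norm (tproj y w - tproj x w) \<le> (2 * B + 2 * B * B + 2 + 4 * B) * ?d * ?w"
    by (simp add: mult.assoc)
qed

text \<open>For projectors, equality of the norms expresses equality of the ranks.\<close>

lemma projector_distance:
  assumes p: "p * p = p" "adjf p = p" and p': "p' * p' = p'" "adjf p' = p'" and n: "norm p' = norm p"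
  shows "(norm (p' - p))\<^sup>2 = 2 * (norm (p' * p - p))\<^sup>2"
proof -
  \<comment> \<open>Both squared norms reduce to <p, p> and <p', p>: the left-hand side becomes 2
    (<p, p> - <p', p>) once the norms agree.\<close>
  have 1: "inner (p' * p) (p' * p) = inner p' p"
    by (metis inner_mult_left inner_mult_right inner_commute idem_assoc p p')
  have 2: "inner (p' * p) p = inner p' p" by (simp add: inner_mult_right p)
  have "inner p' p' = inner p p" using n by (simp add: norm_eq_sqrt_inner)
  then show ?thesis
    unfolding power2_norm_eq_inner
    by (simp add: inner_diff_left inner_diff_right 1 2 inner_commute[of p p']
        inner_commute[of p "p' * p"])
qed

text \<open>Pythagoras: \<open>x - p * x\<close> and \<open>p * x\<close> are orthogonal and add up
  to \<open>x\<close>.\<close>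

lemma projector_contraction:
  assumes p: "p * p = p" "adjf p = p"
  shows "norm (x - p * x) \<le> norm x"
proof -
  have "inner (x - p * x) (p * x) = 0"
    by (simp add: inner_diff_left inner_mult_left p inner_diff_right idem_assoc inner_commute)
  then have "inner (x - p * x) (x - p * x) \<le> inner x x"
    using inner_ge_zero[of "p * x"]
    by (simp add: inner_diff_left inner_diff_right inner_commute)
  then show ?thesis by (simp add: norm_eq_sqrt_inner)
qed

text \<open>The hypothesis \<open>step\<close> makes p' p - p equal to the part of v p outside the
  range of p', hence of order |v|; equality of norms extends this to p' - p. The quadratic equation
  satisfied by d = p' - p then expresses d - v by products of two small factors.\<close>

lemma retraction_estimate:
  assumes p: "p * p = p" "adjf p = p" and p': "p' * p' = p'" "adjf p' = p'"
    and n: "norm p' = norm p" "norm p \<le> B"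
    and v: "p * v + v * p = v" "adjf v = v" and step: "p' * (p + v * p) = p + v * p"
  shows "norm (p' - p - v) \<le> 8 * B\<^sup>2 * (norm v)\<^sup>2"
proof -
  define d where "d = p' - p"
  have B: "0 \<le> B" using n(2) norm_ge_zero order_trans by blast
  have e: "p' * p - p = v * p - p' * (v * p)" using step by (simp add: algebra_simps)
  have vp: "norm (v * p) \<le> norm v * B" by (intro norm_mult_le n order_refl)
  have "norm (p' * p - p) \<le> norm v * B"
    unfolding e using projector_contraction[OF p'] vp by (rule order_trans)
  then have "(norm d)\<^sup>2 \<le> 2 * (norm v * B)\<^sup>2"
    unfolding d_def projector_distance[OF p p' n(1)]
    by (intro mult_left_mono power_mono) simp_all
  \<comment> \<open>Rounds the factor 2 up to the square 4, so that the root can be taken without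
    sqrt 2.\<close>
  also have "\<dots> \<le> 2 * (norm v * B)\<^sup>2 + 2 * (norm v * B)\<^sup>2" by simp
  also have "\<dots> = (2 * B * norm v)\<^sup>2" by (simp add: power2_eq_square)
  finally have d: "norm d \<le> 2 * B * norm v"
    by (rule power2_le_imp_le) (use B in simp)
  have pvp: "p * v * p = 0" by (rule tangent_sandwich[OF p(1) v(1)])
  have dp: "d * p = v * p - d * v * p"
    using step pvp by (simp add: d_def algebra_simps p)
  have "adjf (d * p) = adjf (v * p - d * v * p)" by (simp only: dp)
  then have ld: "p * d = p * v - p * v * d" by (simp add: d_def p p' v mult.assoc)
  \<comment> \<open>Idempotence of p' = p + d. The blocks \<open>p * d\<close> and
    \<open>d * p\<close> are already known up to second order, so this determines all of d.\<close>
  have "p * d + d * p + d * d = d" by (simp add: d_def algebra_simps p p')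
  then have "d - v = (p * v - p * v * d) + (v * p - d * v * p) + d * d - (p * v + v * p)"
    by (simp only: ld dp v(1))
  also have "\<dots> = d * d - p * v * d - d * v * p" by (simp add: algebra_simps)
  \<comment> \<open>The constant 8 is 4 + 2 + 2, one summand for each of the three products.\<close>
  also have "norm \<dots> \<le> (2 * B * norm v) * (2 * B * norm v) + B * norm v * (2 * B * norm v)
      + (2 * B * norm v) * norm v * B"
    by (intro norm_diff_mono norm_mult_le n d order_refl)
  also have "\<dots> = 8 * B\<^sup>2 * (norm v)\<^sup>2" by (simp add: power2_eq_square)
  finally show ?thesis by (simp add: d_def)
qed

text \<open>Idempotence of p + d gives p d + d p = d - d^2, and compressing by p gives p d p = - p
  d^2 p. So the normal part of d is made of terms quadratic in d.\<close>

lemma tangent_approximation: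
  fixes p q :: fmat
  assumes p: "p * p = p" "norm p \<le> B" and q: "q * q = q"
  shows "norm (q - p - tproj p (q - p)) \<le> (1 + 2 * B\<^sup>2) * (norm (q - p))\<^sup>2"
proof -
  define d where "d = q - p"
  have d: "p * d + d * p + d * d = d" by (simp add: d_def algebra_simps p q)
  then have "p * (p * d + d * p + d * d) * p = p * d * p" by simp
  then have pdp: "p * d * p = - (p * (d * d) * p)"
    by (simp add: algebra_simps p idem_assoc[OF p(1)] eq_neg_iff_add_eq_0)
  have "d - tproj p d = d * d + p * d * p + p * d * p"
    using d by (simp add: tproj_def algebra_simps)
  also have "norm \<dots> \<le> norm d * norm d + B * (norm d * norm d) * B + B * (norm d * norm d) * B"
    unfolding pdp norm_minus_cancel
    by (intro norm_triangle_mono) (simp_all only: norm_minus_cancel norm_mult_le p order_refl)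
  finally show ?thesis by (simp add: d_def power2_eq_square algebra_simps)
qed

text \<open>Injectivity gives a linear left inverse; on values supported on \<open>idx ns\<close> it
  is a finite combination of its values on the basis and hence bounded.\<close>

lemma bounded_below:
  assumes "linear f" "subspace S" "inj_on f S" "\<And>v. v \<in> S \<Longrightarrow> supp ns (f v)"
  shows "\<exists>c>0. \<forall>v\<in>S. c * norm v \<le> norm (f v :: fmat)"
proof -
  have sp: "span S = S" using assms(2) by simp
  obtain g where g: "linear g" "\<And>v. v \<in> S \<Longrightarrow> g (f v) = v"
    using linear_inj_on_left_inverse[of f S] assms sp by auto
  \<comment> \<open>A bound for the left inverse composed with \<open>cproj ns\<close>. It may be
    zero, whence \<open>C + 1\<close> in the reciprocal.\<close>
  define C where "C = (\<Sum>i\<in>unit_idx ns. norm (unit_vec i) * norm (g (unit_vec i)))"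
  have C: "0 \<le> C" unfolding C_def by (intro sum_nonneg) simp
  have "norm v \<le> (C + 1) * norm (f v)" if v: "v \<in> S" for v
  proof -
    have "v = g (cproj ns (f v))" using v g(2) assms(4) by (simp add: cproj_id)
    also have "\<dots> = (\<Sum>i\<in>unit_idx ns. inner (f v) (unit_vec i) *\<^sub>R g (unit_vec i))"
      unfolding cproj_def by (simp add: linear_sum[OF g(1)] linear_scale[OF g(1)])
    finally have "norm v \<le> (\<Sum>i\<in>unit_idx ns. norm (inner (f v) (unit_vec i) *\<^sub>R g (unit_vec i)))"
      by (metis norm_sum)
    also have "\<dots> \<le> (\<Sum>i\<in>unit_idx ns. norm (f v) * (norm (unit_vec i) * norm (g (unit_vec i))))"
      by (intro sum_mono) (simp add: mult.assoc[symmetric] mult_right_mono Cauchy_Schwarz_ineq2)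
    also have "\<dots> = C * norm (f v)" by (simp add: C_def sum_distrib_left mult.commute)
    finally show ?thesis by (simp add: distrib_right add_increasing2)
  qed
  then have "inverse (C + 1) * norm v \<le> norm (f v)" if "v \<in> S" for v
    using that C by (simp add: field_simps)
  then show ?thesis using C by (intro exI[of _ "inverse (C + 1)"]) simp
qed

text \<open>A basis of \<open>S\<close> is finite since \<open>S\<close> lies in the span of the
  unit vectors. Its image is independent and equally large, so a vector of \<open>S\<close> outside
  the span of the image would give too large an independent set.\<close>

lemma injective_imp_surjective:
  assumes f: "linear f" and S: "subspace S" "\<And>v. v \<in> S \<Longrightarrow> supp ns v"
    and fS: "f ` S \<subseteq> S" "inj_on f S"
  shows "f ` S = (S :: fmat set)"
proof -
  obtain B where B: "B \<subseteq> S" "independent B" "S \<subseteq> span B"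
    using maximal_independent_subset by blast
  have spB: "span B = S" using B S(1) by (simp add: span_subspace)
  have "S \<subseteq> span (unit_vec ` unit_idx ns)"
  proof
    fix v assume "v \<in> S"
    then have "v = cproj ns v" using S(2) by (simp add: cproj_id)
    then show "v \<in> span (unit_vec ` unit_idx ns)" unfolding cproj_def
      by (metis (no_types, lifting) image_eqI span_base span_scale span_sum)
  qed
  then have fin: "finite B"
    using independent_span_bound[OF _ B(2), of "unit_vec ` unit_idx ns"] B(1) by auto
  have ind: "independent (f ` B)"
    using linear_independent_injective_image[OF f B(2)] fS(2) spB by simp
  have card: "card (f ` B) = card B"
    using fS(2) B(1) by (metis card_image inj_on_subset)
  have sub: "f ` B \<subseteq> S" using fS(1) B(1) by blast
  have "S \<subseteq> span (f ` B)"
  proof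
    fix v assume v: "v \<in> S"
    show "v \<in> span (f ` B)"
    proof (rule ccontr)
      assume n: "v \<notin> span (f ` B)"
      then have "independent (insert v (f ` B))" using ind by (simp add: independent_insert)
      moreover have "insert v (f ` B) \<subseteq> span B" using v sub spB by simp
      ultimately have "card (insert v (f ` B)) \<le> card B"
        using independent_span_bound[OF fin] by blast
      moreover have "v \<notin> f ` B" using n span_base by blast
      ultimately show False using fin card by simp
    qed
  qed
  also have "span (f ` B) = f ` S" using linear_span_image[OF f, of B] spB by simp
  finally show ?thesis using fS(1) by blast
qed

section \<open>The Newton equation\<close>

text \<open>
  \<open>G\<close> plays the role of the Euclidean gradient. At projectors \<open>g\<close> is the Riemannian gradient and
  \<open>hess\<close> the Riemannian Hessian; \<open>dgrad\<close> is the ambient derivative of \<open>g\<close>.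
\<close>

locale projector_newton =
  fixes ns :: "nat list" and G :: "fmat \<Rightarrow> fmat" and G' :: "fmat \<Rightarrow> fmat \<Rightarrow> fmat"
  assumes poly_map_G: "poly_map G G'"
    and G_herms: "x \<in> herms ns \<Longrightarrow> G x \<in> herms ns"
    and G'_herms: "x \<in> herms ns \<Longrightarrow> v \<in> herms ns \<Longrightarrow> G' x v \<in> herms ns"
begin

definition g :: "fmat \<Rightarrow> fmat" where "g x = tproj x (G x)"

definition dgrad :: "fmat \<Rightarrow> fmat \<Rightarrow> fmat" where
  "dgrad x v = v * G x + G x * v - v * G x * x - x * G x * v - v * G x * x - x * G x * v
    + tproj x (G' x v)"

definition hess :: "fmat \<Rightarrow> fmat \<Rightarrow> fmat" where "hess x v = tproj x (dgrad x v)"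

lemma poly_map_g: "poly_map g dgrad"
  using poly_map_tproj[OF poly_map_G] by (rule poly_map_cong) (simp_all add: g_def dgrad_def)

lemma dgrad_herms: assumes x: "x \<in> herms ns" and v: "v \<in> herms ns" shows "dgrad x v \<in> herms ns"
proof -
  have G: "G x \<in> herms ns" by (rule G_herms[OF x])
  have 1: "v * G x * x + x * G x * v \<in> herms ns"
    using x v G by (auto simp: herms_def supp_mult supp_simps mult.assoc add.commute)
  have 2: "v * G x + G x * v \<in> herms ns" using v G by (rule herms_sandwich)
  \<comment> \<open>The terms are grouped into pairs of mutual adjoints, because single terms are
    not Hermitian.\<close>
  have e: "dgrad x v = (v * G x + G x * v) - (v * G x * x + x * G x * v)
      - (v * G x * x + x * G x * v) + tproj x (G' x v)"
    by (simp add: dgrad_def)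
  show ?thesis unfolding e
    by (rule herms_simps(2)[OF herms_simps(3)[OF herms_simps(3)[OF 2 1] 1] tproj_herms[OF x G'_herms[OF x v]]])
qed

lemma linear_dgrad: "linear (dgrad x)"
  by (rule bounded_linear.linear[OF poly_map_linear[OF poly_map_g]])

lemma linear_hess: "linear (hess x)"
  unfolding hess_def
  by (rule linearI) (simp_all add: linear_add[OF linear_dgrad] linear_scale[OF linear_dgrad] tproj_linear)

lemma hess_tspace: "x * x = x \<Longrightarrow> x \<in> herms ns
    \<Longrightarrow> v \<in> herms ns \<Longrightarrow> hess x v \<in> tspace ns x"
  unfolding hess_def by (intro tproj_tspace dgrad_herms)

lemma g_tspace: "x * x = x \<Longrightarrow> x \<in> herms ns \<Longrightarrow> g x \<in> tspace ns x"
  unfolding g_def by (intro tproj_tspace G_herms)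

lemma tspace_D: "v \<in> tspace ns p \<Longrightarrow> v \<in> herms ns" "v \<in> tspace ns p
    \<Longrightarrow> p * v + v * p = v"
  "v \<in> tspace ns p \<Longrightarrow> adjf v = v" "v \<in> tspace ns p \<Longrightarrow> supp ns v"
  by (auto simp: tspace_def herms_def)

lemma hess_bounds:
  assumes B: "0 \<le> B"
  shows "\<exists>K\<ge>0. \<forall>x y v. norm x \<le> B \<longrightarrow> norm y \<le> B \<longrightarrow>
    norm (hess x v) \<le> K * norm v \<and> norm (hess y v - hess x v) \<le> K * norm (y - x) * norm v"
proof -
  obtain K where K: "poly_map_bounds g dgrad B K" using poly_map_bounds_ex[OF poly_map_g] by blast
  obtain L where L: "L \<ge> 0" "\<And>x y w. norm x \<le> B \<Longrightarrow> norm y \<le> B \<Longrightarrow>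
      norm (tproj x w) \<le> L * norm w \<and> norm (tproj y w - tproj x w) \<le> L * norm (y - x) * norm w"
    using tproj_bounds[OF B] by blast
  have K0: "0 \<le> K" using K by (simp add: poly_map_bounds_def)
  show ?thesis
  \<comment> \<open>One \<open>L * K\<close> comes from the change of the differential, the other
    from the change of the projection.\<close>
  proof (intro exI[of _ "2 * (L * K)"] conjI allI impI)
    show "0 \<le> 2 * (L * K)" using K0 L(1) by simp
    fix x y v :: fmat assume xy: "norm x \<le> B" "norm y \<le> B"
    have k: "norm (dgrad x v) \<le> K * norm v" "norm (dgrad y v - dgrad x v) \<le> K * norm (y - x) * norm v"
      using K xy unfolding poly_map_bounds_def by blast+
    have "norm (hess x v) \<le> L * norm (dgrad x v)" unfolding hess_def using L(2) xy by blast
    also have "\<dots> \<le> L * (K * norm v)" using L(1) k by (intro mult_left_mono)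
    finally have 1: "norm (hess x v) \<le> L * K * norm v" by (simp add: mult.assoc)
    moreover have "0 \<le> L * K * norm v" using L(1) K0 by simp
    ultimately show "norm (hess x v) \<le> 2 * (L * K) * norm v" by simp
    have "norm (tproj y (dgrad y v - dgrad x v)) \<le> L * norm (dgrad y v - dgrad x v)" using L(2) xy by blast
    also have "\<dots> \<le> L * (K * norm (y - x) * norm v)" using L(1) k by (intro mult_left_mono)
    finally have 2: "norm (tproj y (dgrad y v - dgrad x v)) \<le> L * (K * norm (y - x) * norm v)" .
    have "norm (tproj y (dgrad x v) - tproj x (dgrad x v)) \<le> L * norm (y - x) * norm (dgrad x v)"
      using L(2) xy by blast
    also have "\<dots> \<le> L * norm (y - x) * (K * norm v)"
      using L(1) k by (intro mult_left_mono mult_nonneg_nonneg norm_ge_zero)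
    finally have 3: "norm (tproj y (dgrad x v) - tproj x (dgrad x v)) \<le> L * norm (y - x) * (K * norm v)" .
    have "hess y v - hess x v = tproj y (dgrad y v - dgrad x v) + (tproj y (dgrad x v) - tproj x (dgrad x v))"
      by (simp add: hess_def tproj_linear)
    then have "norm (hess y v - hess x v)
        \<le> L * (K * norm (y - x) * norm v) + L * norm (y - x) * (K * norm v)"
      using norm_triangle_mono[OF 2 3] by simp
    then show "norm (hess y v - hess x v) \<le> 2 * (L * K) * norm (y - x) * norm v"
      by (simp add: mult_ac)
  qed
qed

lemma hess_inj_on:
  assumes "\<And>v. v \<in> tspace ns p \<Longrightarrow> hess p v = 0 \<Longrightarrow> v = 0"
  shows "inj_on (hess p) (tspace ns p)"
proof (rule inj_onI)
  fix v w assume vw: "v \<in> tspace ns p" "w \<in> tspace ns p" "hess p v = hess p w"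
  then have "hess p (v - w) = 0" by (simp add: linear_diff[OF linear_hess])
  moreover have "v - w \<in> tspace ns p" using vw subspace_diff[OF tspace_subspace] by blast
  ultimately have "v - w = 0" using assms by blast
  then show "v = w" by simp
qed

text \<open>The tangent space moves with \<open>p\<close>, so a tangent vector at \<open>p\<close>
  is first projected to the tangent space at \<open>ps\<close>. Because
  \<open>v = tproj p v\<close>, the projection moves it by at most a multiple of |p - ps|
  |v|.\<close>

lemma hess_uniformly_bounded_below:
  assumes ps: "ps \<in> herms ns" "ps * ps = ps"
    and inj: "\<And>v. v \<in> tspace ns ps \<Longrightarrow> hess ps v = 0 \<Longrightarrow> v = 0"
  shows "\<exists>c>0. \<exists>e>0. \<forall>p. p * p = p \<longrightarrow> norm (p - ps) < e \<longrightarrow>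
    (\<forall>v\<in>tspace ns p. c * norm v \<le> norm (hess p v))"
proof -
  have "inj_on (hess ps) (tspace ns ps)" using inj by (rule hess_inj_on)
  moreover have "supp ns (hess ps v)" if "v \<in> tspace ns ps" for v
    using tspace_D(4)[OF hess_tspace[OF ps(2,1)]] tspace_D(1)[OF that] by blast
  ultimately obtain c where c: "c > 0" "\<And>v. v \<in> tspace ns ps \<Longrightarrow> c * norm v \<le> norm (hess ps v)"
    using bounded_below[OF linear_hess tspace_subspace] by metis
  define B where "B = norm ps + 1"
  have B: "0 \<le> B" "norm ps \<le> B" by (auto simp: B_def add_nonneg_nonneg)
  obtain K where K: "K \<ge> 0" "\<And>x y w. norm x \<le> B \<Longrightarrow> norm y \<le> B \<Longrightarrow>
      norm (hess x w) \<le> K * norm w \<and> norm (hess y w - hess x w) \<le> K * norm (y - x) * norm w"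
    using hess_bounds[OF B(1)] by blast
  obtain L where L: "L \<ge> 0" "\<And>x y w. norm x \<le> B \<Longrightarrow> norm y \<le> B \<Longrightarrow>
      norm (tproj x w) \<le> L * norm w \<and> norm (tproj y w - tproj x w) \<le> L * norm (y - x) * norm w"
    using tproj_bounds[OF B(1)] by blast
  \<comment> \<open>Collects three errors: projecting v costs \<open>c * L\<close>, changing the
    base point of the Hessian costs \<open>K\<close>, and the Hessian of the discarded part costs
    \<open>K * L\<close>.\<close>
  define M where "M = c * L + K + K * L"
  have M: "0 \<le> M" using c K(1) L(1) by (simp add: M_def)
  \<comment> \<open>The minimum with 1 keeps \<open>p\<close> in the ball of radius
    \<open>B\<close>; the other term makes M |p - ps| at most c / 2, and \<open>M + 1\<close> avoids
    dividing by zero.\<close>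
  define e where "e = min 1 (c / (2 * (M + 1)))"
  have e: "e > 0" using c M by (simp add: e_def)
  have "c / 2 * norm v \<le> norm (hess p v)"
    if p: "p * p = p" "norm (p - ps) < e" and v: "v \<in> tspace ns p" for p v
  proof -
    let ?d = "norm (p - ps)" and ?w = "tproj ps v"
    have np: "norm p \<le> B"
      using p(2) norm_triangle_sub[of p ps] by (simp add: B_def e_def)
    have w: "?w \<in> tspace ns ps" using ps tspace_D(1)[OF v] by (intro tproj_tspace)
    have "v - ?w = tproj p v - tproj ps v" using tproj_id[OF p(1) tspace_D(2)[OF v]] by simp
    then have vw: "norm (v - ?w) \<le> L * ?d * norm v" using L(2)[of ps p v] B(2) np by auto
    have 1: "norm (hess p v - hess ps v) \<le> K * ?d * norm v" using K(2)[of ps p v] B(2) np by auto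
    have "norm (hess ps (v - ?w)) \<le> K * norm (v - ?w)" using K(2) B by auto
    also have "\<dots> \<le> K * (L * ?d * norm v)" using K(1) vw by (rule mult_left_mono[rotated])
    finally have 2: "norm (hess ps (v - ?w)) \<le> K * (L * ?d * norm v)" .
    have e: "hess ps ?w = hess p v - (hess p v - hess ps v) - hess ps (v - ?w)"
      by (simp add: linear_diff[OF linear_hess])
    have "norm (hess ps ?w) \<le> norm (hess p v) + K * ?d * norm v + K * (L * ?d * norm v)"
      unfolding e by (rule norm_diff_mono[OF norm_diff_mono[OF order_refl 1] 2])
    moreover have "c * norm ?w \<le> norm (hess ps ?w)" by (rule c(2)[OF w])
    moreover have "c * norm v \<le> c * norm ?w + c * (L * ?d * norm v)"
    proof -
      have "norm v \<le> norm ?w + L * ?d * norm v"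
        using vw norm_triangle_sub[of v ?w] by linarith
      then have "c * norm v \<le> c * (norm ?w + L * ?d * norm v)" using c(1) by simp
      then show ?thesis by (simp add: distrib_left)
    qed
    moreover have "c * (L * ?d * norm v) + K * ?d * norm v + K * (L * ?d * norm v)
        = M * ?d * norm v"
      by (simp add: M_def algebra_simps)
    moreover have "M * ?d * norm v \<le> c / 2 * norm v"
    proof (rule mult_right_mono)
      have "M * ?d \<le> (M + 1) * (c / (2 * (M + 1)))"
        using p(2) M by (intro mult_mono) (auto simp: e_def)
      also have "\<dots> = c / 2" using M by (simp add: field_simps)
      finally show "M * ?d \<le> c / 2" .
    qed simp
    ultimately show ?thesis by linarith
  qed
  then show ?thesis using c e by (intro exI[of _ "c / 2"]) auto
qed

text \<open>The lower bound makes the Hessian injective on the tangent space, which it maps into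
  itself; finite dimension supplies surjectivity.\<close>

lemma newton_equation_solvable:
  assumes p: "p \<in> herms ns" "p * p = p"
    and c: "c > 0" "\<And>v. v \<in> tspace ns p \<Longrightarrow> c * norm v \<le> norm (hess p v)"
  shows "\<exists>!v. v \<in> tspace ns p \<and> hess p v = - g p"
proof -
  have inj: "inj_on (hess p) (tspace ns p)"
  proof (rule hess_inj_on)
    fix v assume "v \<in> tspace ns p" "hess p v = 0"
    then have "c * norm v \<le> 0" using c(2) by fastforce
    then show "v = 0" using c(1) by (simp add: mult_le_0_iff)
  qed
  have "hess p ` tspace ns p = tspace ns p"
    by (rule injective_imp_surjective[OF linear_hess tspace_subspace _ _ inj])
      (use hess_tspace[OF p(2,1)] tspace_D in blast)+
  moreover have "- g p \<in> tspace ns p" using g_tspace[OF p(2,1)] subspace_neg[OF tspace_subspace] by blast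
  ultimately obtain v where "v \<in> tspace ns p" "hess p v = - g p" by (metis imageE)
  then show ?thesis using inj_onD[OF inj] by (intro ex1I[of _ v]) auto
qed

text \<open>Let \<delta> = ps - p with tangential part \<eta>. By the Newton equation, the Hessian
  sends \<eta> - v to (g p + hess p \<delta>) - hess p (\<delta> - \<eta>). Taylor expansion with
  \<open>g ps = 0\<close> makes the first term quadratic in the distance,
  \<open>tangent_approximation\<close> the second; the lower bound on the Hessian transfers this to
  \<eta> - v.\<close>

lemma newton_quadratic:
  assumes ps: "ps \<in> herms ns" "ps * ps = ps" "g ps = 0"
    and c: "c > 0"
  shows "\<exists>C\<ge>0. \<forall>p v p'. p \<in> herms ns \<longrightarrow> p * p = p
      \<longrightarrow> norm p = norm ps \<longrightarrow> norm (p - ps) \<le> 1 \<longrightarrow>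
    (\<forall>v\<in>tspace ns p. c * norm v \<le> norm (hess p v)) \<longrightarrow>
    v \<in> tspace ns p \<longrightarrow> hess p v = - g p \<longrightarrow>
    p' \<in> herms ns \<longrightarrow> p' * p' = p' \<longrightarrow> norm p' = norm ps
        \<longrightarrow> p' * (p + v * p) = p + v * p \<longrightarrow>
    norm (p' - ps) \<le> C * (norm (p - ps))\<^sup>2"
proof -
  \<comment> \<open>No enlarged ball is needed: every projector in question has the norm of
    \<open>ps\<close>.\<close>
  define B where "B = norm ps"
  have B: "0 \<le> B" by (simp add: B_def)
  obtain K where K: "poly_map_bounds g dgrad B K" using poly_map_bounds_ex[OF poly_map_g] by blast
  obtain M where M: "M \<ge> 0" "\<And>x w. norm x \<le> B \<Longrightarrow> norm (hess x w) \<le> M * norm w"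
    using hess_bounds[OF B] by blast
  obtain L where L: "L \<ge> 0" "\<And>x w. norm x \<le> B \<Longrightarrow> norm (tproj x w) \<le> L * norm w"
    using tproj_bounds[OF B] by blast
  have K0: "0 \<le> K" using K by (simp add: poly_map_bounds_def)
  define A where "A = 1 + 2 * B\<^sup>2"
  have A: "0 \<le> A" by (simp add: A_def)
  \<comment> \<open>Bounds the error of the Newton direction: Taylor remainder after projection plus
    Hessian of the normal part, divided by the lower bound of the Hessian.\<close>
  define D where "D = (L * K + M * A) / c"
  have D: "0 \<le> D" using A L(1) M(1) K0 c by (simp add: D_def)
  \<comment> \<open>One summand for each term of the final splitting: retraction error, error of the
    Newton direction, normal part of the displacement.\<close>
  define C where "C = 8 * B\<^sup>2 * (L + D)\<^sup>2 + D + A"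
  have C: "0 \<le> C" using A D by (simp add: C_def)
  show ?thesis
  proof (intro exI[of _ C] conjI C allI impI)
    fix p v p'
    assume p: "p \<in> herms ns" "p * p = p" "norm p = norm ps" and near: "norm (p - ps) \<le> 1"
      and low: "\<forall>v\<in>tspace ns p. c * norm v \<le> norm (hess p v)"
      and v: "v \<in> tspace ns p" "hess p v = - g p"
      and p': "p' \<in> herms ns" "p' * p' = p'" "norm p' = norm ps" "p' * (p + v * p) = p + v * p"
    let ?d = "norm (p - ps)"
    define \<delta> where "\<delta> = ps - p"
    define \<eta> where "\<eta> = tproj p \<delta>"
    have d: "norm \<delta> = ?d" by (simp add: \<delta>_def norm_minus_commute)
    have nB: "norm p \<le> B" "norm ps \<le> B" using p(3) by (simp_all add: B_def)
    have \<eta>: "\<eta> \<in> tspace ns p" unfolding \<eta>_def \<delta>_def using p ps by (intro tproj_tspace herms_simps)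
    have app: "norm (\<delta> - \<eta>) \<le> A * ?d\<^sup>2"
      unfolding \<eta>_def A_def d[symmetric] unfolding \<delta>_def
      by (rule tangent_approximation[OF p(2) nB(1) ps(2)])
    have "norm (g ps - g p - dgrad p \<delta>) \<le> K * ?d\<^sup>2"
      unfolding d[symmetric] unfolding \<delta>_def using K nB unfolding poly_map_bounds_def by blast
    moreover have "g ps - g p - dgrad p \<delta> = - (g p + dgrad p \<delta>)" using ps(3) by simp
    ultimately have tay: "norm (g p + dgrad p \<delta>) \<le> K * ?d\<^sup>2" by (simp only: norm_minus_cancel)
    \<comment> \<open>Since \<open>g p\<close> is tangent, \<open>tproj p\<close> fixes it, and the
      Taylor estimate for the ambient derivative passes to the Hessian.\<close>
    have "g p + hess p \<delta> = tproj p (g p + dgrad p \<delta>)"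
      using tproj_id[OF p(2) tspace_D(2)[OF g_tspace[OF p(2,1)]]] by (simp add: hess_def tproj_linear)
    then have "norm (g p + hess p \<delta>) \<le> L * norm (g p + dgrad p \<delta>)" using L(2) nB by simp
    also have "\<dots> \<le> L * (K * ?d\<^sup>2)" using L(1) tay by (rule mult_left_mono[rotated])
    finally have 1: "norm (g p + hess p \<delta>) \<le> L * (K * ?d\<^sup>2)" .
    have "norm (hess p (\<delta> - \<eta>)) \<le> M * norm (\<delta> - \<eta>)" using M(2) nB by blast
    also have "\<dots> \<le> M * (A * ?d\<^sup>2)" using M(1) app by (rule mult_left_mono[rotated])
    finally have 2: "norm (hess p (\<delta> - \<eta>)) \<le> M * (A * ?d\<^sup>2)" .
    have "hess p (\<eta> - v) = (g p + hess p \<delta>) - hess p (\<delta> - \<eta>)"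
      by (simp add: linear_diff[OF linear_hess] v(2))
    then have "norm (hess p (\<eta> - v)) \<le> L * (K * ?d\<^sup>2) + M * (A * ?d\<^sup>2)"
      using norm_diff_mono[OF 1 2] by simp
    moreover have "c * norm (\<eta> - v) \<le> norm (hess p (\<eta> - v))"
      using low \<eta> v(1) subspace_diff[OF tspace_subspace] by blast
    ultimately have "c * norm (\<eta> - v) \<le> c * (D * ?d\<^sup>2)"
      using c by (simp add: D_def distrib_right mult_ac)
    then have \<eta>v: "norm (\<eta> - v) \<le> D * ?d\<^sup>2" using c by simp
    have "norm \<eta> \<le> L * ?d" unfolding \<eta>_def using L(2)[OF nB(1), of \<delta>] d by simp
    moreover have "norm v \<le> norm \<eta> + norm (\<eta> - v)"
      using norm_triangle_sub[of v \<eta>] by (simp add: norm_minus_commute)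
    \<comment> \<open>As the distance is at most 1, the quadratic error is also linear; hence the
      Newton vector is of the order of the distance, and its square is a second-order term.\<close>
    moreover have "D * ?d\<^sup>2 \<le> D * ?d"
      using D near by (intro mult_left_mono) (simp_all add: power2_eq_square mult_left_le)
    ultimately have nv: "norm v \<le> (L + D) * ?d" using \<eta>v by (simp add: distrib_right)
    have pa: "adjf p = p" "adjf p' = p'" using p p' by (auto simp: herms_def)
    have "norm (p' - p - v) \<le> 8 * B\<^sup>2 * (norm v)\<^sup>2"
      using p' p pa nB tspace_D[OF v(1)] by (intro retraction_estimate) auto
    also have "\<dots> \<le> 8 * B\<^sup>2 * ((L + D) * ?d)\<^sup>2"
      using nv by (intro mult_left_mono power_mono) simp_all
    finally have r: "norm (p' - p - v) \<le> 8 * B\<^sup>2 * (L + D)\<^sup>2 * ?d\<^sup>2"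
      by (simp add: power_mult_distrib mult_ac)
    have e: "p' - ps = (p' - p - v) - (\<eta> - v) - (\<delta> - \<eta>)" by (simp add: \<delta>_def)
    have "norm (p' - ps) \<le> 8 * B\<^sup>2 * (L + D)\<^sup>2 * ?d\<^sup>2 + D * ?d\<^sup>2 + A * ?d\<^sup>2"
      unfolding e by (intro norm_diff_mono r \<eta>v app)
    then show "norm (p' - ps) \<le> C * ?d\<^sup>2" by (simp add: C_def distrib_right)
  qed
qed

end

section \<open>Embedding tuples of matrices\<close>

lemma mat_adjoint_index: "i < dim_col A \<Longrightarrow> j < dim_row A
    \<Longrightarrow> mat_adjoint A $$ (i, j) = cnj (A $$ (j, i))"
  by (simp add: mat_adjoint_def mat_of_rows_def conjugate_complex_def)

lemma mat_adjoint_dims [simp]: "dim_row (mat_adjoint A) = dim_col A" "dim_col (mat_adjoint A) = dim_row A"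
  by (simp_all add: mat_adjoint_def)

lemma mat_adjoint_carrier: "A \<in> carrier_mat n m \<Longrightarrow> mat_adjoint A \<in> carrier_mat m n"
  by (auto intro: carrier_matI)

lemma mult_mat_index:
  "A \<in> carrier_mat n k \<Longrightarrow> B \<in> carrier_mat k m \<Longrightarrow> i < n \<Longrightarrow> j < m
    \<Longrightarrow> (A * B) $$ (i, j) = (\<Sum>c<k. A $$ (i, c) * B $$ (c, j))"
  by (auto simp: scalar_prod_def atLeast0LessThan intro!: sum.cong)

lemma inner_supp:
  assumes "supp ns x"
  shows "inner x y = (\<Sum>j<length ns. \<Sum>a<ns ! j. \<Sum>b<ns ! j. Re (ent x j a b * cnj (ent y j a b)))"
proof -
  have "inner x y = (\<Sum>(j, a, b)\<in>idx ns. Re (ent x j a b * cnj (ent y j a b)))"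
    unfolding inner_fmat_def inner_sum_fmat_def
    using assms by (intro sum.mono_neutral_left) (auto simp: supp_def)
  also have "\<dots> = (\<Sum>j<length ns. \<Sum>(a, b)\<in>{..<ns ! j} \<times> {..<ns ! j}. Re (ent x j a b * cnj (ent y j a b)))"
    unfolding idx_def by (subst sum.Sigma) auto
  finally show ?thesis by (simp only: sum.cartesian_product)
qed

lemma ent_mult_supp:
  assumes "supp ns x" "j < length ns"
  shows "ent (x * y) j a b = (\<Sum>c<ns ! j. ent x j a c * ent y j c b)"
proof -
  obtain N where N: "bnd N x" using bnd_ex by blast
  have "ent (x * y) j a b = (\<Sum>c<N + ns ! j. ent x j a c * ent y j c b)"
    by (rule ent_mult_bnd) (use N bnd_mono in auto)
  also have "\<dots> = (\<Sum>c<ns ! j. ent x j a c * ent y j c b)"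
    using assms by (intro sum.mono_neutral_right) (auto simp: supp_def idx_iff)
  finally show ?thesis .
qed

section \<open>Traces of the blocks\<close>

definition btrace :: "nat list \<Rightarrow> nat \<Rightarrow> fmat \<Rightarrow> complex" where
  "btrace ns j x = (\<Sum>a<ns ! j. ent x j a a)"

lemma bounded_linear_btrace: "bounded_linear (btrace ns j)"
  unfolding btrace_def by (intro bounded_linear_sum bounded_linear_ent)

lemma btrace_commute:
  assumes "supp ns x" "supp ns y" "j < length ns"
  shows "btrace ns j (x * y) = btrace ns j (y * x)"
  unfolding btrace_def ent_mult_supp[OF assms(1,3)] ent_mult_supp[OF assms(2,3)]
  by (subst sum.swap) (simp add: mult.commute)

lemma inner_eq_btrace:
  assumes "supp ns x" "adjf y = y"
  shows "inner x y = (\<Sum>j<length ns. Re (btrace ns j (x * y)))"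
proof -
  have "cnj (ent y j a b) = ent y j b a" for j a b
    by (metis assms(2) ent_adjf)
  then show ?thesis
    unfolding inner_supp[OF assms(1)]
    by (intro sum.cong refl) (simp add: btrace_def ent_mult_supp[OF assms(1)])
qed

section \<open>Transport of tuples to the algebra\<close>

lift_definition emb :: "complex mat list \<Rightarrow> fmat" is
  "\<lambda>Xs j a b. if j < length Xs \<and> a < dim_row (Xs ! j) \<and> b < dim_col (Xs ! j)
    then Xs ! j $$ (a, b) else 0"
proof -
  fix Xs :: "complex mat list"
  let ?N = "length Xs + sum_list (map dim_row Xs) + sum_list (map dim_col Xs)"
  have "dim_row (Xs ! j) \<le> sum_list (map dim_row Xs)" "dim_col (Xs ! j) \<le> sum_list (map dim_col Xs)"
    if "j < length Xs" for j
    using that by (auto intro!: member_le_sum_list)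
  then show "\<exists>N. \<forall>j a b. (if j < length Xs \<and> a < dim_row (Xs ! j) \<and> b < dim_col (Xs ! j)
    then Xs ! j $$ (a, b) else 0) \<noteq> 0 \<longrightarrow> j < N \<and> a < N \<and> b < N"
    by (intro exI[of _ ?N]) (fastforce split: if_splits)
qed

text \<open>Hermiticity is left out on purpose: products such as \<xi> P of Hermitian matrices must
  be embedded as well.\<close>

definition cprod :: "nat list \<Rightarrow> mtuple set" where
  "cprod ns = {Xs. length Xs = length ns \<and> (\<forall>j<length ns. Xs ! j \<in> carrier_mat (ns ! j) (ns ! j))}"

lemma cprodD: "X \<in> cprod ns \<Longrightarrow> length X = length ns"
  "X \<in> cprod ns \<Longrightarrow> j < length ns \<Longrightarrow> X ! j \<in> carrier_mat (ns ! j) (ns ! j)"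
  by (auto simp: cprod_def)

lemma ent_emb: "X \<in> cprod ns \<Longrightarrow> ent (emb X) j a b
    = (if (j, a, b) \<in> idx ns then X ! j $$ (a, b) else 0)"
  by (auto simp: emb.rep_eq cprod_def idx_iff)

lemma supp_emb: "X \<in> cprod ns \<Longrightarrow> supp ns (emb X)"
  by (simp add: supp_def ent_emb)

lemma emb_inj: assumes "X \<in> cprod ns" "Y \<in> cprod ns" "emb X = emb Y" shows "X = Y"
proof (rule nth_equalityI)
  show "length X = length Y" using assms cprodD by metis
  fix j assume "j < length X"
  then have j: "j < length ns" using assms(1) cprodD by metis
  have "X ! j $$ (a, b) = Y ! j $$ (a, b)" if "a < ns ! j" "b < ns ! j" for a b
    using ent_emb[OF assms(1), of j a b] ent_emb[OF assms(2), of j a b] that j assms(3)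
    by (simp add: idx_iff)
  then show "X ! j = Y ! j"
    using cprodD(2)[OF assms(1) j] cprodD(2)[OF assms(2) j] by (intro eq_matI) auto
qed

text \<open>The sizes have to be supplied, because an element of \<open>fmat\<close> does not
  determine them.\<close>

definition unemb :: "nat list \<Rightarrow> fmat \<Rightarrow> mtuple" where
  "unemb ns x = map (\<lambda>j. mat (ns ! j) (ns ! j) (\<lambda>(a, b). ent x j a b)) [0..<length ns]"

lemma unemb_cprod: "unemb ns x \<in> cprod ns"
  by (simp add: unemb_def cprod_def)

lemma unemb_index: "(j, a, b) \<in> idx ns \<Longrightarrow> unemb ns x ! j $$ (a, b) = ent x j a b"
  by (simp add: unemb_def idx_iff)

lemma emb_unemb: "supp ns x \<Longrightarrow> emb (unemb ns x) = x"
  by (rule fmat_eqI) (auto simp: ent_emb[OF unemb_cprod] unemb_index supp_def)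

lemma unemb_emb: "X \<in> cprod ns \<Longrightarrow> unemb ns (emb X) = X"
  by (rule emb_inj[OF unemb_cprod]) (simp_all add: emb_unemb supp_emb)

lemma cprod_tops:
  assumes "X \<in> cprod ns" "Y \<in> cprod ns"
  shows "tadd X Y \<in> cprod ns" "tdiff X Y \<in> cprod ns" "tscale c X \<in> cprod ns"
  using assms by (auto simp: cprod_def tadd_def tdiff_def tscale_def intro!: minus_carrier_mat)

lemma emb_tops:
  assumes "X \<in> cprod ns" "Y \<in> cprod ns"
  shows "emb (tadd X Y) = emb X + emb Y" "emb (tdiff X Y) = emb X - emb Y"
    "emb (tscale c X) = c *\<^sub>R emb X"
proof -
  note c = cprodD(2)[OF assms(1)] cprodD(2)[OF assms(2)]
  note l = cprodD(1)[OF assms(1)] cprodD(1)[OF assms(2)]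
  have i: "tadd X Y ! j $$ (a, b) = X ! j $$ (a, b) + Y ! j $$ (a, b)"
    "tdiff X Y ! j $$ (a, b) = X ! j $$ (a, b) - Y ! j $$ (a, b)"
    "tscale c X ! j $$ (a, b) = complex_of_real c * X ! j $$ (a, b)"
    if "(j, a, b) \<in> idx ns" for j a b
    using that l c[of j] by (auto simp: tadd_def tdiff_def tscale_def idx_iff)
  show "emb (tadd X Y) = emb X + emb Y"
    by (rule fmat_eqI) (simp add: ent_emb[OF cprod_tops(1)[OF assms]] ent_emb[OF assms(1)]
        ent_emb[OF assms(2)] i)
  show "emb (tdiff X Y) = emb X - emb Y"
    by (rule fmat_eqI) (simp add: ent_emb[OF cprod_tops(2)[OF assms]] ent_emb[OF assms(1)]
        ent_emb[OF assms(2)] i)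
  show "emb (tscale c X) = c *\<^sub>R emb X"
    by (rule fmat_eqI) (simp add: ent_emb[OF cprod_tops(3)[OF assms]] ent_emb[OF assms(1)] i)
qed

lemma emb_mult:
  assumes "X \<in> cprod ns" "Y \<in> cprod ns" "Z \<in> cprod ns" "\<And>j. j < length ns
      \<Longrightarrow> Z ! j = X ! j * Y ! j"
  shows "emb Z = emb X * emb Y"
proof (rule fmat_eqI)
  fix j a b
  show "ent (emb Z) j a b = ent (emb X * emb Y) j a b"
  proof (cases "(j, a, b) \<in> idx ns")
    case True
    then have j: "j < length ns" "a < ns ! j" "b < ns ! j" by (auto simp: idx_iff)
    show ?thesis
      unfolding ent_mult_supp[OF supp_emb[OF assms(1)] j(1)]
      using True j assms(4)[OF j(1)] mult_mat_index[OF cprodD(2)[OF assms(1) j(1)] cprodD(2)[OF assms(2) j(1)] j(2,3)]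
      by (auto simp: ent_emb[OF assms(1)] ent_emb[OF assms(2)] ent_emb[OF assms(3)] idx_iff)
  next
    case False
    then show ?thesis
      using supp_mult[OF supp_emb[OF assms(1)] supp_emb[OF assms(2)]] supp_emb[OF assms(3)]
      by (simp add: supp_def)
  qed
qed

lemma adjf_emb_iff:
  assumes "X \<in> cprod ns"
  shows "adjf (emb X) = emb X \<longleftrightarrow> (\<forall>j<length ns. mat_adjoint (X ! j) = X ! j)"
proof
  assume h: "adjf (emb X) = emb X"
  show "\<forall>j<length ns. mat_adjoint (X ! j) = X ! j"
  proof (intro allI impI)
    fix j assume j: "j < length ns"
    note c = cprodD(2)[OF assms j]
    have "cnj (X ! j $$ (b, a)) = X ! j $$ (a, b)" if "a < ns ! j" "b < ns ! j" for a b
      using arg_cong[OF h, of "\<lambda>x. ent x j a b"] that j by (simp add: ent_emb[OF assms] idx_iff)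
    then show "mat_adjoint (X ! j) = X ! j"
      using c by (intro eq_matI) (auto simp: mat_adjoint_index)
  qed
next
  assume h: "\<forall>j<length ns. mat_adjoint (X ! j) = X ! j"
  show "adjf (emb X) = emb X"
  proof (rule fmat_eqI)
    fix j a b
    have "cnj (X ! j $$ (b, a)) = X ! j $$ (a, b)" if "j < length ns" "a < ns ! j" "b < ns ! j"
      using mat_adjoint_index[of a "X ! j" b] h that cprodD(2)[OF assms that(1)] by auto
    then show "ent (adjf (emb X)) j a b = ent (emb X) j a b"
      by (auto simp: ent_emb[OF assms] idx_iff)
  qed
qed

lemma her_prod_iff: "X \<in> her_prod ns \<longleftrightarrow> X \<in> cprod ns \<and> emb X \<in> herms ns"
proof -
  have "X \<in> her_prod ns \<longleftrightarrow> X \<in> cprod ns \<and> (\<forall>j<length ns. mat_adjoint (X ! j) = X ! j)"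
    by (auto simp: her_prod_def herm_def cprod_def list_all2_conv_all_nth)
  then show ?thesis using adjf_emb_iff by (auto simp: herms_def supp_emb)
qed

lemma her_cprod: "X \<in> her_prod ns \<Longrightarrow> X \<in> cprod ns"
  by (simp add: her_prod_iff)

lemma emb_herms: "X \<in> her_prod ns \<Longrightarrow> emb X \<in> herms ns"
  by (simp add: her_prod_iff)

lemma unemb_her: "x \<in> herms ns \<Longrightarrow> unemb ns x \<in> her_prod ns"
    "x \<in> herms ns \<Longrightarrow> emb (unemb ns x) = x"
  by (auto simp: her_prod_iff unemb_cprod emb_unemb herms_def)

lemma her_emb_inj: "X \<in> her_prod ns \<Longrightarrow> Y \<in> her_prod ns
    \<Longrightarrow> emb X = emb Y \<Longrightarrow> X = Y"
  by (blast intro: emb_inj her_cprod)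

lemma her_tops:
  assumes "X \<in> her_prod ns" "Y \<in> her_prod ns"
  shows "tadd X Y \<in> her_prod ns" "tdiff X Y \<in> her_prod ns" "tscale c X \<in> her_prod ns"
  using assms cprod_tops[of X ns Y] emb_tops[of X ns Y] by (auto simp: her_prod_iff herms_simps)

lemma her_emb_tops:
  assumes "X \<in> her_prod ns" "Y \<in> her_prod ns"
  shows "emb (tadd X Y) = emb X + emb Y" "emb (tdiff X Y) = emb X - emb Y"
    "emb (tscale c X) = c *\<^sub>R emb X"
  using emb_tops[OF her_cprod her_cprod] assms by blast+

lemma mtrace_btrace: "X \<in> cprod ns \<Longrightarrow> j < length ns
    \<Longrightarrow> mtrace (X ! j) = btrace ns j (emb X)"
  using cprodD(2)[of X ns j] by (auto simp: mtrace_def btrace_def ent_emb idx_iff)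

lemma tinner_emb:
  assumes "X \<in> her_prod ns" "Y \<in> her_prod ns"
  shows "tinner X Y = inner (emb X) (emb Y)"
proof -
  note c = her_cprod[OF assms(1)] her_cprod[OF assms(2)]
  let ?Z = "map2 (*) X Y"
  have Z: "?Z \<in> cprod ns" using c by (auto simp: cprod_def)
  have nth: "?Z ! j = X ! j * Y ! j" if "j < length ns" for j using c that by (simp add: cprod_def)
  have "tinner X Y = Re (\<Sum>j<length ns. mtrace (?Z ! j))"
    unfolding tinner_def cprodD(1)[OF c(1)] by (intro arg_cong[where f = Re] sum.cong) (auto simp: nth)
  also have "\<dots> = (\<Sum>j<length ns. Re (btrace ns j (emb X * emb Y)))"
    unfolding Re_sum
    by (intro sum.cong refl) (simp add: mtrace_btrace[OF Z] emb_mult[OF c Z nth])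
  also have "\<dots> = inner (emb X) (emb Y)"
    using emb_herms[OF assms(2)] by (intro inner_eq_btrace[symmetric] supp_emb c) (simp add: herms_def)
  finally show ?thesis .
qed

lemma tdist_emb: "X \<in> her_prod ns \<Longrightarrow> Y \<in> her_prod ns
    \<Longrightarrow> tdist X Y = norm (emb X - emb Y)"
  by (simp add: tdist_def tnorm_def tinner_emb[where ns = ns] her_tops her_emb_tops norm_eq_sqrt_inner)

section \<open>The product of Grassmannians as a set of projectors\<close>

definition projs :: "(nat \<times> nat) list \<Rightarrow> fmat set" where
  "projs mns = {x \<in> herms (map snd mns). x * x = x \<and>
     (\<forall>j<length mns. btrace (map snd mns) j x = of_nat (fst (mns ! j)))}"

lemma Gr_prod_iff: "P \<in> Gr_prod mns \<longleftrightarrow> P \<in> ambient mns \<and> emb P \<in> projs mns"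
proof -
  let ?ns = "map snd mns"
  have 1: "P \<in> Gr_prod mns \<longleftrightarrow> length P
      = length mns \<and> (\<forall>j<length mns. P ! j \<in> Gr (fst (mns ! j)) (snd (mns ! j)))"
    by (auto simp: Gr_prod_def list_all2_conv_all_nth split_def)
  have 2: "P \<in> ambient mns \<longleftrightarrow> length P
      = length mns \<and> (\<forall>j<length mns. P ! j \<in> herm (snd (mns ! j)))"
    by (auto simp: ambient_def her_prod_def list_all2_conv_all_nth)
  have 3: "emb P * emb P = emb P \<longleftrightarrow> (\<forall>j<length mns. P ! j * P ! j
      = P ! j)" if P: "P \<in> cprod ?ns"
  proof -
    let ?Z = "map2 (*) P P"
    have Z: "?Z \<in> cprod ?ns" using P by (auto simp: cprod_def)
    have nth: "?Z ! j = P ! j * P ! j" if "j < length ?ns" for j using P that by (simp add: cprod_def)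
    have "emb P * emb P = emb ?Z" by (rule emb_mult[OF P P Z nth, symmetric])
    then have "emb P * emb P = emb P \<longleftrightarrow> ?Z = P" using emb_inj[OF Z P] by auto
    also have "\<dots> \<longleftrightarrow> (\<forall>j<length mns. P ! j * P ! j = P ! j)"
      using P nth by (auto simp: list_eq_iff_nth_eq cprod_def)
    finally show ?thesis .
  qed
  have 4: "P \<in> ambient mns \<Longrightarrow> P \<in> cprod ?ns \<and> emb P \<in> herms ?ns"
      by (simp add: ambient_def her_prod_iff)
  show ?thesis
  proof (cases "P \<in> ambient mns")
    case True
    then have "emb P \<in> projs mns \<longleftrightarrow> (\<forall>j<length mns. P ! j * P ! j = P ! j) \<and>
        (\<forall>j<length mns. mtrace (P ! j) = of_nat (fst (mns ! j)))"
      using 4 3 mtrace_btrace[of P ?ns] by (auto simp: projs_def)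
    then show ?thesis using True unfolding 1 by (auto simp: 2 Gr_def herm_def)
  next
    case False
    then show ?thesis unfolding 1 2 by (auto simp: Gr_def herm_def)
  qed
qed

lemma projs_D: "p \<in> projs mns \<Longrightarrow> p \<in> herms (map snd mns)"
    "p \<in> projs mns \<Longrightarrow> p * p = p"
  "p \<in> projs mns \<Longrightarrow> adjf p = p" "p \<in> projs mns \<Longrightarrow> supp (map snd mns) p"
  by (auto simp: projs_def herms_def)

text \<open>For a projector the squared norm is the trace, here the sum of the prescribed ranks.
  This supplies the equal-norm hypotheses of the estimates for projectors.\<close>

lemma projs_norm: assumes "p \<in> projs mns" "q \<in> projs mns" shows "norm p = norm q"
proof -
  have "inner x x = (\<Sum>j<length mns. Re (of_nat (fst (mns ! j))))" if "x \<in> projs mns" for x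
    using that inner_eq_btrace[OF projs_D(4)[OF that] projs_D(3)[OF that]] projs_D(2)[OF that] by (simp add: projs_def)
  then show ?thesis using assms by (simp add: norm_eq_sqrt_inner)
qed

section \<open>Tangent spaces and directional derivatives\<close>

text \<open>Multiplying the difference quotient by s - t turns the limit of \<open>tdist\<close>
  into the remainder condition of a derivative. The curve has to be Hermitian near t, since
  \<open>tdist\<close> is matched with the norm only there.\<close>

lemma has_velocity_iff:
  assumes c: "\<forall>\<^sub>F s in at t. c s \<in> her_prod ns" "c t \<in> her_prod ns" "v \<in> her_prod ns"
  shows "has_velocity c v t \<longleftrightarrow> ((\<lambda>s. emb (c s)) has_vector_derivative emb v) (at t)"
proof -
  let ?f = "\<lambda>s. emb (c s)"
  have ev: "\<forall>\<^sub>F s in at t. tdist (tscale (1 / (s - t)) (tdiff (c s) (c t))) v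
      = norm (?f s - ?f t - (s - t) *\<^sub>R emb v) / norm (s - t)"
    using c(1) eventually_neq_at_within[of t]
  proof eventually_elim
    case (elim s)
    note d = her_tops(2)[OF elim(1) c(2)]
    have "tdist (tscale (1 / (s - t)) (tdiff (c s) (c t))) v
      = norm ((1 / (s - t)) *\<^sub>R (?f s - ?f t) - emb v)"
      by (simp add: tdist_emb[OF her_tops(3)[OF d d] c(3)] her_emb_tops(3)[OF d d]
          her_emb_tops(2)[OF elim(1) c(2)])
    also have "(1 / (s - t)) *\<^sub>R (?f s - ?f t) - emb v
      = (1 / (s - t)) *\<^sub>R (?f s - ?f t - (s - t) *\<^sub>R emb v)"
      using elim(2) by (simp add: scaleR_diff_right)
    finally show ?case by simp
  qed
  show ?thesis
    unfolding has_velocity_def has_vector_derivative_def has_derivative_iff_norm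
    using tendsto_cong[OF ev] by (auto intro: bounded_linear_scaleR_left)
qed

lemma ambient_iff: "X \<in> ambient mns \<longleftrightarrow> X \<in> her_prod (map snd mns)"
  by (simp add: ambient_def)

lemma Gr_ambient: "P \<in> Gr_prod mns \<Longrightarrow> P \<in> her_prod (map snd mns)"
  by (simp add: Gr_prod_iff ambient_def)

lemma Gr_projs: "P \<in> Gr_prod mns \<Longrightarrow> emb P \<in> projs mns"
  by (simp add: Gr_prod_iff)

lemma eventually_at_ball: "(\<And>t :: real. \<bar>t\<bar> < e \<Longrightarrow> P t)
    \<Longrightarrow> 0 < e \<Longrightarrow> \<forall>\<^sub>F t in at 0. P t"
  unfolding eventually_at by (rule exI[of _ e]) (auto simp: dist_real_def)

lemma curve_throughD:
  assumes c: "curve_through (ambient mns) (Gr_prod mns) P v c" and v: "v \<in> ambient mns"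
  shows "((\<lambda>t. emb (c t)) has_vector_derivative emb v) (at 0)" "c 0 = P" "P \<in> Gr_prod mns"
    "\<forall>\<^sub>F t in at 0. c t \<in> Gr_prod mns"
proof -
  obtain e where e: "e > 0" "\<And>t. \<bar>t\<bar> < e \<Longrightarrow> c t \<in> Gr_prod mns"
    and c': "c 0 = P" "has_velocity c v 0"
    using c unfolding curve_through_def by (auto simp: abs_less_iff)
  show P: "c 0 = P" "P \<in> Gr_prod mns" using c' e(2)[of 0] e(1) by auto
  show ev: "\<forall>\<^sub>F t in at 0. c t \<in> Gr_prod mns" using e by (intro eventually_at_ball)
  have "\<forall>\<^sub>F t in at 0. c t \<in> her_prod (map snd mns)"
    using ev by eventually_elim (rule Gr_ambient)
  then show "((\<lambda>t. emb (c t)) has_vector_derivative emb v) (at 0)"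
    using has_velocity_iff[of c "map snd mns" 0 v] c' P v Gr_ambient[of P mns] by (simp add: ambient_iff)
qed

text \<open>The chain rule gives the same derivative along every admissible curve, and tangency
  provides at least one, so the definite description is determined. Any extension of
  \<open>f\<close> that is differentiable at the point may serve as \<phi>.\<close>

lemma dir_deriv_eq:
  assumes v: "v \<in> tangent (ambient mns) (Gr_prod mns) P"
    and \<phi>: "(\<phi> has_derivative \<phi>') (at (emb P))"
    and f: "\<And>Q. Q \<in> Gr_prod mns \<Longrightarrow> f Q = \<phi> (emb Q)"
  shows "dir_deriv (ambient mns) (Gr_prod mns) f P v = \<phi>' (emb v)"
proof -
  obtain c0 where c0: "curve_through (ambient mns) (Gr_prod mns) P v c0" and vE: "v \<in> ambient mns"
    using v by (auto simp: tangent_def)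
  have der: "((\<lambda>t. f (c t)) has_real_derivative \<phi>' (emb v)) (at 0)"
    if c: "curve_through (ambient mns) (Gr_prod mns) P v c" for c
  proof -
    note D = curve_throughD[OF c vE]
    have "((\<lambda>t. \<phi> (emb (c t))) has_derivative (\<lambda>x. \<phi>' (x *\<^sub>R emb v))) (at 0)"
      using has_derivative_compose[OF D(1)[unfolded has_vector_derivative_def]] \<phi> D(2) by simp
    moreover have "\<phi>' (x *\<^sub>R emb v) = \<phi>' (emb v) * x" for x
      using linear_scale[OF has_derivative_linear[OF \<phi>]] by simp
    ultimately have "((\<lambda>t. \<phi> (emb (c t))) has_real_derivative \<phi>' (emb v)) (at 0)"
      by (simp add: has_field_derivative_def)
    moreover have "\<forall>\<^sub>F t in nhds 0. \<phi> (emb (c t)) = f (c t)"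
      using D(4) D(2,3) f unfolding eventually_at_filter
      by (auto elim!: eventually_mono)
    ultimately show ?thesis using DERIV_cong_ev[of 0 0 "\<lambda>t. \<phi> (emb (c t))" "\<lambda>t. f (c t)"] by simp
  qed
  show ?thesis unfolding dir_deriv_def
  proof (rule the_equality)
    show "\<forall>c. curve_through (ambient mns) (Gr_prod mns) P v c \<longrightarrow>
      ((\<lambda>t. f (c t)) has_real_derivative \<phi>' (emb v)) (at 0)" using der by blast
    fix d
    assume "\<forall>c. curve_through (ambient mns) (Gr_prod mns) P v c \<longrightarrow>
      ((\<lambda>t. f (c t)) has_real_derivative d) (at 0)"
    with c0 show "d = \<phi>' (emb v)" using DERIV_unique der by blast
  qed
qed

text \<open>Differentiating both sides of \<gamma> \<gamma> = \<gamma> at 0 and comparing the two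
  derivatives.\<close>

lemma tangent_subset:
  assumes "v \<in> tangent (ambient mns) (Gr_prod mns) P"
  shows "v \<in> ambient mns" "emb v \<in> tspace (map snd mns) (emb P)"
proof -
  obtain c where c: "curve_through (ambient mns) (Gr_prod mns) P v c" and vE: "v \<in> ambient mns"
    using assms by (auto simp: tangent_def)
  show "v \<in> ambient mns" by fact
  note D = curve_throughD[OF c vE]
  let ?\<gamma> = "\<lambda>t. emb (c t)"
  have "((\<lambda>t. ?\<gamma> t * ?\<gamma> t) has_vector_derivative (?\<gamma> 0 * emb v + emb v * ?\<gamma> 0)) (at 0)"
    by (rule has_vector_derivative_mult[OF D(1) D(1)])
  moreover have "\<forall>\<^sub>F t in at 0. ?\<gamma> t * ?\<gamma> t = ?\<gamma> t"
    using D(4) by eventually_elim (simp add: projs_D(2)[OF Gr_projs])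
  moreover have "?\<gamma> 0 * ?\<gamma> 0 = ?\<gamma> 0" using D(2,3) by (simp add: projs_D(2)[OF Gr_projs])
  ultimately have "(?\<gamma> has_vector_derivative (?\<gamma> 0 * emb v + emb v * ?\<gamma> 0)) (at 0)"
    unfolding has_vector_derivative_def
    by (rule has_derivative_transform_eventually) simp_all
  then have "(\<lambda>x. x *\<^sub>R (emb P * emb v + emb v * emb P)) = (\<lambda>x. x *\<^sub>R emb v)"
    using has_derivative_unique D(1,2) unfolding has_vector_derivative_def by blast
  then have "emb P * emb v + emb v * emb P = emb v" by (metis scaleR_one)
  then show "emb v \<in> tspace (map snd mns) (emb P)"
    using vE by (simp add: tspace_def emb_herms ambient_iff)
qed

section \<open>Curves of projectors with prescribed velocity\<close>

fun ad_iter :: "fmat \<Rightarrow> fmat \<Rightarrow> nat \<Rightarrow> fmat" where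
  "ad_iter w p 0 = p"
| "ad_iter w p (Suc n) = w * ad_iter w p n - ad_iter w p n * w"

text \<open>
  The power series of \<open>exp (t w) p exp (- t w)\<close> and its derivatives, summed coordinatewise since
  \<open>fmat\<close> is not complete.
\<close>

definition ad_curve :: "nat list \<Rightarrow> fmat \<Rightarrow> fmat \<Rightarrow> nat \<Rightarrow> real \<Rightarrow> fmat" where
  "ad_curve ns w p k t =
     (\<Sum>b\<in>unit_idx ns. (\<Sum>n. inner (ad_iter w p (n + k)) (unit_vec b) / fact n * t ^ n) *\<^sub>R unit_vec b)"

lemma norm_ad_iter: "norm (ad_iter w p n) \<le> (2 * norm w) ^ n * norm p"
proof (induction n)
  case (Suc n)
  have "norm (ad_iter w p (Suc n)) \<le> norm w * norm (ad_iter w p n) + norm (ad_iter w p n) * norm w"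
    unfolding ad_iter.simps by (intro norm_diff_mono norm_mult_le order_refl)
  also have "\<dots> = 2 * norm w * norm (ad_iter w p n)" by simp
  also have "\<dots> \<le> 2 * norm w * ((2 * norm w) ^ n * norm p)"
    using Suc by (intro mult_left_mono) auto
  finally show ?case by (simp add: mult.assoc)
qed simp

lemma ad_iter_supp: "supp ns w \<Longrightarrow> supp ns p \<Longrightarrow> supp ns (ad_iter w p n)"
  by (induction n) (auto intro: supp_simps supp_mult)

lemma ad_iter_adjf: "adjf w = - w \<Longrightarrow> adjf p = p \<Longrightarrow> adjf (ad_iter w p n) = ad_iter w p n"
  by (induction n) auto

lemma ad_summable: "summable (\<lambda>n. inner (ad_iter w p (n + k)) y / fact n * (t :: real) ^ n)"
proof (rule summable_comparison_test')
  let ?C = "(2 * norm w) ^ k * norm p * norm y"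
  show "summable (\<lambda>n. ?C * (inverse (fact n) * (2 * norm w * \<bar>t\<bar>) ^ n))"
    by (intro summable_mult summable_exp)
  fix n :: nat assume "0 \<le> n"
  have "\<bar>inner (ad_iter w p (n + k)) y\<bar> \<le> norm (ad_iter w p (n + k)) * norm y"
    by (rule Cauchy_Schwarz_ineq2)
  also have "\<dots> \<le> (2 * norm w) ^ (n + k) * norm p * norm y"
    by (intro mult_right_mono norm_ad_iter) simp
  also have "\<dots> = ?C * (2 * norm w) ^ n" by (simp add: power_add)
  finally have "\<bar>inner (ad_iter w p (n + k)) y\<bar> * (inverse (fact n) * \<bar>t\<bar> ^ n)
      \<le> ?C * (2 * norm w) ^ n * (inverse (fact n) * \<bar>t\<bar> ^ n)"
    by (rule mult_right_mono) simp
  then show "norm (inner (ad_iter w p (n + k)) y / fact n * t ^ n)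
      \<le> ?C * (inverse (fact n) * (2 * norm w * \<bar>t\<bar>) ^ n)"
    by (simp add: abs_mult power_abs divide_inverse power_mult_distrib mult_ac)
qed

lemma ad_curve_deriv:
  "(ad_curve ns w p k has_vector_derivative ad_curve ns w p (Suc k) t) (at t)"
proof -
  have "((\<lambda>t. \<Sum>n. inner (ad_iter w p (n + k)) (unit_vec b) / fact n * t ^ n) has_real_derivative
      (\<Sum>n. inner (ad_iter w p (n + Suc k)) (unit_vec b) / fact n * t ^ n)) (at t)" for b
  proof -
    \<comment> \<open>Dividing by the factorial turns differentiation of the series into the index
      shift from k to k + 1.\<close>
    have d: "diffs (\<lambda>n. inner (ad_iter w p (n + k)) (unit_vec b) / fact n)
        = (\<lambda>n. inner (ad_iter w p (n + Suc k)) (unit_vec b) / fact n)"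
      by (rule ext)
        (simp add: diffs_def fact_Suc del: ad_iter.simps of_nat_Suc)
    show ?thesis
      using termdiffs_strong_converges_everywhere[OF ad_summable, of w p k "unit_vec b" t] unfolding d .
  qed
  then have "((\<lambda>t. (\<Sum>n. inner (ad_iter w p (n + k)) (unit_vec b) / fact n * t ^ n) *\<^sub>R unit_vec b)
      has_vector_derivative (\<Sum>n. inner (ad_iter w p (n
          + Suc k)) (unit_vec b) / fact n * t ^ n) *\<^sub>R unit_vec b) (at t)" for b
    by (intro bounded_linear.has_vector_derivative[OF bounded_linear_scaleR_left])
      (simp add: has_real_derivative_iff_has_vector_derivative)
  then show ?thesis
    unfolding ad_curve_def[abs_def] by (intro has_vector_derivative_sum)
qed

lemma ad_curve_sums:
  assumes "supp ns w" "supp ns p"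
  shows "(\<lambda>n. (t ^ n / fact n) *\<^sub>R ad_iter w p (n + k)) sums ad_curve ns w p k t"
proof -
  have "(\<lambda>n. \<Sum>b\<in>unit_idx ns. (inner (ad_iter w p (n
      + k)) (unit_vec b) / fact n * t ^ n) *\<^sub>R unit_vec b)
      sums ad_curve ns w p k t"
    unfolding ad_curve_def
    by (intro sums_sum bounded_linear.sums[OF bounded_linear_scaleR_left] summable_sums ad_summable)
  moreover have "(\<Sum>b\<in>unit_idx ns. (inner (ad_iter w p (n + k)) (unit_vec b) / fact n * t ^ n) *\<^sub>R unit_vec b)
      = (t ^ n / fact n) *\<^sub>R cproj ns (ad_iter w p (n + k))" for n
    by (simp add: cproj_def scaleR_sum_right mult.commute)
  ultimately show ?thesis
    by (simp add: cproj_id[OF ad_iter_supp[OF assms]])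
qed

text \<open>Being Hermitian and having support in \<open>idx ns\<close> mean being fixed by the
  bounded linear maps \<open>adjf\<close> and \<open>cproj ns\<close>, so both pass from the terms
  of the series to its sum.\<close>

lemma ad_curve_herms:
  assumes "supp ns w" "adjf w = - w" "p \<in> herms ns"
  shows "ad_curve ns w p k t \<in> herms ns"
proof -
  have p: "supp ns p" "adjf p = p" using assms by (auto simp: herms_def)
  note s = ad_curve_sums[OF assms(1) p(1), of t k]
  have "adjf (ad_curve ns w p k t) = ad_curve ns w p k t"
    using bounded_linear.sums[OF bounded_linear_adjf s] s
    by (simp add: ad_iter_adjf[OF assms(2) p(2)] sums_unique2 del: ad_iter.simps)
  moreover have "cproj ns (ad_curve ns w p k t) = ad_curve ns w p k t"
    using bounded_linear.sums[OF bounded_linear_cproj[of ns] s] s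
      linear_scale[OF bounded_linear.linear[OF bounded_linear_cproj[of ns]]]
    by (simp add: cproj_id[OF ad_iter_supp[OF assms(1) p(1)]] sums_unique2 del: ad_iter.simps)
  ultimately show ?thesis using supp_cproj[of ns] by (metis (mono_tags, lifting) herms_def mem_Collect_eq)
qed

text \<open>Applying the bounded map x -> w x - x w termwise raises the order of the commutators by
  one. With \<open>ad_curve_deriv\<close> this is the differential equation \<gamma>' = w \<gamma> -
  \<gamma> w.\<close>

lemma ad_curve_Suc:
  assumes "supp ns w" "supp ns p"
  shows "ad_curve ns w p (Suc k) t = w * ad_curve ns w p k t - ad_curve ns w p k t * w"
proof -
  have bl: "bounded_linear (\<lambda>x. w * x - x * w)"
    by (intro bounded_linear_sub bounded_linear_mult_left bounded_linear_mult_right)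
  have "(\<lambda>n. (t ^ n / fact n) *\<^sub>R ad_iter w p (n + Suc k)) sums
      (w * ad_curve ns w p k t - ad_curve ns w p k t * w)"
    using bounded_linear.sums[OF bl ad_curve_sums[OF assms, of t k]]
    by (simp add: scaleR_diff_right)
  then show ?thesis by (rule sums_unique2[OF ad_curve_sums[OF assms]])
qed

lemma ad_curve_0: "supp ns w \<Longrightarrow> supp ns p \<Longrightarrow> ad_curve ns w p k 0 = ad_iter w p k"
  using cproj_id[OF ad_iter_supp[of ns w p k]]
  unfolding ad_curve_def powser_zero by (simp add: cproj_def del: ad_iter.simps)

text \<open>The differential equation replaces multiplicativity of the exponential. The defect y =
  \<gamma> \<gamma> - \<gamma> obeys the same linear equation, whose flow preserves the norm because
  w is skew-adjoint; as y vanishes at 0, it vanishes throughout. Traces are constant because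
  commutators are traceless.\<close>

lemma ad_curve_projs:
  assumes w: "supp ns w" "adjf w = - w" and p: "p \<in> projs mns" and ns: "ns = map snd mns"
  shows "ad_curve ns w p 0 t \<in> projs mns"
proof -
  have pH: "p \<in> herms ns" "supp ns p" using projs_D[OF p] ns by auto
  define \<gamma> where "\<gamma> = ad_curve ns w p 0"
  have \<gamma>E: "\<gamma> t \<in> herms ns" "supp ns (\<gamma> t)" for t
    using ad_curve_herms[OF w pH(1)] by (auto simp: \<gamma>_def herms_def)
  have \<gamma>': "(\<gamma> has_vector_derivative (w * \<gamma> t - \<gamma> t * w)) (at t)" for t
    unfolding \<gamma>_def ad_curve_Suc[OF w(1) pH(2), symmetric] by (rule ad_curve_deriv)
  have \<gamma>0: "\<gamma> 0 = p" by (simp add: \<gamma>_def ad_curve_0[OF w(1) pH(2)])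
  define y where "y t = \<gamma> t * \<gamma> t - \<gamma> t" for t
  have "(y has_vector_derivative (\<gamma> t * (w * \<gamma> t - \<gamma> t * w)
      + (w * \<gamma> t - \<gamma> t * w) * \<gamma> t
      - (w * \<gamma> t - \<gamma> t * w))) (at t)" for t
    unfolding y_def[abs_def] by (intro has_vector_derivative_diff has_vector_derivative_mult \<gamma>')
  moreover have "\<gamma> t * (w * \<gamma> t - \<gamma> t * w) + (w * \<gamma> t - \<gamma> t * w) * \<gamma> t
      - (w * \<gamma> t - \<gamma> t * w) = w * y t - y t * w" for t
    by (simp add: y_def algebra_simps)
  ultimately have y': "(y has_vector_derivative (w * y t - y t * w)) (at t)" for t by simp
  have skew: "inner z (w * z - z * w) = 0" for z
  proof -
    have "inner z (w * z) = - inner z (w * z)"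
      using inner_mult_left[of w z z] by (simp add: w(2) inner_commute)
    moreover have "inner z (z * w) = - inner z (z * w)"
      using inner_mult_right[of z w z] by (simp add: w(2) inner_commute)
    ultimately show ?thesis by (simp add: inner_diff_right)
  qed
  have "((\<lambda>t. inner (y t) (y t)) has_vector_derivative
      (inner (y t) (w * y t - y t * w) + inner (w * y t - y t * w) (y t))) (at t)" for t
    by (rule bounded_bilinear.has_vector_derivative[OF bounded_bilinear_inner y' y'])
  moreover have "inner (y t) (w * y t - y t * w) + inner (w * y t - y t * w) (y t) = 0" for t
    by (metis inner_commute skew add_0)
  ultimately have "((\<lambda>t. inner (y t) (y t)) has_real_derivative 0) (at t)" for t
    by (simp add: has_real_derivative_iff_has_vector_derivative)
  then have "inner (y t) (y t) = inner (y 0) (y 0)" by (intro DERIV_isconst_all) blast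
  also have "y 0 = 0" by (simp add: y_def \<gamma>0 projs_D(2)[OF p])
  finally have idem: "\<gamma> t * \<gamma> t = \<gamma> t" by (simp add: y_def)
  have tr: "btrace ns j (\<gamma> t) = btrace ns j p" if j: "j < length ns" for j
  proof -
    have "((\<lambda>t. btrace ns j (\<gamma> t)) has_vector_derivative btrace ns j (w * \<gamma> t - \<gamma> t * w)) (at t)" for t
      by (rule bounded_linear.has_vector_derivative[OF bounded_linear_btrace \<gamma>'])
    moreover have "btrace ns j (w * \<gamma> t - \<gamma> t * w) = 0" for t
      using btrace_commute[OF w(1) \<gamma>E(2) j]
      by (simp add: linear_diff[OF bounded_linear.linear[OF bounded_linear_btrace]])
    ultimately have d: "((\<lambda>t. btrace ns j (\<gamma> t)) has_vector_derivative 0) (at t)" for t by simp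
    have "((\<lambda>t. Re (btrace ns j (\<gamma> t))) has_real_derivative 0) (at t) \<and>
      ((\<lambda>t. Im (btrace ns j (\<gamma> t))) has_real_derivative 0) (at t)" for t
      using bounded_linear.has_vector_derivative[OF bounded_linear_Re d[of t]]
        bounded_linear.has_vector_derivative[OF bounded_linear_Im d[of t]]
      by (simp_all add: has_real_derivative_iff_has_vector_derivative)
    then have "Re (btrace ns j (\<gamma> t))
        = Re (btrace ns j (\<gamma> 0)) \<and> Im (btrace ns j (\<gamma> t)) = Im (btrace ns j (\<gamma> 0))"
      using DERIV_isconst_all[of "\<lambda>t. Re (btrace ns j (\<gamma> t))" t 0]
        DERIV_isconst_all[of "\<lambda>t. Im (btrace ns j (\<gamma> t))" t 0] by blast
    then show ?thesis by (simp add: complex_eq_iff \<gamma>0)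
  qed
  show ?thesis
    using idem tr \<gamma>E(1)[of t] p ns unfolding \<gamma>_def projs_def by auto
qed

lemma tangent_supset:
  assumes P: "P \<in> Gr_prod mns" and v: "v \<in> ambient mns" "emb v \<in> tspace (map snd mns) (emb P)"
  shows "v \<in> tangent (ambient mns) (Gr_prod mns) P"
proof -
  define ns where "ns = map snd mns"
  define p where "p = emb P"
  define u where "u = emb v"
  \<comment> \<open>With this generator w p - p w = u p + p u - 2 p u p, which is u because u is
    tangent and p u p = 0.\<close>
  define w where "w = u * p - p * u"
  have p: "p \<in> projs mns" "p * p = p" "adjf p = p" "supp ns p" "p \<in> herms ns"
    using Gr_projs[OF P] projs_D by (auto simp: p_def ns_def)
  have u: "p * u + u * p = u" "adjf u = u" "supp ns u"
    using v(2) by (auto simp: u_def p_def tspace_def herms_def ns_def)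
  have w: "supp ns w" "adjf w = - w"
    using p u by (auto simp: w_def supp_simps supp_mult)
  define D where "D k t = unemb ns (ad_curve ns w p k t)" for k t
  have DE: "D k t \<in> her_prod ns" "emb (D k t) = ad_curve ns w p k t" for k t
    using unemb_her[OF ad_curve_herms[OF w p(5)]] by (auto simp: D_def)
  have vel: "has_velocity (D k) (D (Suc k) t) t" for k t
    using has_velocity_iff[of "D k" ns t "D (Suc k) t"] DE ad_curve_deriv by simp
  have "smooth_curve_on (ambient mns) {- 1<..<1} (D 0)"
    unfolding smooth_curve_on_def using DE vel by (intro exI[of _ D]) (auto simp: ambient_def ns_def)
  moreover have "D 0 t \<in> Gr_prod mns" for t
    using DE[of 0 t] ad_curve_projs[OF w p(1) ns_def] by (simp add: Gr_prod_iff ambient_def ns_def)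
  moreover have "D 0 0 = P"
    using unemb_emb[of P ns] Gr_ambient[OF P] ad_curve_0[OF w(1) p(4)]
    by (simp add: D_def p_def ns_def her_cprod)
  moreover have "D (Suc 0) 0 = v"
  proof -
    have "w * p - p * w = u"
      using u(1) tangent_sandwich[OF p(2) u(1)]
      by (simp add: w_def algebra_simps p(2) idem_assoc[OF p(2)])
    then show ?thesis
      using unemb_emb[of v ns] v(1) ad_curve_0[OF w(1) p(4), of "Suc 0"]
      by (simp add: D_def u_def ns_def her_cprod ambient_iff)
  qed
  ultimately have "curve_through (ambient mns) (Gr_prod mns) P v (D 0)"
    unfolding curve_through_def using vel[of 0 0] by (intro conjI exI[of _ 1]) auto
  then show ?thesis using v(1) unfolding tangent_def by blast
qed

lemma tangent_iff:
  assumes "P \<in> Gr_prod mns"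
  shows "v \<in> tangent (ambient mns) (Gr_prod mns) P
    \<longleftrightarrow> v \<in> ambient mns \<and> emb v \<in> tspace (map snd mns) (emb P)"
  using tangent_subset tangent_supset[OF assms] by blast

section \<open>Polynomial vector fields and the Levi-Civita connection\<close>

text \<open>\<open>poly_map\<close> is a relation, so a differential is chosen at each stage. The
  newest direction stands at the head, as in \<open>smooth_fun_open\<close>.\<close>

primrec iter_deriv :: "(fmat \<Rightarrow> fmat) \<Rightarrow> fmat list \<Rightarrow> fmat \<Rightarrow> fmat" where
  "iter_deriv f [] = f"
| "iter_deriv f (v # vs) = (\<lambda>x. (SOME f'. poly_map (iter_deriv f vs) f') x v)"

lemma iter_deriv_poly_map: "poly_map f f' \<Longrightarrow> \<exists>h. poly_map (iter_deriv f vs) h"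
proof (induction vs)
  case (Cons v vs)
  have "poly_map (iter_deriv f vs) (SOME f'. poly_map (iter_deriv f vs) f')"
    by (rule someI_ex[OF Cons.IH[OF Cons.prems]])
  then show ?case unfolding iter_deriv.simps by (rule poly_map_directional)
qed auto

lemma iter_deriv_has_derivative:
  assumes "poly_map f f'"
  shows "(iter_deriv f vs has_derivative (\<lambda>v. iter_deriv f (v # vs) x)) (at x)"
proof -
  have "poly_map (iter_deriv f vs) (SOME f'. poly_map (iter_deriv f vs) f')"
    by (rule someI_ex[OF iter_deriv_poly_map[OF assms]])
  from poly_map_has_derivative[OF this, of x] show ?thesis by simp
qed

text \<open>A polynomial is defined on the whole ambient space, which can therefore serve as the
  neighbourhood of every point.\<close>

lemma smooth_fun_poly_map:
  assumes \<chi>: "poly_map \<chi> \<chi>'" and l: "bounded_linear l"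
    and f: "\<And>Q. Q \<in> Gr_prod mns \<Longrightarrow> f Q = l (\<chi> (emb Q))"
  shows "smooth_fun (ambient mns) (Gr_prod mns) f"
proof -
  let ?E = "ambient mns"
  define F where "F vs Q = l (iter_deriv \<chi> (map emb vs) (emb Q))" for vs Q
  have d: "((\<lambda>x. l (iter_deriv \<chi> ws x)) has_derivative (\<lambda>v. l (iter_deriv \<chi> (v # ws) x))) (at x)"
    for ws x
    by (rule bounded_linear.has_derivative[OF l iter_deriv_has_derivative[OF \<chi>]])
  have "smooth_fun_open ?E ?E (\<lambda>Q. l (\<chi> (emb Q)))"
    unfolding smooth_fun_open_def
  proof (intro exI[of _ F] conjI allI impI ballI)
    show "F [] = (\<lambda>Q. l (\<chi> (emb Q)))" by (simp add: F_def[abs_def])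
    fix vs :: "mtuple list" assume "set vs \<subseteq> ?E"
    show "continuous_fun_on ?E (F vs)"
      unfolding continuous_fun_on_def
    proof (intro ballI allI impI)
      fix X and e :: real assume X: "X \<in> ?E" and e: "0 < e"
      let ?f = "\<lambda>x. l (iter_deriv \<chi> (map emb vs) x)"
      have "(?f \<longlongrightarrow> ?f (emb X)) (at (emb X))"
        using has_derivative_continuous[OF d] by (simp add: continuous_within)
      then have "\<forall>\<^sub>F y in at (emb X). dist (?f y) (?f (emb X)) < e" using e by (rule tendstoD)
      then obtain \<delta> where \<delta>: "\<delta> > 0"
        "\<And>y. y \<noteq> emb X \<Longrightarrow> dist y (emb X) < \<delta>
            \<Longrightarrow> dist (?f y) (?f (emb X)) < e"
        unfolding eventually_at by blast
      have "\<bar>F vs Y - F vs X\<bar> < e" if Y: "Y \<in> ?E" "tdist Y X < \<delta>" for Y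
      proof (cases "emb Y = emb X")
        case True
        then show ?thesis using e by (simp add: F_def)
      next
        case False
        then show ?thesis
          using \<delta>(2)[of "emb Y"] Y X
          by (simp add: tdist_emb[of _ "map snd mns"] ambient_iff dist_norm F_def)
      qed
      then show "\<exists>d>0. \<forall>Y\<in>?E. tdist Y X < d
          \<longrightarrow> \<bar>F vs Y - F vs X\<bar> < e" using \<delta>(1) by blast
    qed
    fix v X assume vX: "v \<in> ?E" "X \<in> ?E"
    have eq: "F vs (tadd X (tscale t v))
        = l (iter_deriv \<chi> (map emb vs) (emb X + t *\<^sub>R emb v))" for t
      using her_emb_tops(1)[of X "map snd mns" "tscale t v"] her_emb_tops(3)[of v "map snd mns" v t]
        her_tops(3)[of v "map snd mns" v t] vX
      by (simp add: F_def ambient_iff)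
    have "((\<lambda>t. emb X + t *\<^sub>R emb v) has_derivative (\<lambda>t. t *\<^sub>R emb v)) (at 0)"
      by (auto intro!: derivative_eq_intros)
    from has_derivative_compose[OF this, of "\<lambda>x. l (iter_deriv \<chi> (map emb vs) x)"]
    have "((\<lambda>t. F vs (tadd X (tscale t v))) has_derivative
        (\<lambda>t. l (iter_deriv \<chi> ((t *\<^sub>R emb v) # map emb vs) (emb X)))) (at 0)"
      unfolding eq using d[of "map emb vs" "emb X"] by simp
    moreover have "l (iter_deriv \<chi> ((t *\<^sub>R emb v) # map emb vs) (emb X)) = F (v # vs) X * t" for t
      using linear_scale[OF has_derivative_linear[OF d[of "map emb vs" "emb X"]], of t "emb v"]
      by (simp add: F_def)
    ultimately show "((\<lambda>t. F vs (tadd X (tscale t v))) has_real_derivative F (v # vs) X) (at 0)"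
      by (simp add: has_field_derivative_def)
  qed
  moreover have "open_in ?E ?E" by (auto simp: open_in_def intro: exI[of _ 1])
  ultimately show ?thesis
    unfolding smooth_fun_def using f Gr_ambient[of _ mns]
    by (intro ballI exI[of _ ?E] exI[of _ "\<lambda>Q. l (\<chi> (emb Q))"]) (simp add: ambient_iff)
qed

text \<open>Fields that agree on the manifold with a polynomial \<chi> whose differential \<chi>' is
  known. Both the gradient and extensions of single tangent vectors are of this kind.\<close>

definition poly_field ::
    "(nat \<times> nat) list \<Rightarrow> (mtuple \<Rightarrow> mtuple) \<Rightarrow> (fmat \<Rightarrow> fmat) \<Rightarrow> (fmat \<Rightarrow> fmat \<Rightarrow> fmat) \<Rightarrow> bool" where
  "poly_field mns X \<chi> \<chi>' \<longleftrightarrow> poly_map \<chi> \<chi>' \<and>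
     (\<forall>Q\<in>Gr_prod mns. X Q \<in> tangent (ambient mns) (Gr_prod mns) Q \<and> emb (X Q) = \<chi> (emb Q))"

lemma poly_fieldD:
  assumes "poly_field mns X \<chi> \<chi>'"
  shows "poly_map \<chi> \<chi>'" "Q \<in> Gr_prod mns \<Longrightarrow> X Q \<in> tangent (ambient mns) (Gr_prod mns) Q"
    "Q \<in> Gr_prod mns \<Longrightarrow> X Q \<in> her_prod (map snd mns)"
        "Q \<in> Gr_prod mns \<Longrightarrow> emb (X Q) = \<chi> (emb Q)"
  using assms tangent_subset(1) by (auto simp: poly_field_def ambient_iff)

lemma poly_field_vector_field:
  assumes "poly_field mns X \<chi> \<chi>'"
  shows "vector_field (ambient mns) (Gr_prod mns) X"
proof -
  note X = poly_fieldD[OF assms]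
  have "smooth_fun (ambient mns) (Gr_prod mns) (\<lambda>P. tinner (X P) v)" if "v \<in> ambient mns" for v
    using X(3,4) that
    by (intro smooth_fun_poly_map[OF X(1) bounded_linear_inner_left[of "emb v"]])
      (simp add: tinner_emb[of _ "map snd mns"] ambient_iff)
  then show ?thesis using X(2) by (auto simp: vector_field_def)
qed

lemma unemb_tangent:
  assumes "P \<in> Gr_prod mns" "u \<in> tspace (map snd mns) (emb P)"
  shows "unemb (map snd mns) u \<in> tangent (ambient mns) (Gr_prod mns) P" "emb (unemb (map snd mns) u) = u"
  using assms unemb_her[of u "map snd mns"] by (auto simp: tangent_iff ambient_iff tspace_def)

text \<open>Projecting one fixed \<open>u\<close> to every tangent space gives a global field; at a
  point where \<open>u\<close> is already tangent, its value is \<open>u\<close>.\<close>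

lemma poly_field_extension:
  assumes "u \<in> herms (map snd mns)"
  shows "\<exists>\<chi>'. poly_field mns (\<lambda>Q. unemb (map snd mns) (tproj (emb Q) u)) (\<lambda>x. tproj x u) \<chi>'"
  using poly_map_tproj[OF poly_map_const[of u]] unemb_tangent tproj_tspace projs_D[OF Gr_projs] assms
  unfolding poly_field_def by blast

lemma levi_civita_tangent:
  assumes lc: "levi_civita (ambient mns) (Gr_prod mns) nab"
    and P: "P \<in> Gr_prod mns" and U: "poly_field mns U \<alpha> \<alpha>'" and V: "poly_field mns V \<beta> \<beta>'"
  shows "nab P (U P) V \<in> tangent (ambient mns) (Gr_prod mns) P"
  using lc P poly_fieldD(2)[OF U P] poly_field_vector_field[OF V]
  unfolding levi_civita_def affine_connection_def by blast

lemma levi_civita_metric: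
  assumes lc: "levi_civita (ambient mns) (Gr_prod mns) nab"
    and P: "P \<in> Gr_prod mns" and U: "poly_field mns U \<alpha> \<alpha>'" and V: "poly_field mns V \<beta> \<beta>'"
    and W: "poly_field mns W \<gamma> \<gamma>'"
  shows "inner (\<beta>' (emb P) (emb (U P))) (emb (W P)) + inner (\<gamma>' (emb P) (emb (U P))) (emb (V P))
    = inner (emb (nab P (U P) V)) (emb (W P)) + inner (emb (nab P (U P) W)) (emb (V P))"
proof -
  let ?ns = "map snd mns"
  note V' = poly_fieldD[OF V] and W' = poly_fieldD[OF W] and U' = poly_fieldD[OF U]
  have her: "nab P (U P) V \<in> her_prod ?ns" "nab P (U P) W \<in> her_prod ?ns"
    using levi_civita_tangent[OF lc P U] V W tangent_subset(1) ambient_iff by blast+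
  have "dir_deriv (ambient mns) (Gr_prod mns) (\<lambda>Q. tinner (V Q) (W Q)) P (U P)
      = inner (\<beta> (emb P)) (\<gamma>' (emb P) (emb (U P))) + inner (\<beta>' (emb P) (emb (U P))) (\<gamma> (emb P))"
    using U'(2)[OF P]
  proof (rule dir_deriv_eq)
    show "((\<lambda>x. inner (\<beta> x) (\<gamma> x)) has_derivative
      (\<lambda>v. inner (\<beta> (emb P)) (\<gamma>' (emb P) v)
          + inner (\<beta>' (emb P) v) (\<gamma> (emb P)))) (at (emb P))"
      by (rule has_derivative_inner) (rule poly_map_has_derivative V' W')+
  qed (simp add: tinner_emb[of _ ?ns] V' W')
  moreover have "dir_deriv (ambient mns) (Gr_prod mns) (\<lambda>Q. tinner (V Q) (W Q)) P (U P)
      = tinner (nab P (U P) V) (W P) + tinner (V P) (nab P (U P) W)"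
    using lc P poly_field_vector_field[OF V] poly_field_vector_field[OF W] U'(2)[OF P]
    unfolding levi_civita_def metric_compatible_def by blast
  ultimately show ?thesis
    by (simp add: tinner_emb[of _ ?ns] her V' W' P inner_commute)
qed

text \<open>Torsion-freeness is only needed for the linear functions \<open>Q \<mapsto> \<langle>Q, w\<rangle>\<close>.\<close>

lemma levi_civita_torsion:
  assumes lc: "levi_civita (ambient mns) (Gr_prod mns) nab"
    and P: "P \<in> Gr_prod mns" and U: "poly_field mns U \<alpha> \<alpha>'" and V: "poly_field mns V \<beta> \<beta>'"
    and w: "w \<in> herms (map snd mns)"
  shows "inner (emb (nab P (U P) V)) w - inner (emb (nab P (V P) U)) w
    = inner (\<beta>' (emb P) (emb (U P))) w - inner (\<alpha>' (emb P) (emb (V P))) w"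
proof -
  let ?ns = "map snd mns" and ?E = "ambient mns" and ?M = "Gr_prod mns"
  note V' = poly_fieldD[OF V] and U' = poly_fieldD[OF U]
  define f where "f Q = inner (emb Q) w" for Q
  have sm: "smooth_fun ?E ?M f"
    by (rule smooth_fun_poly_map[OF poly_map_id bounded_linear_inner_left]) (simp add: f_def)
  have df: "dir_deriv ?E ?M f Q v = inner (emb v) w" if "v \<in> tangent ?E ?M Q" for Q v
    using that by (rule dir_deriv_eq[where \<phi> = "\<lambda>x. inner x w"])
      (simp_all add: f_def bounded_linear_imp_has_derivative bounded_linear_inner_left)
  have dd: "dir_deriv ?E ?M (\<lambda>Q. dir_deriv ?E ?M f Q (Y Q)) P v = inner (\<eta>' (emb P) (emb v)) w"
    if Y: "poly_field mns Y \<eta> \<eta>'" and v: "v \<in> tangent ?E ?M P" for Y \<eta> \<eta>' v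
    using v
  proof (rule dir_deriv_eq)
    note Y' = poly_fieldD[OF Y]
    show "((\<lambda>x. inner (\<eta> x) w) has_derivative (\<lambda>v. inner (\<eta>' (emb P) v) w)) (at (emb P))"
      by (rule has_derivative_inner_left) (rule poly_map_has_derivative[OF Y'(1)])
    show "\<And>Q. Q \<in> ?M \<Longrightarrow> dir_deriv ?E ?M f Q (Y Q) = inner (\<eta> (emb Q)) w"
      by (simp add: df Y')
  qed
  have t: "nab P (U P) V \<in> tangent ?E ?M P" "nab P (V P) U \<in> tangent ?E ?M P"
    using levi_civita_tangent[OF lc P] U V by blast+
  then have her: "nab P (U P) V \<in> her_prod ?ns" "nab P (V P) U \<in> her_prod ?ns"
    using tangent_subset(1) ambient_iff by blast+
  have "tdiff (nab P (U P) V) (nab P (V P) U) \<in> tangent ?E ?M P"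
    using t subspace_diff[OF tspace_subspace] her_tops(2)[OF her]
    by (simp add: tangent_iff[OF P] her_emb_tops(2)[OF her] ambient_iff)
  from df[OF this] have "inner (emb (nab P (U P) V)) w - inner (emb (nab P (V P) U)) w
    = dir_deriv ?E ?M f P (tdiff (nab P (U P) V) (nab P (V P) U))"
    by (simp add: her_emb_tops(2)[OF her] inner_diff_left)
  also have "\<dots> = dir_deriv ?E ?M (\<lambda>Q. dir_deriv ?E ?M f Q (V Q)) P (U P)
      - dir_deriv ?E ?M (\<lambda>Q. dir_deriv ?E ?M f Q (U Q)) P (V P)"
    using lc P poly_field_vector_field[OF U] poly_field_vector_field[OF V] sm
    unfolding levi_civita_def torsion_free_def by blast
  finally show ?thesis using dd U V U'(2)[OF P] V'(2)[OF P] by simp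
qed

text \<open>
  The difference \<open>\<langle>\<nabla>\<^sub>U V - DV(U), W\<rangle>\<close> is symmetric in \<open>U, V\<close> (no torsion) and skew in \<open>V, W\<close>
  (metric compatibility), hence zero.
\<close>

lemma levi_civita_eq_projected_derivative:
  assumes lc: "levi_civita (ambient mns) (Gr_prod mns) nab"
    and P: "P \<in> Gr_prod mns" and U: "poly_field mns U \<alpha> \<alpha>'" and V: "poly_field mns V \<beta> \<beta>'"
    and W: "poly_field mns W \<gamma> \<gamma>'"
  shows "inner (emb (nab P (U P) V)) (emb (W P)) = inner (\<beta>' (emb P) (emb (U P))) (emb (W P))"
proof -
  note m = levi_civita_metric[OF lc P]
  note t = levi_civita_torsion[OF lc P]
  have E: "emb (U P) \<in> herms (map snd mns)" "emb (V P) \<in> herms (map snd mns)" "emb (W P) \<in> herms (map snd mns)"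
    using poly_fieldD(3)[OF U P] poly_fieldD(3)[OF V P] poly_fieldD(3)[OF W P] emb_herms by blast+
  \<comment> \<open>As in the Koszul formula: metric compatibility for the three cyclic arrangements
    and the three torsion identities form a linear system for the inner products.\<close>
  show ?thesis
    using m[OF U V W] m[OF V W U] m[OF W U V] t[OF U V E(3)] t[OF V W E(1)] t[OF W U E(2)]
    by linarith
qed

text \<open>On tangent vectors \<open>tproj\<close> can be moved off \<open>G\<close> by
  self-adjointness, so the projected vector represents the differential; testing the difference of
  two representatives against itself gives uniqueness.\<close>

lemma rgrad_eq:
  assumes P: "P \<in> Gr_prod mns" and \<phi>: "(\<phi> has_derivative \<phi>') (at (emb P))"
    and f: "\<And>Q. Q \<in> Gr_prod mns \<Longrightarrow> f Q = \<phi> (emb Q)"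
    and G: "G \<in> herms (map snd mns)" "\<And>v. v \<in> herms (map snd mns) \<Longrightarrow> inner G v = \<phi>' v"
  shows "rgrad (ambient mns) (Gr_prod mns) f P = unemb (map snd mns) (tproj (emb P) G)"
proof -
  let ?ns = "map snd mns" and ?E = "ambient mns" and ?M = "Gr_prod mns" and ?p = "emb P"
  note p = projs_D[OF Gr_projs[OF P]]
  have prT: "tproj ?p G \<in> tspace ?ns ?p" using p G by (intro tproj_tspace)
  note gT = unemb_tangent[OF P prT]
  have her: "v \<in> tangent ?E ?M P \<Longrightarrow> v \<in> her_prod ?ns" for v
    using tangent_subset(1) ambient_iff by blast
  have val: "inner (tproj ?p G) (emb v) = dir_deriv ?E ?M f P v" if v: "v \<in> tangent ?E ?M P" for v
  proof -
    have v': "emb v \<in> tspace ?ns ?p" using tangent_subset(2)[OF v] .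
    then have "inner (tproj ?p G) (emb v) = inner G (emb v)"
      using inner_tproj[OF p(3)] tproj_id[OF p(2)] by (simp add: tspace_def)
    also have "\<dots> = \<phi>' (emb v)" using v' G(2) by (simp add: tspace_def)
    finally show ?thesis using dir_deriv_eq[OF v \<phi> f] by simp
  qed
  show ?thesis unfolding rgrad_def
  proof (rule the_equality)
    show "unemb ?ns (tproj ?p G) \<in> tangent ?E ?M P \<and>
      (\<forall>\<xi>\<in>tangent ?E ?M P. tinner (unemb ?ns (tproj ?p G)) \<xi> = dir_deriv ?E ?M f P \<xi>)"
      using gT val her[OF gT(1)] her by (simp add: tinner_emb[of _ ?ns])
    fix g assume g: "g \<in> tangent ?E ?M P \<and> (\<forall>\<xi>\<in>tangent ?E ?M P. tinner g \<xi>
        = dir_deriv ?E ?M f P \<xi>)"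
    have "emb g - tproj ?p G \<in> tspace ?ns ?p"
      using tangent_subset(2) g prT subspace_diff[OF tspace_subspace] by blast
    note d = unemb_tangent[OF P this]
    have "inner (emb g) (emb g - tproj ?p G) = inner (tproj ?p G) (emb g - tproj ?p G)"
      using g val[OF d(1)] d her[OF d(1)] her[of g] by (auto simp: tinner_emb[of _ ?ns])
    then have "inner (emb g - tproj ?p G) (emb g - tproj ?p G) = 0" by (simp add: inner_diff_left)
    then have "emb g = emb (unemb ?ns (tproj ?p G))" using gT(2) by simp
    then show "g = unemb ?ns (tproj ?p G)" using her_emb_inj her g gT(1) by blast
  qed
qed

section \<open>The Rayleigh quotient\<close>

lemma kronecker_list_carrier:
  assumes "P \<in> cprod ns"
  shows "kronecker_list P \<in> carrier_mat (prod_list ns) (prod_list ns)"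
  using assms
proof (induction ns arbitrary: P)
  case (Cons n ns)
  then obtain X Xs where P: "P = X # Xs" by (cases P) (auto simp: cprod_def)
  have "X \<in> carrier_mat n n" "Xs \<in> cprod ns"
    using Cons.prems by (fastforce simp: P cprod_def)+
  then show ?case using Cons.IH[of Xs] by (auto simp: P kronecker_list_def kronecker_def)
qed (simp add: cprod_def kronecker_list_def)

lemma cprod_drop: "P \<in> cprod ns \<Longrightarrow> drop s P \<in> cprod (drop s ns)"
  by (auto simp: cprod_def)

text \<open>Scalar polynomials are encoded as multiples of the idempotent \<open>single 0 0 0 1\<close>.\<close>

lemma kronecker_list_entry_poly_map:
  assumes "s \<le> length ns" "k < prod_list (drop s ns)" "i < prod_list (drop s ns)"
  shows "\<exists>f f'. poly_map f f' \<and>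
    (\<forall>P\<in>cprod ns. f (emb P) = single 0 0 0 (kronecker_list (drop s P) $$ (k, i)))"
  using assms
proof (induction s arbitrary: k i rule: inc_induct)
  \<comment> \<open>The induction descends from the empty tail, whose Kronecker product is the 1 by
    1 identity, so both indices are 0.\<close>
  case base
  then show ?case
    by (intro exI[of _ "\<lambda>x. single 0 0 0 1"] exI[of _ "\<lambda>x v. 0"])
      (auto simp: poly_map_const cprod_def kronecker_list_def)
next
  case (step s)
  define N where "N = prod_list (drop (Suc s) ns)"
  have ds: "drop s ns = ns ! s # drop (Suc s) ns" using step.hyps by (simp add: Cons_nth_drop_Suc)
  have ki: "k < ns ! s * N" "i < ns ! s * N" using step.prems by (auto simp: ds N_def)
  then have N: "0 < N" by (cases N) auto
  have b: "k div N < ns ! s" "i div N < ns ! s" using ki by (auto simp: less_mult_imp_div_less)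
  have "k mod N < prod_list (drop (Suc s) ns)" "i mod N < prod_list (drop (Suc s) ns)"
    using N by (auto simp: N_def)
  from step.IH[OF this] obtain f f' where f: "poly_map f f'"
    "\<And>P. P \<in> cprod ns \<Longrightarrow>
        f (emb P) = single 0 0 0 (kronecker_list (drop (Suc s) P) $$ (k mod N, i mod N))"
    by blast
  have bl: "bounded_linear (\<lambda>x. single 0 0 0 (ent x s (k div N) (i div N)))"
    by (rule bounded_linear_compose[OF bounded_linear_single bounded_linear_ent])
  note pm = poly_map_mult[OF poly_map_lin[OF bl poly_map_id] f(1)]
  have "single 0 0 0 (ent (emb P) s (k div N) (i div N)) * f (emb P)
      = single 0 0 0 (kronecker_list (drop s P) $$ (k, i))" if P: "P \<in> cprod ns" for P
  proof -
    have "s < length P" using P step.hyps by (simp add: cprod_def)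
    then have dP: "drop s P = P ! s # drop (Suc s) P" by (simp add: Cons_nth_drop_Suc)
    have c: "P ! s \<in> carrier_mat (ns ! s) (ns ! s)" using cprodD(2)[OF P] step.hyps by blast
    have K: "kronecker_list (drop (Suc s) P) \<in> carrier_mat N N"
      unfolding N_def by (rule kronecker_list_carrier[OF cprod_drop[OF P]])
    have "kronecker_list (drop s P) = kronecker (P ! s) (kronecker_list (drop (Suc s) P))"
      by (simp add: dP kronecker_list_def)
    also have "\<dots> $$ (k, i) = P ! s $$ (k div N, i div N) * kronecker_list (drop (Suc s) P) $$ (k mod N, i mod N)"
      using c K ki by (auto simp: kronecker_def)
    finally show ?thesis
      using b step.hyps by (simp add: f(2)[OF P] single_mult_single ent_emb[OF P] idx_iff)
  qed
  then show ?case using pm by blast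
qed

text \<open>The trace is a finite sum of entries of A times entries of the Kronecker product;
  pairing with \<open>single 0 0 0 1\<close> reads off its real part.\<close>

lemma rayleigh_poly_map:
  assumes A: "A \<in> carrier_mat (prod_list ns) (prod_list ns)"
  shows "\<exists>f f'. poly_map f f' \<and> (\<forall>P\<in>cprod ns. rayleigh A P = inner (f (emb P)) (single 0 0 0 1))"
proof -
  let ?N = "prod_list ns"
  have "\<exists>f f'. poly_map f f' \<and> (\<forall>P\<in>cprod ns. f (emb P) = single 0 0 0 (kronecker_list P $$ (k, i)))"
    if "k < ?N" "i < ?N" for k i
    using kronecker_list_entry_poly_map[of 0 ns k i] that by simp
  then obtain f f' where f: "\<And>k i. k < ?N \<Longrightarrow> i < ?N \<Longrightarrow> poly_map (f k i) (f' k i)"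
    "\<And>k i P. k < ?N \<Longrightarrow> i < ?N \<Longrightarrow> P \<in> cprod ns
        \<Longrightarrow> f k i (emb P) = single 0 0 0 (kronecker_list P $$ (k, i))"
    by metis
  define r where "r x = (\<Sum>i<?N. \<Sum>c<?N. single 0 0 0 (A $$ (i, c)) * f c i x)" for x
  have "\<exists>r'. poly_map r r'"
    unfolding r_def[abs_def]
  proof (intro poly_map_sum)
    fix i c assume "i \<in> {..<?N}" "c \<in> {..<?N}"
    then show "\<exists>h. poly_map (\<lambda>x. single 0 0 0 (A $$ (i, c)) * f c i x) h"
      using poly_map_mult[OF poly_map_const f(1)] by blast
  qed
  moreover have "rayleigh A P = inner (r (emb P)) (single 0 0 0 1)" if P: "P \<in> cprod ns" for P
  proof -
    note K = kronecker_list_carrier[OF P]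
    have "rayleigh A P = Re (\<Sum>i<?N. \<Sum>c<?N. A $$ (i, c) * kronecker_list P $$ (c, i))"
      using A by (simp add: rayleigh_def mtrace_def mult_mat_index[OF A K])
    also have "\<dots> = inner (r (emb P)) (single 0 0 0 1)"
      by (simp add: r_def inner_sum_left f(2)[OF _ _ P] single_mult_single inner_single ent_single)
    finally show ?thesis .
  qed
  ultimately show ?thesis by blast
qed

text \<open>The coordinates of the gradient are directional derivatives of \<open>r\<close> along
  the finite basis, hence polynomial again; \<open>hproj\<close> makes the result Hermitian. Here
  \<open>e\<close> is the vector that reads off the scalar value.\<close>

lemma polynomial_gradient:
  assumes r: "poly_map r r'"
  shows "\<exists>G G'. projector_newton ns G G' \<and>
    (\<forall>x. \<forall>v\<in>herms ns. inner (G x) v = inner (r' x v) e)"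
proof -
  have "\<forall>i. \<exists>h. poly_map (\<lambda>x. r' x (unit_vec i)) h"
    by (intro allI poly_map_directional[OF r])
  from choice[OF this] obtain h where h: "\<And>i. poly_map (\<lambda>x. r' x (unit_vec i)) (h i)" by blast
  have bl: "bounded_linear (\<lambda>y. inner y e *\<^sub>R unit_vec i)" for i
    by (intro bounded_linear_compose[OF bounded_linear_scaleR_left] bounded_linear_inner_left)
  define G where "G x = hproj ns (\<Sum>i\<in>unit_idx ns. inner (r' x (unit_vec i)) e *\<^sub>R unit_vec i)" for x
  define G' where "G' x v = hproj ns (\<Sum>i\<in>unit_idx ns. inner (h i x v) e *\<^sub>R unit_vec i)" for x v
  have "projector_newton ns G G'"
  proof
    show "poly_map G G'"
      unfolding G_def[abs_def] G'_def[abs_def]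
      by (intro poly_map_lin[OF bounded_linear_hproj] poly_map_sum_deriv poly_map_lin[OF bl h])
  qed (simp_all add: G_def G'_def hproj_in)
  moreover have "inner (G x) v = inner (r' x v) e" if v: "v \<in> herms ns" for x v
  proof -
    have v': "v = cproj ns v" using v by (simp add: herms_def cproj_id)
    note lin = bounded_linear.linear[OF poly_map_linear[OF r, of x]]
    have "inner (G x) v = (\<Sum>i\<in>unit_idx ns. inner v (unit_vec i) * inner (r' x (unit_vec i)) e)"
      unfolding G_def inner_hproj[OF v] by (simp add: inner_sum_left inner_commute[of v] mult.commute)
    also have "\<dots> = inner (r' x (cproj ns v)) e"
      unfolding cproj_def by (simp add: linear_sum[OF lin] linear_scale[OF lin] inner_sum_left)
    finally show ?thesis using v' by simp
  qed
  ultimately show ?thesis by blast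
qed

locale rayleigh_newton = projector_newton ns G G' for ns G G' +
  fixes mns :: "(nat \<times> nat) list" and A :: "complex mat" and r :: "fmat \<Rightarrow> fmat"
    and r' :: "fmat \<Rightarrow> fmat \<Rightarrow> fmat" and e :: fmat
  assumes ns: "ns = map snd mns"
    and r: "poly_map r r'"
    and rayleigh: "\<And>P. P \<in> cprod ns \<Longrightarrow> rayleigh A P = inner (r (emb P)) e"
    and grad: "\<And>x v. v \<in> herms ns \<Longrightarrow> inner (G x) v = inner (r' x v) e"
begin

lemma rayleigh_derivative:
  "((\<lambda>x. inner (r x) e) has_derivative (\<lambda>v. inner (r' x v) e)) (at x)"
  by (rule has_derivative_inner_left[OF poly_map_has_derivative[OF r]])

lemma rayleigh_Gr: "Q \<in> Gr_prod mns \<Longrightarrow> rayleigh A Q = inner (r (emb Q)) e"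
  using rayleigh her_cprod Gr_ambient ns by blast

lemma rgrad_rayleigh:
  assumes P: "P \<in> Gr_prod mns"
  shows "rgrad (ambient mns) (Gr_prod mns) (rayleigh A) P = unemb ns (g (emb P))"
  using rgrad_eq[OF P rayleigh_derivative rayleigh_Gr, of "G (emb P)"] grad
    G_herms[OF projs_D(1)[OF Gr_projs[OF P], folded ns]]
  by (simp add: g_def ns)

lemma rgrad_poly_field: "poly_field mns (rgrad (ambient mns) (Gr_prod mns) (rayleigh A)) g dgrad"
  unfolding poly_field_def
proof (intro conjI ballI poly_map_g)
  fix Q assume Q: "Q \<in> Gr_prod mns"
  have "g (emb Q) \<in> tspace (map snd mns) (emb Q)"
    using g_tspace[OF projs_D(2)[OF Gr_projs[OF Q]]] projs_D(1)[OF Gr_projs[OF Q]] by (simp add: ns)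
  note t = unemb_tangent[OF Q this]
  show "rgrad (ambient mns) (Gr_prod mns) (rayleigh A) Q \<in> tangent (ambient mns) (Gr_prod mns) Q"
    "emb (rgrad (ambient mns) (Gr_prod mns) (rayleigh A) Q) = g (emb Q)"
    unfolding rgrad_rayleigh[OF Q] ns by (rule t)+
qed

text \<open>The projected gradient is itself an admissible test direction, and the derivative along
  it is its squared norm.\<close>

lemma critical_point_rayleigh:
  assumes "critical_point (ambient mns) (Gr_prod mns) (rayleigh A) P"
  shows "g (emb P) = 0"
proof -
  have P: "P \<in> Gr_prod mns" using assms by (simp add: critical_point_def)
  note p = projs_D[OF Gr_projs[OF P]]
  have gT: "g (emb P) \<in> tspace (map snd mns) (emb P)" using g_tspace p ns by simp
  note t = unemb_tangent[OF P gT]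
  have "0 = dir_deriv (ambient mns) (Gr_prod mns) (rayleigh A) P (unemb (map snd mns) (g (emb P)))"
    using assms t by (simp add: critical_point_def)
  also have "\<dots> = inner (r' (emb P) (g (emb P))) e"
    using dir_deriv_eq[OF t(1) rayleigh_derivative rayleigh_Gr] t(2) by simp
  also have "\<dots> = inner (G (emb P)) (g (emb P))" using grad[OF tspace_D(1)[OF gT[folded ns]]] by simp
  also have "\<dots> = inner (g (emb P)) (g (emb P))"
    using inner_tproj[OF p(3), of "G (emb P)" "g (emb P)"] tproj_id[OF p(2) tspace_D(2)[OF gT[folded ns]]]
    by (simp add: g_def)
  finally show ?thesis by simp
qed

text \<open>Both sides are tangent, so it suffices to pair them with tangent vectors w. Extending
  \<xi> and w to polynomial fields brings the comparison with the ambient derivative to bear on the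
  gradient field.\<close>

lemma rhess_rayleigh:
  assumes lc: "levi_civita (ambient mns) (Gr_prod mns) nab"
    and P: "P \<in> Gr_prod mns" and \<xi>: "\<xi> \<in> tangent (ambient mns) (Gr_prod mns) P"
  shows "rhess (ambient mns) (Gr_prod mns) nab (rayleigh A) P \<xi> = unemb ns (hess (emb P) (emb \<xi>))"
proof -
  let ?E = "ambient mns" and ?M = "Gr_prod mns" and ?p = "emb P" and ?u = "emb \<xi>"
  let ?ext = "\<lambda>u Q. unemb (map snd mns) (tproj (emb Q) u)"
  note p = projs_D[OF Gr_projs[OF P]]
  have ext: "?ext (emb v) P = v" if v: "v \<in> tangent ?E ?M P" for v
    using tangent_subset[OF v] tproj_id[OF p(2)]
    by (simp add: tspace_def unemb_emb her_cprod ambient_iff)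
  have uT: "?u \<in> tspace ns ?p" using tangent_subset(2)[OF \<xi>] ns by simp
  let ?h = "nab P \<xi> (rgrad ?E ?M (rayleigh A))"
  obtain \<alpha>' where U: "poly_field mns (?ext ?u) (\<lambda>x. tproj x ?u) \<alpha>'"
    using poly_field_extension tspace_D(1)[OF uT] ns by blast
  have hT: "?h \<in> tangent ?E ?M P"
    using levi_civita_tangent[OF lc P U rgrad_poly_field] ext[OF \<xi>] by simp
  have val: "inner (emb ?h) w = inner (hess ?p ?u) w" if w: "w \<in> tspace ns ?p" for w
  proof -
    note w' = unemb_tangent[OF P, of w, folded ns, OF w]
    obtain \<gamma>' where W: "poly_field mns (?ext w) (\<lambda>x. tproj x w) \<gamma>'"
      using poly_field_extension tspace_D(1)[OF w] ns by blast
    have e: "?ext w P = unemb ns w" using ext[OF w'(1)] w'(2) by simp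
    have "inner (emb ?h) w = inner (dgrad ?p ?u) w"
      using levi_civita_eq_projected_derivative[OF lc P U rgrad_poly_field W]
      unfolding ext[OF \<xi>] e w'(2) .
    also have "\<dots> = inner (dgrad ?p ?u) (tproj ?p w)" using tproj_id[OF p(2) tspace_D(2)[OF w]] by simp
    finally show ?thesis by (simp add: hess_def inner_tproj[OF p(3)])
  qed
  have hsT: "hess ?p ?u \<in> tspace ns ?p" using hess_tspace p tspace_D(1)[OF uT] ns by simp
  have "emb ?h - hess ?p ?u \<in> tspace ns ?p"
    using tangent_subset(2)[OF hT] hsT subspace_diff[OF tspace_subspace] ns by blast
  from val[OF this] have "inner (emb ?h - hess ?p ?u) (emb ?h - hess ?p ?u) = 0"
    by (simp add: inner_diff_left)
  then have eq: "emb ?h = hess ?p ?u" by simp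
  show ?thesis
    unfolding rhess_def eq[symmetric]
    using unemb_emb[of ?h ns] tangent_subset(1)[OF hT] ns by (simp add: her_cprod ambient_iff)
qed

lemma newton_solution_iff:
  assumes lc: "levi_civita (ambient mns) (Gr_prod mns) nab" and P: "P \<in> Gr_prod mns"
  shows "newton_solution nab mns A P \<xi> \<longleftrightarrow>
    \<xi> \<in> tangent (ambient mns) (Gr_prod mns) P \<and> hess (emb P) (emb \<xi>) = - g (emb P)"
proof (cases "\<xi> \<in> tangent (ambient mns) (Gr_prod mns) P")
  case True
  note p = projs_D[OF Gr_projs[OF P], folded ns]
  have h: "hess (emb P) (emb \<xi>) \<in> herms ns" "g (emb P) \<in> herms ns"
    using hess_tspace[OF p(2,1)] g_tspace[OF p(2,1)] tangent_subset(2)[OF True] tspace_D(1) ns by blast+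
  note hh = unemb_her[OF h(1)] and gg = unemb_her[OF h(2)]
  have "unemb ns (hess (emb P) (emb \<xi>)) = tscale (- 1) (unemb ns (g (emb P)))
      \<longleftrightarrow> hess (emb P) (emb \<xi>) = - g (emb P)"
    using her_emb_inj[OF hh(1) her_tops(3)[OF gg(1) gg(1), of "- 1"]] hh(2) gg(2)
      her_emb_tops(3)[OF gg(1) gg(1), of "- 1"] by auto
  then show ?thesis
    using True by (simp add: newton_solution_def rhess_rayleigh[OF lc P True] rgrad_rayleigh[OF P])
qed (simp add: newton_solution_def)

lemma nondegenerate_imp_hess_injective:
  assumes lc: "levi_civita (ambient mns) (Gr_prod mns) nab"
    and nd: "nondegenerate_critical_point (ambient mns) (Gr_prod mns) nab (rayleigh A) P"
    and u: "u \<in> tspace ns (emb P)" "hess (emb P) u = 0"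
  shows "u = 0"
proof -
  let ?E = "ambient mns" and ?M = "Gr_prod mns"
  have P: "P \<in> ?M" using nd by (simp add: nondegenerate_critical_point_def critical_point_def)
  have inj: "inj_on (rhess ?E ?M nab (rayleigh A) P) (tangent ?E ?M P)"
    using nd by (simp add: nondegenerate_critical_point_def bij_betw_def)
  have z: "0 \<in> tspace ns (emb P)" using tspace_subspace by (rule subspace_0)
  note ut = unemb_tangent[OF P, of u, folded ns, OF u(1)] and zt = unemb_tangent[OF P, of 0, folded ns, OF z]
  have "rhess ?E ?M nab (rayleigh A) P (unemb ns u) = rhess ?E ?M nab (rayleigh A) P (unemb ns 0)"
    unfolding rhess_rayleigh[OF lc P ut(1)] rhess_rayleigh[OF lc P zt(1)] ut(2) zt(2)
    using u(2) linear_0[OF linear_hess] by simp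
  from inj_onD[OF inj this ut(1) zt(1)] have "unemb ns u = unemb ns 0" .
  then show ?thesis using ut(2) zt(2) by metis
qed

end

section \<open>QR decomposition of the update block\<close>

lemma mat_adjoint_mult:
  fixes A B :: "complex mat"
  assumes A: "A \<in> carrier_mat n k" and B: "B \<in> carrier_mat k m"
  shows "mat_adjoint (A * B) = mat_adjoint B * mat_adjoint A"
proof (rule eq_matI)
  fix i j assume "i < dim_row (mat_adjoint B * mat_adjoint A)" "j < dim_col (mat_adjoint B * mat_adjoint A)"
  then have ij: "i < m" "j < n" using A B by auto
  have "mat_adjoint (A * B) $$ (i, j) = cnj ((A * B) $$ (j, i))"
    using A B ij by (intro mat_adjoint_index) auto
  also have "\<dots> = (\<Sum>c<k. cnj (A $$ (j, c)) * cnj (B $$ (c, i)))"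
    by (simp add: mult_mat_index[OF A B ij(2,1)])
  also have "\<dots> = (\<Sum>c<k. mat_adjoint B $$ (i, c) * mat_adjoint A $$ (c, j))"
    using A B ij by (intro sum.cong refl) (simp add: mat_adjoint_index mult.commute)
  also have "\<dots> = (mat_adjoint B * mat_adjoint A) $$ (i, j)"
    by (rule mult_mat_index[OF mat_adjoint_carrier[OF B] mat_adjoint_carrier[OF A] ij, symmetric])
  finally show "mat_adjoint (A * B) $$ (i, j) = (mat_adjoint B * mat_adjoint A) $$ (i, j)" .
qed (use A B in auto)

lemma mat_adjoint_adjoint [simp]: "mat_adjoint (mat_adjoint A) = (A :: complex mat)"
  by (rule eq_matI) (simp_all add: mat_adjoint_index)

lemma det_mat_adjoint:
  fixes A :: "complex mat"
  assumes A: "A \<in> carrier_mat n n"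
  shows "det (mat_adjoint A) = cnj (det A)"
proof -
  interpret cnj: comm_ring_hom cnj by unfold_locales auto
  have "mat_adjoint A = transpose_mat (map_mat cnj A)"
    using A by (intro eq_matI) (auto simp: mat_adjoint_index)
  then show ?thesis using A det_transpose[of "map_mat cnj A" n] by simp
qed

text \<open>Matrices are index functions so that a column can be appended without changing
  dimensions. The extra factor \<open>s\<close> expresses the columns of \<open>q\<close> by those
  of \<open>y\<close>; it traces a vanishing residual back to a linear relation between columns of
  \<open>y\<close>.\<close>

definition gs_factors :: "nat \<Rightarrow> nat \<Rightarrow> (nat \<Rightarrow> nat \<Rightarrow> complex) \<Rightarrow> (nat \<Rightarrow> nat \<Rightarrow> complex)
    \<Rightarrow> (nat \<Rightarrow> nat \<Rightarrow> complex) \<Rightarrow> (nat \<Rightarrow> nat \<Rightarrow> complex) \<Rightarrow> bool" where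
  "gs_factors k n y q r s \<longleftrightarrow>
    (\<forall>a<n. \<forall>b<n. (\<Sum>i<k. cnj (q i a) * q i b) = (if a = b then 1 else 0)) \<and>
    (\<forall>i<k. \<forall>b<n. y i b = (\<Sum>a<n. q i a * r a b)) \<and>
    (\<forall>a b. b < a \<longrightarrow> r a b = 0) \<and>
    (\<forall>a<n. \<exists>t>0. r a a = complex_of_real t) \<and>
    (\<forall>i<k. \<forall>a<n. q i a = (\<Sum>b<n. y i b * s b a))"

lemma gs_factorsD:
  assumes "gs_factors k n y q r s"
  shows "a < n \<Longrightarrow> b < n \<Longrightarrow> (\<Sum>i<k. cnj (q i a) * q i b) = (if a = b then 1 else 0)"
    "i < k \<Longrightarrow> b < n \<Longrightarrow> y i b = (\<Sum>a<n. q i a * r a b)"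
    "b < a \<Longrightarrow> r a b = 0"
    "a < n \<Longrightarrow> \<exists>t>0. r a a = complex_of_real t"
    "i < k \<Longrightarrow> a < n \<Longrightarrow> q i a = (\<Sum>b<n. y i b * s b a)"
  using assms unfolding gs_factors_def by blast+

text \<open>Gram-Schmidt, one column at a time: the residual \<open>z\<close> of the new column is
  orthogonal to the earlier ones and is nonzero by independence, so its length is a positive
  diagonal entry.\<close>

lemma gram_schmidt_columns:
  fixes y :: "nat \<Rightarrow> nat \<Rightarrow> complex"
  assumes "\<forall>c. (\<forall>i<k. (\<Sum>b<n. y i b * c b) = 0) \<longrightarrow> (\<forall>b<n. c b = 0)"
  shows "\<exists>q r s. gs_factors k n y q r s"
  using assms
proof (induction n)
  case 0
  show ?case unfolding gs_factors_def by (intro exI[of _ "\<lambda>_ _. 0"]) simp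
next
  case (Suc n)
  have "\<forall>c. (\<forall>i<k. (\<Sum>b<n. y i b * c b) = 0) \<longrightarrow> (\<forall>b<n. c b = 0)"
  proof (intro allI impI)
    fix c b assume c: "\<forall>i<k. (\<Sum>b<n. y i b * c b) = 0" and b: "b < n"
    have "\<forall>i<k. (\<Sum>b<Suc n. y i b * (c(n := 0)) b) = 0" using c by auto
    with Suc.prems[rule_format, of "c(n := 0)" b] b show "c b = 0" by simp
  qed
  from Suc.IH[OF this] obtain q r s where "gs_factors k n y q r s" by blast
  note orth = gs_factorsD(1)[OF this] and fac = gs_factorsD(2)[OF this]
    and tri = gs_factorsD(3)[OF this] and pos = gs_factorsD(4)[OF this]
    and span = gs_factorsD(5)[OF this]
  define w where "w a = (\<Sum>i<k. cnj (q i a) * y i n)" for a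
  define z where "z i = y i n - (\<Sum>a<n. q i a * w a)" for i
  define u where "u b = (\<Sum>a<n. s b a * w a)" for b
  have zy: "z i = y i n - (\<Sum>b<n. y i b * u b)" if i: "i < k" for i
  proof -
    have "(\<Sum>a<n. q i a * w a) = (\<Sum>a<n. \<Sum>b<n. y i b * s b a * w a)"
      using span[OF i] by (simp add: sum_distrib_right)
    also have "\<dots> = (\<Sum>b<n. \<Sum>a<n. y i b * s b a * w a)" by (rule sum.swap)
    also have "\<dots> = (\<Sum>b<n. y i b * u b)" by (simp add: u_def sum_distrib_left mult.assoc)
    finally show ?thesis by (simp add: z_def)
  qed
  define N where "N = (\<Sum>i<k. (cmod (z i))\<^sup>2)"
  \<comment> \<open>A zero residual would be a relation between the columns of \<open>y\<close> with
    coefficient 1 at column n.\<close>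
  have "N \<noteq> 0"
  proof
    assume "N = 0"
    then have z0: "z i = 0" if "i < k" for i
      using that by (simp add: N_def sum_nonneg_eq_0_iff)
    define c where "c b = (if b = n then 1 else - u b)" for b
    have "(\<Sum>b<Suc n. y i b * c b) = 0" if i: "i < k" for i
    proof -
      have "(\<Sum>b<Suc n. y i b * c b) = z i"
        by (simp add: c_def zy[OF i] sum_negf)
      then show ?thesis using z0[OF i] by simp
    qed
    then have "c n = 0" using Suc.prems by blast
    then show False by (simp add: c_def)
  qed
  moreover have "0 \<le> N" unfolding N_def by (intro sum_nonneg) simp
  ultimately have N: "0 < N" by simp
  define t where "t = sqrt N"
  have t: "0 < t" "t * t = N" using N by (auto simp: t_def)
  have ow: "(\<Sum>i<k. cnj (q i a) * z i) = 0" if a: "a < n" for a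
  proof -
    have "(\<Sum>i<k. cnj (q i a) * z i) = w a - (\<Sum>i<k. \<Sum>a'<n. cnj (q i a) * q i a' * w a')"
      by (simp add: z_def w_def right_diff_distrib sum_subtractf sum_distrib_left mult.assoc)
    also have "(\<Sum>i<k. \<Sum>a'<n. cnj (q i a) * q i a' * w a')
        = (\<Sum>a'<n. (\<Sum>i<k. cnj (q i a) * q i a') * w a')"
      by (subst sum.swap) (simp add: sum_distrib_right)
    also have "\<dots> = (\<Sum>a'<n. if a' = a then w a' else 0)"
      using orth[OF a] by (intro sum.cong) auto
    also have "\<dots> = w a" using a by simp
    finally show ?thesis by simp
  qed
  have wo: "(\<Sum>i<k. cnj (z i) * q i a) = 0" if a: "a < n" for a
    using arg_cong[OF ow[OF a], of cnj] by (simp add: mult.commute)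
  have zz: "(\<Sum>i<k. cnj (z i) * z i) = complex_of_real N"
    by (simp add: N_def complex_norm_square mult.commute del: of_real_power)
  define q' where "q' i a = (if a = n then z i / of_real t else q i a)" for i a
  define r' where "r' a b = (if b = n then if a = n then of_real t else if a < n then w a else 0
      else if a = n then 0 else r a b)" for a b
  define s' where "s' b a = (if a = n then (if b = n then 1 else - u b) / of_real t
      else if b = n then 0 else s b a)" for b a
  show ?case unfolding gs_factors_def
  proof (rule exI[of _ q'], rule exI[of _ r'], rule exI[of _ s'], intro conjI allI impI)
    fix a b assume ab: "a < Suc n" "b < Suc n"
    have "(\<Sum>i<k. cnj (z i / of_real t) * (z i / of_real t)) = (\<Sum>i<k. cnj (z i) * z i) / (of_real t * of_real t)"
      by (simp add: sum_divide_distrib)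
    also have "\<dots> = 1" using N t by (simp add: zz flip: of_real_mult)
    finally have 1: "(\<Sum>i<k. cnj (z i / of_real t) * (z i / of_real t)) = 1" .
    have 2: "(\<Sum>i<k. cnj (q i a) * (z i / of_real t)) = 0" if "a < n" for a
      using ow[OF that] by (simp flip: sum_divide_distrib)
    have 3: "(\<Sum>i<k. cnj (z i / of_real t) * q i a) = 0" if "a < n" for a
      using wo[OF that] by (simp flip: sum_divide_distrib)
    show "(\<Sum>i<k. cnj (q' i a) * q' i b) = (if a = b then 1 else 0)"
      using ab 1 2 3 orth by (auto simp: q'_def less_Suc_eq)
  next
    fix i b assume i: "i < k" and b: "b < Suc n"
    have sq: "(\<Sum>a<Suc n. q' i a * r' a b) = (\<Sum>a<n. q i a * r' a b) + z i / of_real t * r' n b"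
      by (simp add: q'_def)
    show "y i b = (\<Sum>a<Suc n. q' i a * r' a b)"
    proof (cases "b = n")
      case True
      then show ?thesis unfolding sq using t by (simp add: r'_def z_def)
    next
      case False
      then show ?thesis unfolding sq using b fac[OF i, of b] by (simp add: r'_def)
    qed
  next
    fix a b :: nat assume "b < a"
    then show "r' a b = 0" using tri by (auto simp: r'_def)
  next
    fix a assume "a < Suc n"
    then show "\<exists>t>0. r' a a = complex_of_real t"
      using pos[of a] t(1) by (cases "a = n") (auto simp: r'_def)
  next
    fix i a assume i: "i < k" and a: "a < Suc n"
    show "q' i a = (\<Sum>b<Suc n. y i b * s' b a)"
    proof (cases "a = n")
      case True
      have "(\<Sum>b<Suc n. y i b * s' b a) = z i / of_real t"
        by (simp add: True s'_def zy[OF i] sum_negf diff_divide_distrib flip: sum_divide_distrib)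
      then show ?thesis by (simp add: q'_def True)
    next
      case False
      then show ?thesis using span[OF i, of a] a by (simp add: q'_def s'_def)
    qed
  qed
qed

lemma qr_exists_tall:
  assumes Y: "Y \<in> carrier_mat k n"
    and inj: "\<forall>c. (\<forall>i<k. (\<Sum>b<n. Y $$ (i, b) * c b) = 0) \<longrightarrow> (\<forall>b<n. c b = 0)"
  shows "\<exists>Q R. Q \<in> carrier_mat k n \<and> mat_adjoint Q * Q = 1\<^sub>m n \<and> R \<in> carrier_mat n n
    \<and> upper_triangular R \<and> (\<forall>i<n. \<exists>t>0. R $$ (i, i) = complex_of_real t) \<and> Y = Q * R"
proof -
  obtain q r s where "gs_factors k n (\<lambda>i b. Y $$ (i, b)) q r s"
    using gram_schmidt_columns[OF inj] by blast
  note orth = gs_factorsD(1)[OF this] and fac = gs_factorsD(2)[OF this]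
    and tri = gs_factorsD(3)[OF this] and pos = gs_factorsD(4)[OF this]
  define Q where "Q = mat k n (\<lambda>(i, a). q i a)"
  define R where "R = mat n n (\<lambda>(a, b). r a b)"
  have Q: "Q \<in> carrier_mat k n" and R: "R \<in> carrier_mat n n" by (auto simp: Q_def R_def)
  have "mat_adjoint Q * Q = 1\<^sub>m n"
  proof (rule eq_matI)
    fix a b assume "a < dim_row (1\<^sub>m n :: complex mat)" "b < dim_col (1\<^sub>m n :: complex mat)"
    then have ab: "a < n" "b < n" by auto
    have "(mat_adjoint Q * Q) $$ (a, b) = (\<Sum>i<k. mat_adjoint Q $$ (a, i) * Q $$ (i, b))"
      by (rule mult_mat_index[OF mat_adjoint_carrier[OF Q] Q ab])
    also have "\<dots> = (\<Sum>i<k. cnj (q i a) * q i b)"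
      using ab Q by (intro sum.cong refl) (simp add: mat_adjoint_index Q_def)
    finally show "(mat_adjoint Q * Q) $$ (a, b) = (1\<^sub>m n :: complex mat) $$ (a, b)"
      using orth ab by simp
  qed (use Q in auto)
  moreover have "Y = Q * R"
  proof (rule eq_matI)
    fix i b assume "i < dim_row (Q * R)" "b < dim_col (Q * R)"
    then have ib: "i < k" "b < n" using Q R by auto
    have "(Q * R) $$ (i, b) = (\<Sum>a<n. Q $$ (i, a) * R $$ (a, b))"
      by (rule mult_mat_index[OF Q R ib])
    also have "\<dots> = Y $$ (i, b)" using ib fac by (simp add: Q_def R_def)
    finally show "Y $$ (i, b) = (Q * R) $$ (i, b)" by simp
  qed (use Q R Y in auto)
  moreover have "upper_triangular R" using tri by (auto simp: R_def)
  moreover have "\<forall>i<n. \<exists>t>0. R $$ (i, i) = complex_of_real t" using pos by (simp add: R_def)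
  ultimately show ?thesis using Q R by blast
qed

lemma det_upper_triangular_pos:
  assumes R: "R \<in> carrier_mat n n" "upper_triangular R"
    and pos: "\<forall>i<n. \<exists>t>0. R $$ (i, i) = complex_of_real t"
  shows "\<exists>t>0. det R = complex_of_real t"
proof -
  obtain f where f: "\<And>i. i < n \<Longrightarrow> 0 < f i \<and> R $$ (i, i) = complex_of_real (f i)"
    using pos by metis
  have "det R = (\<Prod>i = 0..<n. R $$ (i, i))"
    using det_upper_triangular[OF R(2,1)] R(1) by (simp add: prod_list_diag_prod)
  also have "\<dots> = complex_of_real (\<Prod>i = 0..<n. f i)" using f by simp
  finally show ?thesis using f by (intro exI[of _ "\<Prod>i = 0..<n. f i"] conjI prod_pos) auto
qed

text \<open>As a quotient of positive determinants, det Q is a positive real; as the determinant of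
  a unitary matrix, it has modulus 1.\<close>

lemma det_unitary_pos:
  assumes Q: "unitary n Q" and R: "R \<in> carrier_mat n n"
    and d: "det (Q * R) = complex_of_real s" "0 < s" "det R = complex_of_real t" "0 < t"
  shows "det Q = 1"
proof -
  have Qc: "Q \<in> carrier_mat n n" using Q by (simp add: unitary_def)
  have "det Q * complex_of_real t = complex_of_real s" using det_mult[OF Qc R] d by simp
  then have dQ: "det Q = complex_of_real (s / t)" using d by (simp add: field_simps)
  have "1 = det (mat_adjoint Q * Q)" using Q by (simp add: unitary_def)
  also have "\<dots> = cnj (det Q) * det Q"
    by (simp add: det_mult[OF mat_adjoint_carrier[OF Qc] Qc] det_mat_adjoint[OF Qc])
  finally have "complex_of_real ((s / t) * (s / t)) = complex_of_real 1" unfolding dQ by simp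
  then have "(s / t) * (s / t) = 1" by (simp only: of_real_eq_iff)
  moreover have "0 < s / t" using d by simp
  ultimately have "s / t = 1" unfolding square_eq_1_iff by linarith
  then show ?thesis using dQ by simp
qed

text \<open>The update block minus the identity, as a function on all indices, so that its
  skew-Hermitian symmetry holds without range conditions.\<close>

definition ublock :: "nat \<Rightarrow> complex mat \<Rightarrow> nat \<Rightarrow> nat \<Rightarrow> complex" where
  "ublock m Z i j = (if i < m then if j < m then 0 else - Z $$ (i, j - m)
     else if j < m then cnj (Z $$ (j, i - m)) else 0)"

lemma block_index:
  assumes m: "m \<le> n" and Z: "Z \<in> carrier_mat m (n - m)" and ij: "i < n" "j < n"
  shows "std_proj m n $$ (i, j) = (if i = j \<and> i < m then 1 else 0)"
    "tangent_block m n Z $$ (i, j) = (if i < m then if j < m then 0 else Z $$ (i, j - m)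
       else if j < m then cnj (Z $$ (j, i - m)) else 0)"
    "update_block m n Z $$ (i, j) = (if i = j then 1 else 0) + ublock m Z i j"
  using assms
  by (auto simp: std_proj_def tangent_block_def update_block_def ublock_def mat_adjoint_index)

lemma block_carrier:
  assumes "m \<le> n"
  shows "std_proj m n \<in> carrier_mat n n"
    "Z \<in> carrier_mat m (n - m) \<Longrightarrow> tangent_block m n Z \<in> carrier_mat n n"
    "Z \<in> carrier_mat m (n - m) \<Longrightarrow> update_block m n Z \<in> carrier_mat n n"
  using assms by (auto simp: std_proj_def tangent_block_def update_block_def intro!: carrier_matI)

text \<open>The update block is \<open>1 + S\<close> with \<open>S\<close> skew-Hermitian, so \<open>Re \<langle>c, (1 + S) c\<rangle> = \<parallel>c\<parallel>\<^sup>2\<close>.\<close>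

lemma update_block_injective:
  assumes m: "m \<le> n" and Z: "Z \<in> carrier_mat m (n - m)"
  shows "\<forall>c. (\<forall>i<n. (\<Sum>b<n. update_block m n Z $$ (i, b) * c b) = 0)
      \<longrightarrow> (\<forall>b<n. c b = 0)"
proof (intro allI impI)
  fix c b
  assume c: "\<forall>i<n. (\<Sum>b<n. update_block m n Z $$ (i, b) * c b) = 0" and b: "b < n"
  let ?S = "ublock m Z"
  have skew: "cnj (?S i j) = - ?S j i" for i j by (auto simp: ublock_def)
  have "c i + (\<Sum>j<n. ?S i j * c j) = 0" if i: "i < n" for i
  proof -
    have "(\<Sum>j<n. update_block m n Z $$ (i, j) * c j)
        = (\<Sum>j<n. (if j = i then c j else 0) + ?S i j * c j)"
      using block_index(3)[OF m Z i] by (intro sum.cong) (auto simp: distrib_right)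
    also have "\<dots> = c i + (\<Sum>j<n. ?S i j * c j)" using i by (simp add: sum.distrib)
    finally show ?thesis using c i by simp
  qed
  then have "(\<Sum>i<n. cnj (c i) * (c i + (\<Sum>j<n. ?S i j * c j))) = 0" by simp
  moreover define T where "T = (\<Sum>i<n. \<Sum>j<n. cnj (c i) * ?S i j * c j)"
  moreover have "(\<Sum>i<n. cnj (c i) * (c i + (\<Sum>j<n. ?S i j * c j)))
      = (\<Sum>i<n. cnj (c i) * c i) + T"
    by (simp add: T_def distrib_left sum.distrib sum_distrib_left mult.assoc)
  ultimately have eq: "(\<Sum>i<n. cnj (c i) * c i) + T = 0" by simp
  have "cnj T = (\<Sum>i<n. \<Sum>j<n. - (cnj (c j) * ?S j i * c i))"
    by (simp add: T_def skew mult_ac)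
  also have "\<dots> = - T" unfolding T_def by (subst sum.swap) (simp add: sum_negf)
  finally have "Re (cnj T) = Re (- T)" by (rule arg_cong)
  then have "Re T = 0" by simp
  then have "(\<Sum>i<n. Re (cnj (c i) * c i)) = 0" using arg_cong[OF eq, of Re] by simp
  moreover have "Re (cnj (c i) * c i) = (cmod (c i))\<^sup>2" for i
    by (simp only: cmod_power2) (simp add: power2_eq_square)
  ultimately have "(\<Sum>i<n. (cmod (c i))\<^sup>2) = 0" by (simp only:)
  then show "c b = 0" using b by (simp add: sum_nonneg_eq_0_iff)
qed

lemma sum_lessThan_add:
  fixes f :: "nat \<Rightarrow> 'a :: comm_monoid_add"
  shows "(\<Sum>c<m + k. f c) = (\<Sum>c<m. f c) + (\<Sum>c<k. f (m + c))"
  by (induction k) (simp_all add: add.assoc)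

text \<open>
  Multiplying the update block by \<open>[[1, Z], [0, 1]]\<close> on the right gives \<open>[[1, 0], [Z\<^sup>*, Z\<^sup>* Z + 1]]\<close>.
\<close>

lemma det_update_block:
  assumes m: "m \<le> n" and Z: "Z \<in> carrier_mat m (n - m)"
  shows "\<exists>s>0. det (update_block m n Z) = complex_of_real s"
proof -
  let ?k = "n - m"
  have Za: "mat_adjoint Z \<in> carrier_mat ?k m" by (rule mat_adjoint_carrier[OF Z])
  \<comment> \<open>This is Z stacked on the identity, so Y* Y = Z* Z + 1. A QR factor R of Y turns
    the determinant of this matrix into |det R|^2, which is positive.\<close>
  define Y where "Y = mat n ?k (\<lambda>(i, j). if i < m then Z $$ (i, j) else if i - m = j then 1 else 0)"
  have Y: "Y \<in> carrier_mat n ?k" by (simp add: Y_def)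
  have "\<forall>c. (\<forall>i<n. (\<Sum>b<?k. Y $$ (i, b) * c b) = 0) \<longrightarrow> (\<forall>b<?k. c b = 0)"
  proof (intro allI impI)
    fix c b assume c: "\<forall>i<n. (\<Sum>b<?k. Y $$ (i, b) * c b) = 0" and b: "b < ?k"
    have "(\<Sum>a<?k. Y $$ (m + b, a) * c a) = (\<Sum>a<?k. if a = b then c a else 0)"
      using b by (intro sum.cong) (auto simp: Y_def)
    moreover have "(\<Sum>a<?k. Y $$ (m + b, a) * c a) = 0" using c b m by simp
    ultimately show "c b = 0" using b by simp
  qed
  from qr_exists_tall[OF Y this] obtain Q R where Q: "Q \<in> carrier_mat n ?k" "mat_adjoint Q * Q = 1\<^sub>m ?k"
    and R: "R \<in> carrier_mat ?k ?k" "upper_triangular R"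
      "\<forall>i<?k. \<exists>t>0. R $$ (i, i) = complex_of_real t" and QR: "Y = Q * R" by blast
  obtain t where t: "t > 0" "det R = complex_of_real t" using det_upper_triangular_pos[OF R] by blast
  note Qa = mat_adjoint_carrier[OF Q(1)] and Ra = mat_adjoint_carrier[OF R(1)]
  have "mat_adjoint Y * Y = mat_adjoint R * (mat_adjoint Q * Q) * R"
    unfolding QR mat_adjoint_mult[OF Q(1) R(1)]
    using Q(1) R(1) Qa Ra by (simp add: assoc_mult_mat[of _ ?k ?k _ ?k _ ?k] assoc_mult_mat[of _ ?k ?k _ n _ ?k]
        assoc_mult_mat[of _ ?k n _ ?k _ ?k])
  also have "\<dots> = mat_adjoint R * R" by (simp only: Q(2) right_mult_one_mat[OF Ra])
  finally have YY: "mat_adjoint Y * Y = mat_adjoint R * R" .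
  have "mat_adjoint Z * Z + 1\<^sub>m ?k = mat_adjoint Y * Y"
  proof (rule eq_matI)
    fix i j assume "i < dim_row (mat_adjoint Y * Y)" "j < dim_col (mat_adjoint Y * Y)"
    then have ij: "i < ?k" "j < ?k" using Y by auto
    have "(mat_adjoint Y * Y) $$ (i, j) = (\<Sum>c<n. cnj (Y $$ (c, i)) * Y $$ (c, j))"
      unfolding mult_mat_index[OF mat_adjoint_carrier[OF Y] Y ij]
      using Y ij by (intro sum.cong refl) (simp add: mat_adjoint_index)
    also have "\<dots> = (\<Sum>c<m + ?k. cnj (Y $$ (c, i)) * Y $$ (c, j))" using m by simp
    also have "\<dots> = (\<Sum>c<m. cnj (Y $$ (c, i)) * Y $$ (c, j))
        + (\<Sum>c<?k. cnj (Y $$ (m + c, i)) * Y $$ (m + c, j))"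
      by (rule sum_lessThan_add)
    also have "(\<Sum>c<m. cnj (Y $$ (c, i)) * Y $$ (c, j)) = (mat_adjoint Z * Z) $$ (i, j)"
      unfolding mult_mat_index[OF Za Z ij] using ij m Z
      by (intro sum.cong refl) (simp add: Y_def mat_adjoint_index)
    also have "(\<Sum>c<?k. cnj (Y $$ (m + c, i)) * Y $$ (m + c, j))
        = (\<Sum>c<?k. if c = i then if i = j then 1 else 0 else 0)"
      using ij by (intro sum.cong refl) (auto simp: Y_def)
    also have "\<dots> = 1\<^sub>m ?k $$ (i, j)" using ij by simp
    finally show "(mat_adjoint Z * Z + 1\<^sub>m ?k) $$ (i, j) = (mat_adjoint Y * Y) $$ (i, j)"
      using ij Z by simp
  qed (use Y Z in auto)
  then have dZ: "det (mat_adjoint Z * Z + 1\<^sub>m ?k) = complex_of_real (t * t)"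
    using YY det_mult[OF Ra R(1)] det_mat_adjoint[OF R(1)] t by simp
  let ?L = "four_block_mat (1\<^sub>m m) Z (0\<^sub>m ?k m) (1\<^sub>m ?k)"
  have L: "?L \<in> carrier_mat n n"
    using four_block_carrier_mat[OF one_carrier_mat[of m] one_carrier_mat[of ?k]] m by simp
  have "update_block m n Z * ?L = four_block_mat (1\<^sub>m m) (0\<^sub>m m ?k) (mat_adjoint Z) (mat_adjoint Z * Z + 1\<^sub>m ?k)"
  proof -
    have uZ: "- Z \<in> carrier_mat m ?k" using Z by simp
    have "update_block m n Z * ?L = four_block_mat (1\<^sub>m m * 1\<^sub>m m + - Z * 0\<^sub>m ?k m)
        (1\<^sub>m m * Z + - Z * 1\<^sub>m ?k) (mat_adjoint Z * 1\<^sub>m m + 1\<^sub>m ?k * 0\<^sub>m ?k m)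
        (mat_adjoint Z * Z + 1\<^sub>m ?k * 1\<^sub>m ?k)"
      unfolding update_block_def
      by (rule mult_four_block_mat[OF one_carrier_mat uZ Za one_carrier_mat
            one_carrier_mat Z zero_carrier_mat one_carrier_mat])
    moreover have "1\<^sub>m m * 1\<^sub>m m + - Z * 0\<^sub>m ?k m = 1\<^sub>m m" using uZ by simp
    moreover have "1\<^sub>m m * Z + - Z * 1\<^sub>m ?k = 0\<^sub>m m ?k"
      using left_mult_one_mat[OF Z] right_mult_one_mat[OF uZ] Z uZ
      by (intro eq_matI) auto
    moreover have "mat_adjoint Z * 1\<^sub>m m + 1\<^sub>m ?k * 0\<^sub>m ?k m = mat_adjoint Z"
      using right_mult_one_mat[OF Za] Za by simp
    moreover have "1\<^sub>m ?k * 1\<^sub>m ?k = (1\<^sub>m ?k :: complex mat)" by simp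
    ultimately show ?thesis by (simp only:)
  qed
  moreover have "det ?L = 1"
    using det_four_block_mat_lower_left_zero[OF one_carrier_mat Z refl one_carrier_mat] by simp
  moreover have "det (four_block_mat (1\<^sub>m m) (0\<^sub>m m ?k) (mat_adjoint Z) (mat_adjoint Z * Z + 1\<^sub>m ?k))
      = complex_of_real (t * t)"
    using det_four_block_mat_upper_right_zero[OF one_carrier_mat refl Za, of "mat_adjoint Z * Z + 1\<^sub>m ?k"]
      mult_carrier_mat[OF Za Z] dZ by simp
  ultimately have "det (update_block m n Z) = complex_of_real (t * t)"
    using det_mult[OF block_carrier(3)[OF m Z] L] by simp
  then show ?thesis using t(1) by (intro exI[of _ "t * t"]) simp
qed

text \<open>A QR factor is a priori only unitary; determinant 1 keeps the new frame in the special
  unitary group, so that the next step can be made.\<close>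

lemma is_qr_det:
  assumes m: "m \<le> n" and Z: "Z \<in> carrier_mat m (n - m)" and qr: "is_qr n (update_block m n Z) Q R"
  shows "det Q = 1"
proof -
  have R: "R \<in> carrier_mat n n" "upper_triangular R" and Q: "unitary n Q"
    and QR: "update_block m n Z = Q * R" using qr by (auto simp: is_qr_def)
  have "\<forall>i<n. \<exists>t>0. R $$ (i, i) = complex_of_real t"
    using qr by (metis is_qr_def of_real_Re)
  from det_upper_triangular_pos[OF R this] obtain t where "t > 0" "det R = complex_of_real t" by blast
  moreover obtain s where "s > 0" "det (update_block m n Z) = complex_of_real s"
    using det_update_block[OF m Z] by blast
  ultimately show ?thesis using det_unitary_pos[OF Q R(1)] QR by metis
qed

lemma is_qr_exists:
  assumes m: "m \<le> n" and Z: "Z \<in> carrier_mat m (n - m)"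
  shows "\<exists>Q R. is_qr n (update_block m n Z) Q R"
proof -
  from qr_exists_tall[OF block_carrier(3)[OF m Z] update_block_injective[OF m Z]]
  obtain Q R where QR: "Q \<in> carrier_mat n n" "mat_adjoint Q * Q = 1\<^sub>m n" "R \<in> carrier_mat n n"
    "upper_triangular R" "\<forall>i<n. \<exists>t>0. R $$ (i, i) = complex_of_real t" "update_block m n Z = Q * R"
    by blast
  have "Q * mat_adjoint Q = 1\<^sub>m n"
    by (rule mat_mult_left_right_inverse[OF mat_adjoint_carrier[OF QR(1)] QR(1,2)])
  then have "is_qr n (update_block m n Z) Q R"
    using QR by (auto simp: is_qr_def unitary_def)
  then show ?thesis by blast
qed

section \<open>The iteration\<close>

lemma unitaryD:
  assumes "unitary n U"
  shows "U \<in> carrier_mat n n" "mat_adjoint U \<in> carrier_mat n n"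
    "mat_adjoint U * U = 1\<^sub>m n" "U * mat_adjoint U = 1\<^sub>m n"
  using assms by (auto simp: unitary_def mat_adjoint_carrier)

lemma unitary_adjoint: "unitary n U \<Longrightarrow> unitary n (mat_adjoint U)"
  by (auto simp: unitary_def mat_adjoint_carrier)

lemma unitary_cancel:
  assumes "unitary n U" "Y \<in> carrier_mat n n"
  shows "mat_adjoint U * (U * Y) = Y" "U * (mat_adjoint U * Y) = Y"
proof -
  note U = unitaryD[OF assms(1)]
  have "mat_adjoint U * (U * Y) = (mat_adjoint U * U) * Y"
    using U assms(2) by (intro assoc_mult_mat[symmetric]) auto
  then show "mat_adjoint U * (U * Y) = Y" using U left_mult_one_mat[OF assms(2)] by simp
  have "U * (mat_adjoint U * Y) = (U * mat_adjoint U) * Y"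
    using U assms(2) by (intro assoc_mult_mat[symmetric]) auto
  then show "U * (mat_adjoint U * Y) = Y" using U left_mult_one_mat[OF assms(2)] by simp
qed

lemma unitary_mult: assumes "unitary n U" "unitary n Q" shows "unitary n (U * Q)"
proof -
  note U = unitaryD[OF assms(1)] and Q = unitaryD[OF assms(2)]
  have "mat_adjoint (U * Q) * (U * Q) = mat_adjoint Q * (mat_adjoint U * (U * Q))"
    using U Q by (simp add: mat_adjoint_mult[OF U(1) Q(1)] assoc_mult_mat[of _ n n _ n _ n])
  moreover have "U * Q * mat_adjoint (U * Q) = U * (Q * (mat_adjoint Q * mat_adjoint U))"
    using U Q by (simp add: mat_adjoint_mult[OF U(1) Q(1)] assoc_mult_mat[of _ n n _ n _ n])
  ultimately show ?thesis
    using U Q unitary_cancel(1)[OF assms(1) Q(1)] unitary_cancel(2)[OF assms(2) U(2)]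
    by (simp add: unitary_def)
qed

section \<open>Conjugation by unitaries and the standard projector\<close>

definition conj_by :: "complex mat \<Rightarrow> complex mat \<Rightarrow> complex mat" where
  "conj_by U B = U * B * mat_adjoint U"

lemma conj_by:
  assumes U: "unitary n U" and B: "B \<in> carrier_mat n n" and C: "C \<in> carrier_mat n n"
  shows "conj_by U B \<in> carrier_mat n n" "conj_by U B * conj_by U C = conj_by U (B * C)"
    "conj_by U B + conj_by U C = conj_by U (B + C)"
    "mat_adjoint (conj_by U B) = conj_by U (mat_adjoint B)"
    "conj_by (mat_adjoint U) (conj_by U B) = B" "conj_by U (conj_by (mat_adjoint U) B) = B"
proof -
  note Uc = unitaryD[OF U]
  note car = Uc B C mult_carrier_mat[of _ n n _ n] mat_adjoint_carrier[of _ n n]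
  note assoc = assoc_mult_mat[of _ n n _ n _ n]
  note canc = unitary_cancel[OF U]
  show "conj_by U B \<in> carrier_mat n n" unfolding conj_by_def by (intro car)
  show "conj_by U B * conj_by U C = conj_by U (B * C)"
    unfolding conj_by_def by (simp add: car assoc canc)
  show "conj_by U B + conj_by U C = conj_by U (B + C)"
    unfolding conj_by_def
    by (simp add: car add_mult_distrib_mat[of _ n n _ _ n] mult_add_distrib_mat[of _ n n _ n])
  show "mat_adjoint (conj_by U B) = conj_by U (mat_adjoint B)"
    unfolding conj_by_def
    by (simp add: car assoc mat_adjoint_mult[of _ n n _ n])
  show "conj_by (mat_adjoint U) (conj_by U B) = B" "conj_by U (conj_by (mat_adjoint U) B) = B"
    unfolding conj_by_def by (simp_all add: car assoc canc right_mult_one_mat[of _ n n])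
qed

lemma mtrace_mult_commute:
  assumes "A \<in> carrier_mat n n" "B \<in> carrier_mat n n"
  shows "mtrace (A * B) = mtrace (B * A)"
proof -
  have tr: "mtrace (C * D) = (\<Sum>i<n. \<Sum>c<n. C $$ (i, c) * D $$ (c, i))"
    if "C \<in> carrier_mat n n" "D \<in> carrier_mat n n" for C D
    using that(1) by (simp add: mtrace_def mult_mat_index[OF that] del: index_mult_mat(1))
  show ?thesis
    unfolding tr[OF assms] tr[OF assms(2,1)] by (subst sum.swap) (simp add: mult.commute)
qed

lemma mtrace_conj_by:
  assumes U: "unitary n U" and B: "B \<in> carrier_mat n n"
  shows "mtrace (conj_by U B) = mtrace B"
proof -
  note Uc = unitaryD[OF U]
  have "mtrace (conj_by U B) = mtrace (mat_adjoint U * (U * B))"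
    unfolding conj_by_def using Uc B by (intro mtrace_mult_commute[of _ n]) auto
  then show ?thesis by (simp add: unitary_cancel[OF U B])
qed

lemma std_proj_mult_index:
  assumes m: "m \<le> n" and B: "B \<in> carrier_mat n n" and ij: "i < n" "j < n"
  shows "(std_proj m n * B) $$ (i, j) = (if i < m then B $$ (i, j) else 0)"
    "(B * std_proj m n) $$ (i, j) = (if j < m then B $$ (i, j) else 0)"
proof -
  note S = block_carrier(1)[OF m]
  have e: "std_proj m n $$ (i, j) = (if i = j \<and> i < m then 1 else 0)" if "i < n" "j < n" for i j
    by (rule block_index(1)[OF m zero_carrier_mat that])
  have "(std_proj m n * B) $$ (i, j) = (\<Sum>c<n. if c = i then if i < m then B $$ (i, j) else 0 else 0)"
    unfolding mult_mat_index[OF S B ij] using ij by (intro sum.cong) (auto simp: e)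
  then show "(std_proj m n * B) $$ (i, j) = (if i < m then B $$ (i, j) else 0)" using ij by simp
  have "(B * std_proj m n) $$ (i, j) = (\<Sum>c<n. if c = j then if j < m then B $$ (i, j) else 0 else 0)"
    unfolding mult_mat_index[OF B S ij] using ij by (intro sum.cong) (auto simp: e)
  then show "(B * std_proj m n) $$ (i, j) = (if j < m then B $$ (i, j) else 0)" using ij by simp
qed

lemma std_proj:
  assumes m: "m \<le> n"
  shows "mat_adjoint (std_proj m n) = std_proj m n" "std_proj m n * std_proj m n = std_proj m n"
    "mtrace (std_proj m n) = of_nat m"
proof -
  note S = block_carrier(1)[OF m]
  have e: "std_proj m n $$ (i, j) = (if i = j \<and> i < m then 1 else 0)" if "i < n" "j < n" for i j
    by (rule block_index(1)[OF m zero_carrier_mat that])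
  show "mat_adjoint (std_proj m n) = std_proj m n"
    using S by (intro eq_matI) (auto simp: mat_adjoint_index e)
  show "std_proj m n * std_proj m n = std_proj m n"
    using S by (intro eq_matI) (auto simp: std_proj_mult_index[OF m S] e simp del: index_mult_mat(1))
  have "mtrace (std_proj m n) = (\<Sum>i<n. if i < m then 1 else 0)"
    using S by (simp add: mtrace_def e)
  also have "\<dots> = (\<Sum>i<m. 1)" using m by (intro sum.mono_neutral_cong_right) auto
  finally show "mtrace (std_proj m n) = of_nat m" by simp
qed

section \<open>Frames and single steps of the algorithm\<close>

lemma frame_Gr:
  assumes f: "frame mns \<Theta> P" and mn: "\<forall>(m, n)\<in>set mns. m \<le> n"
  shows "P \<in> Gr_prod mns"
proof -
  have "P ! j \<in> Gr (fst (mns ! j)) (snd (mns ! j))" if j: "j < length mns" for j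
  proof -
    obtain m n where e: "mns ! j = (m, n)" by (cases "mns ! j")
    have m: "m \<le> n" using mn nth_mem[OF j] unfolding e by auto
    have U: "unitary n (\<Theta> ! j)" and P: "P ! j = conj_by (\<Theta> ! j) (std_proj m n)"
      using f j e by (auto simp: frame_def SU_def conj_by_def)
    note S = block_carrier(1)[OF m] and c = conj_by[OF U block_carrier(1)[OF m] block_carrier(1)[OF m]]
    show ?thesis
      unfolding e P Gr_def using c mtrace_conj_by[OF U S] std_proj[OF m] by simp
  qed
  then show ?thesis
    using f by (auto simp: Gr_prod_def list_all2_conv_all_nth frame_def split_def)
qed

text \<open>Entrywise the tangency equation multiplies B_ij by the number of indices among i, j that
  are below m. This number is 0 or 2 on the diagonal blocks, which therefore vanish; Z is the upper
  right block.\<close>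

lemma tangent_block_exists:
  assumes m: "m \<le> n" and B: "B \<in> carrier_mat n n" "mat_adjoint B = B"
    and t: "std_proj m n * B + B * std_proj m n = B"
  shows "\<exists>Z\<in>carrier_mat m (n - m). B = tangent_block m n Z"
proof
  define Z where "Z = mat m (n - m) (\<lambda>(i, j). B $$ (i, m + j))"
  show Z: "Z \<in> carrier_mat m (n - m)" by (simp add: Z_def)
  have S: "std_proj m n * B \<in> carrier_mat n n" "B * std_proj m n \<in> carrier_mat n n"
    using block_carrier(1)[OF m] B(1) by auto
  show "B = tangent_block m n Z"
  proof (rule eq_matI)
    fix i j assume "i < dim_row (tangent_block m n Z)" "j < dim_col (tangent_block m n Z)"
    then have ij: "i < n" "j < n" using block_carrier(2)[OF m Z] by auto
    have h: "B $$ (i, j) = cnj (B $$ (j, i))"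
      using mat_adjoint_index[of i B j] B ij by auto
    have "(std_proj m n * B + B * std_proj m n) $$ (i, j)
        = (if i < m then B $$ (i, j) else 0) + (if j < m then B $$ (i, j) else 0)"
      using B(1)[THEN carrier_matD(1)] block_carrier(1)[OF m, THEN carrier_matD(2)] ij
      by (simp add: std_proj_mult_index[OF m B(1)] del: index_mult_mat(1))
    then have "B $$ (i, j) = (if i < m then B $$ (i, j) else 0) + (if j < m then B $$ (i, j) else 0)"
      unfolding t .
    then show "B $$ (i, j) = tangent_block m n Z $$ (i, j)"
      using ij h unfolding block_index(2)[OF m Z ij] by (auto simp: Z_def)
  qed (use B block_carrier(2)[OF m Z] in auto)
qed

text \<open>
  The first \<open>m\<close> columns of the update block span the range of \<open>(1 + \<xi>) P\<close>, and \<open>R\<close>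
  preserves the span of the first \<open>m\<close> coordinate vectors; so the new projector fixes
  \<open>(1 + \<xi>) P\<close>.
\<close>

lemma qr_step_fixes:
  assumes m: "m \<le> n" and Z: "Z \<in> carrier_mat m (n - m)" and U: "unitary n U"
    and qr: "is_qr n (update_block m n Z) Q R"
    and P: "P = conj_by U (std_proj m n)" and \<xi>: "\<xi> = conj_by U (tangent_block m n Z)"
    and P': "P' = conj_by (U * Q) (std_proj m n)"
  shows "P' * (P + \<xi> * P) = P + \<xi> * P"
proof -
  let ?S = "std_proj m n" and ?T = "tangent_block m n Z" and ?X = "update_block m n Z"
  have Q: "unitary n Q" and R: "R \<in> carrier_mat n n" "upper_triangular R" and X: "?X = Q * R"
    using qr by (auto simp: is_qr_def)
  note S = block_carrier(1)[OF m] and T = block_carrier(2)[OF m Z] and Xc = block_carrier(3)[OF m Z]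
  note Qc = unitaryD[OF Q] and Uc = unitaryD[OF U]
  have cS: "C * ?S \<in> carrier_mat n n" if "C \<in> carrier_mat n n" for C
    using that S by auto
  have XS: "?S + ?T * ?S = ?X * ?S"
  proof (rule eq_matI)
    fix i j assume "i < dim_row (?X * ?S)" "j < dim_col (?X * ?S)"
    then have ij: "i < n" "j < n" using S Xc by auto
    show "(?S + ?T * ?S) $$ (i, j) = (?X * ?S) $$ (i, j)"
      using ij T[THEN carrier_matD(1)] S[THEN carrier_matD(2)]
      by (simp add: std_proj_mult_index[OF m T] std_proj_mult_index[OF m Xc] block_index[OF m Z]
          ublock_def del: index_mult_mat(1))
  qed (use S T Xc in auto)
  have RS: "?S * (R * ?S) = R * ?S"
  proof (rule eq_matI)
    fix i j assume "i < dim_row (R * ?S)" "j < dim_col (R * ?S)"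
    then have ij: "i < n" "j < n" using S R by auto
    show "(?S * (R * ?S)) $$ (i, j) = (R * ?S) $$ (i, j)"
      using ij R by (auto simp: std_proj_mult_index[OF m cS[OF R(1)]] std_proj_mult_index[OF m R(1)]
          upper_triangular_def simp del: index_mult_mat(1))
  qed (use S R in auto)
  have e: "P + \<xi> * P = conj_by U (?X * ?S)"
    unfolding P \<xi> using conj_by(2)[OF U T S] conj_by(3)[OF U S cS[OF T]] XS by simp
  have "P' = conj_by U (conj_by Q ?S)"
    unfolding P' conj_by_def using Qc Uc S
    by (simp add: mat_adjoint_mult[OF Uc(1) Qc(1)] assoc_mult_mat[of _ n n _ n _ n])
  then have "P' * (P + \<xi> * P) = conj_by U (conj_by Q ?S * (?X * ?S))"
    unfolding e using conj_by(2)[OF U conj_by(1)[OF Q S S] cS[OF Xc]] by simp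
  also have "conj_by Q ?S * (?X * ?S) = Q * (?S * (R * ?S))"
    unfolding X conj_by_def using Qc R S unitary_cancel(1)[OF Q cS[OF R(1)]]
    by (simp add: assoc_mult_mat[of _ n n _ n _ n])
  also have "\<dots> = ?X * ?S" unfolding RS X using Qc R S by (simp add: assoc_mult_mat[of _ n n _ n _ n])
  finally show ?thesis unfolding e .
qed

text \<open>Whatever Z, Q and R a step has chosen, all that the convergence proof retains is the new
  frame and the equation saying that the new projector fixes (1 + \<xi>) P.\<close>

lemma nlike_stepD:
  assumes step: "nlike_step nab mns A \<Theta> P \<Theta>' P'" and mn: "\<forall>(m, n)\<in>set mns. m \<le> n"
  shows "frame mns \<Theta>' P'"
    and "\<exists>\<xi>. newton_solution nab mns A P \<xi> \<and>
      emb P' * (emb P + emb \<xi> * emb P) = emb P + emb \<xi> * emb P"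
proof -
  let ?ns = "map snd mns"
  have f: "frame mns \<Theta> P" using step by (simp add: nlike_step_def)
  obtain \<xi> Z where \<xi>: "newton_solution nab mns A P \<xi>" and l: "length \<Theta>'
      = length mns" "length P' = length mns"
    and s: "\<And>j. j < length mns \<Longrightarrow> case mns ! j of (m, n) \<Rightarrow>
           Z ! j \<in> carrier_mat m (n - m) \<and>
           \<xi> ! j = \<Theta> ! j * tangent_block m n (Z ! j) * mat_adjoint (\<Theta> ! j) \<and>
           (\<exists>Q R. is_qr n (update_block m n (Z ! j)) Q R \<and> \<Theta>' ! j = \<Theta> ! j * Q) \<and>
           P' ! j = \<Theta>' ! j * std_proj m n * mat_adjoint (\<Theta>' ! j)"
    using step unfolding nlike_step_def by blast
  have j1: "\<Theta>' ! j \<in> SU n \<and> P' ! j = \<Theta>' ! j * std_proj m n * mat_adjoint (\<Theta>' ! j) \<and>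
      P' ! j * (P ! j + \<xi> ! j * P ! j) = P ! j + \<xi> ! j * P ! j"
    if j: "j < length mns" and e: "mns ! j = (m, n)" for j m n
  proof -
    have m: "m \<le> n" using mn nth_mem[OF j] unfolding e by auto
    obtain Q R where Z: "Z ! j \<in> carrier_mat m (n - m)" and qr: "is_qr n (update_block m n (Z ! j)) Q R"
      and t: "\<Theta>' ! j = \<Theta> ! j * Q" "P' ! j = \<Theta>' ! j * std_proj m n * mat_adjoint (\<Theta>' ! j)"
        "\<xi> ! j = \<Theta> ! j * tangent_block m n (Z ! j) * mat_adjoint (\<Theta> ! j)"
      using s[OF j] unfolding e by auto
    have \<Theta>: "\<Theta> ! j \<in> SU n" "P ! j = \<Theta> ! j * std_proj m n * mat_adjoint (\<Theta> ! j)"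
      using f j e by (auto simp: frame_def)
    have U: "unitary n (\<Theta> ! j)" "unitary n Q" using \<Theta>(1) qr by (auto simp: SU_def is_qr_def)
    have "det (\<Theta>' ! j) = 1"
      unfolding t(1) using det_mult[OF unitaryD(1)[OF U(1)] unitaryD(1)[OF U(2)]]
        is_qr_det[OF m Z qr] \<Theta>(1) by (simp add: SU_def)
    then have "\<Theta>' ! j \<in> SU n" using unitary_mult[OF U] t(1) by (simp add: SU_def)
    moreover have "P' ! j * (P ! j + \<xi> ! j * P ! j) = P ! j + \<xi> ! j * P ! j"
      by (rule qr_step_fixes[OF m Z U(1) qr]) (simp_all only: conj_by_def \<Theta>(2) t)
    ultimately show ?thesis using t(2) by blast
  qed
  show f': "frame mns \<Theta>' P'"
    unfolding frame_def using l j1 by (auto split: prod.splits)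
  have c: "P \<in> cprod ?ns" "P' \<in> cprod ?ns" "\<xi> \<in> cprod ?ns"
    using frame_Gr[OF f mn] frame_Gr[OF f' mn] Gr_ambient her_cprod \<xi>
    by (auto simp: newton_solution_def tangent_def ambient_iff)
  let ?S = "map2 (*) \<xi> P"
  have S: "?S \<in> cprod ?ns" using c by (auto simp: cprod_def)
  have Sj: "?S ! j = \<xi> ! j * P ! j" if "j < length ?ns" for j using c that by (simp add: cprod_def)
  let ?T = "tadd P ?S"
  have T: "?T \<in> cprod ?ns" by (rule cprod_tops(1)[OF c(1) S])
  have Tj: "?T ! j = P ! j + \<xi> ! j * P ! j" if "j < length ?ns" for j
    using c S Sj[OF that] that by (simp add: tadd_def cprod_def)
  have eT: "emb ?T = emb P + emb \<xi> * emb P"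
    using emb_tops(1)[OF c(1) S] emb_mult[OF c(3,1) S Sj] by simp
  have "emb ?T = emb P' * emb ?T"
  proof (rule emb_mult[OF c(2) T T])
    fix j assume j: "j < length ?ns"
    then have "j < length mns" by simp
    from j1[OF this prod.collapse[symmetric], THEN conjunct2, THEN conjunct2]
    show "?T ! j = P' ! j * ?T ! j" unfolding Tj[OF j] by (rule sym)
  qed
  then show "\<exists>\<xi>. newton_solution nab mns A P \<xi> \<and>
      emb P' * (emb P + emb \<xi> * emb P) = emb P + emb \<xi> * emb P"
    using \<xi> unfolding eT by metis
qed

lemma nlike_step_exists:
  assumes f: "frame mns \<Theta> P" and mn: "\<forall>(m, n)\<in>set mns. m \<le> n"
    and sol: "\<exists>!\<xi>. newton_solution nab mns A P \<xi>"
  shows "\<exists>\<Theta>' P'. nlike_step nab mns A \<Theta> P \<Theta>' P'"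
proof -
  let ?ns = "map snd mns"
  obtain \<xi> where \<xi>: "newton_solution nab mns A P \<xi>" using sol by blast
  then have tan: "\<xi> \<in> tangent (ambient mns) (Gr_prod mns) P" by (simp add: newton_solution_def)
  note P = frame_Gr[OF f mn]
  have c: "P \<in> cprod ?ns" "\<xi> \<in> cprod ?ns"
    using Gr_ambient[OF P] tangent_subset(1)[OF tan] her_cprod by (auto simp: ambient_iff)
  have \<xi>T: "emb P * emb \<xi> + emb \<xi> * emb P = emb \<xi>" "adjf (emb \<xi>) = emb \<xi>"
    using tangent_subset(2)[OF tan] by (auto simp: tspace_def herms_def)
  let ?S1 = "map2 (*) P \<xi>" and ?S2 = "map2 (*) \<xi> P"
  have S: "?S1 \<in> cprod ?ns" "?S2 \<in> cprod ?ns" using c by (auto simp: cprod_def)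
  have Sj: "?S1 ! j = P ! j * \<xi> ! j" "?S2 ! j = \<xi> ! j * P ! j" if "j < length ?ns" for j
    using c that by (auto simp: cprod_def)
  have "emb (tadd ?S1 ?S2) = emb \<xi>"
    using emb_tops(1)[OF S] emb_mult[OF c S(1) Sj(1)] emb_mult[OF c(2,1) S(2) Sj(2)] \<xi>T by simp
  then have "tadd ?S1 ?S2 = \<xi>" using emb_inj[OF cprod_tops(1)[OF S] c(2)] by blast
  then have tj: "P ! j * \<xi> ! j + \<xi> ! j * P ! j = \<xi> ! j" if "j < length mns" for j
    using Sj that S c by (auto simp: tadd_def cprod_def list_eq_iff_nth_eq)
  \<comment> \<open>The triple (Z, Q, R) is packed into a single t, so that one application of
    choice suffices for all j.\<close>
  have "\<forall>j. \<exists>t. j < length mns \<longrightarrow> (case mns ! j of (m, n) \<Rightarrow>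
           fst t \<in> carrier_mat m (n - m) \<and>
           \<xi> ! j = \<Theta> ! j * tangent_block m n (fst t) * mat_adjoint (\<Theta> ! j) \<and>
           is_qr n (update_block m n (fst t)) (fst (snd t)) (snd (snd t)))"
  proof (intro allI, subst ex_simps(6), intro impI)
    fix j assume j: "j < length mns"
    obtain m n where e: "mns ! j = (m, n)" by (cases "mns ! j")
    have m: "m \<le> n" using mn nth_mem[OF j] unfolding e by auto
    have \<Theta>: "unitary n (\<Theta> ! j)" and Pj: "P ! j = conj_by (\<Theta> ! j) (std_proj m n)"
      using f j e by (auto simp: frame_def SU_def conj_by_def)
    note S = block_carrier(1)[OF m]
    have x: "\<xi> ! j \<in> carrier_mat n n" "mat_adjoint (\<xi> ! j) = \<xi> ! j"
      using cprodD(2)[OF c(2), of j] adjf_emb_iff[OF c(2)] \<xi>T(2) j e by auto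
    \<comment> \<open>Conjugation by the adjoint frame moves the j-th projector to the standard one,
      where the block form can be read off.\<close>
    let ?B = "conj_by (mat_adjoint (\<Theta> ! j)) (\<xi> ! j)"
    note U' = unitary_adjoint[OF \<Theta>]
    note cU = conj_by[OF \<Theta> S S]
    have Pc: "P ! j \<in> carrier_mat n n" using cU(1) Pj by simp
    have SP: "std_proj m n = conj_by (mat_adjoint (\<Theta> ! j)) (P ! j)" unfolding Pj cU(5) ..
    have B: "?B \<in> carrier_mat n n" "mat_adjoint ?B = ?B"
      using conj_by(1,4)[OF U' x(1) x(1)] x(2) by auto
    have "std_proj m n * ?B + ?B * std_proj m n
        = conj_by (mat_adjoint (\<Theta> ! j)) (P ! j * \<xi> ! j + \<xi> ! j * P ! j)"
      unfolding SP conj_by(2)[OF U' Pc x(1)] conj_by(2)[OF U' x(1) Pc]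
      using x(1) Pc by (intro conj_by(3)[OF U']) auto
    then have "std_proj m n * ?B + ?B * std_proj m n = ?B" unfolding tj[OF j] .
    from tangent_block_exists[OF m B this] obtain Z where Z: "Z \<in> carrier_mat m (n - m)"
      "?B = tangent_block m n Z" by blast
    have "\<xi> ! j = conj_by (\<Theta> ! j) (tangent_block m n Z)"
      using conj_by(6)[OF \<Theta> x(1) x(1)] unfolding Z(2) by simp
    moreover obtain Q R where "is_qr n (update_block m n Z) Q R" using is_qr_exists[OF m Z(1)] by blast
    ultimately show "\<exists>t. case mns ! j of (m, n) \<Rightarrow>
           fst t \<in> carrier_mat m (n - m) \<and>
           \<xi> ! j = \<Theta> ! j * tangent_block m n (fst t) * mat_adjoint (\<Theta> ! j) \<and>
           is_qr n (update_block m n (fst t)) (fst (snd t)) (snd (snd t))"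
      using Z(1) unfolding e conj_by_def by (intro exI[of _ "(Z, Q, R)"]) simp
  qed
  from choice[OF this] obtain F where F: "\<And>j. j < length mns \<Longrightarrow> case mns ! j of (m, n) \<Rightarrow>
           fst (F j) \<in> carrier_mat m (n - m) \<and>
           \<xi> ! j = \<Theta> ! j * tangent_block m n (fst (F j)) * mat_adjoint (\<Theta> ! j) \<and>
           is_qr n (update_block m n (fst (F j))) (fst (snd (F j))) (snd (snd (F j)))" by blast
  define Z Q R where "Z j = fst (F j)" and "Q j = fst (snd (F j))" and "R j = snd (snd (F j))" for j
  have ZQR: "\<And>j. j < length mns \<Longrightarrow> case mns ! j of (m, n) \<Rightarrow>
           Z j \<in> carrier_mat m (n - m) \<and>
           \<xi> ! j = \<Theta> ! j * tangent_block m n (Z j) * mat_adjoint (\<Theta> ! j) \<and>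
           is_qr n (update_block m n (Z j)) (Q j) (R j)"
    using F unfolding Z_def Q_def R_def .
  define \<Theta>' where "\<Theta>' = map (\<lambda>j. \<Theta> ! j * Q j) [0..<length mns]"
  define P' where "P' = map (\<lambda>j. \<Theta>' ! j * std_proj (fst (mns ! j)) (snd (mns ! j)) * mat_adjoint (\<Theta>' ! j)) [0..<length mns]"
  define Zs where "Zs = map Z [0..<length mns]"
  have L: "length \<Theta>' = length mns" "length P' = length mns" "length Zs = length mns"
    by (simp_all add: \<Theta>'_def P'_def Zs_def)
  have ex: "\<exists>\<xi> Z. newton_solution nab mns A P \<xi> \<and> length Z = length mns \<and>
      (\<forall>j<length mns. case mns ! j of (m, n) \<Rightarrow>
           Z ! j \<in> carrier_mat m (n - m) \<and>
           \<xi> ! j = \<Theta> ! j * tangent_block m n (Z ! j) * mat_adjoint (\<Theta> ! j) \<and>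
           (\<exists>Q R. is_qr n (update_block m n (Z ! j)) Q R \<and> \<Theta>' ! j = \<Theta> ! j * Q) \<and>
           P' ! j = \<Theta>' ! j * std_proj m n * mat_adjoint (\<Theta>' ! j))"
  proof (rule exI[of _ \<xi>], rule exI[of _ Zs], intro conjI \<xi> L allI impI)
    fix j assume j: "j < length mns"
    obtain m n where e: "mns ! j = (m, n)" by (cases "mns ! j")
    show "case mns ! j of (m, n) \<Rightarrow>
           Zs ! j \<in> carrier_mat m (n - m) \<and>
           \<xi> ! j = \<Theta> ! j * tangent_block m n (Zs ! j) * mat_adjoint (\<Theta> ! j) \<and>
           (\<exists>Q R. is_qr n (update_block m n (Zs ! j)) Q R \<and> \<Theta>' ! j = \<Theta> ! j * Q) \<and>
           P' ! j = \<Theta>' ! j * std_proj m n * mat_adjoint (\<Theta>' ! j)"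
      using ZQR[OF j] j unfolding e by (auto simp: Zs_def \<Theta>'_def P'_def e)
  qed
  have "nlike_step nab mns A \<Theta> P \<Theta>' P'"
    unfolding nlike_step_def by (intro conjI f sol L(1,2) ex)
  then show ?thesis by blast
qed

text \<open>Within radius \<open>e\<close> the quadratic estimate at least halves the distance,
  which keeps the iterates in the ball; \<open>C + 1\<close> avoids dividing by zero.\<close>

lemma contraction_halves:
  fixes d C e :: real
  assumes "0 \<le> d" "d < e" "0 \<le> C" "e \<le> 1 / (2 * (C + 1))"
  shows "C * d\<^sup>2 \<le> d / 2"
proof -
  have "C * d \<le> C * (1 / (2 * (C + 1)))" using assms by (intro mult_left_mono) auto
  also have "\<dots> \<le> 1 / 2" using assms(3) by (simp add: field_simps)
  finally have "C * d * d \<le> 1 / 2 * d" using assms(1) by (rule mult_right_mono)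
  then show ?thesis by (simp add: power2_eq_square mult.assoc)
qed

theorem theorem4p1:
  fixes mns :: "(nat \<times> nat) list" and A :: "complex mat" and nab :: conn and Pstar :: mtuple
  assumes "mns \<noteq> []"
    and "\<forall>(m, n)\<in>set mns. 1 \<le> m \<and> m \<le> n"
    and "A \<in> herm (prod_list (map snd mns))"
    and "levi_civita (ambient mns) (Gr_prod mns) nab"
    and "nondegenerate_critical_point (ambient mns) (Gr_prod mns) nab (rayleigh A) Pstar"
  shows "\<exists>V \<subseteq> Gr_prod mns.
    (\<exists>e>0. \<forall>P\<in>Gr_prod mns. tdist P Pstar < e \<longrightarrow> P \<in> V) \<and>
    (\<forall>P0\<in>V. \<forall>\<Theta>0. frame mns \<Theta>0 P0 \<longrightarrow>
       (\<exists>\<Theta> P. nlike_run nab mns A \<Theta> P \<and> \<Theta> 0 = \<Theta>0 \<and> P 0 = P0) \<and>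
       (\<forall>\<Theta> P. nlike_run nab mns A \<Theta> P \<and> \<Theta> 0 = \<Theta>0 \<and> P 0 = P0 \<longrightarrow>
          converges_quadratically P Pstar))"
proof -
  define ns where "ns = map snd mns"
  have mn: "\<forall>(m, n)\<in>set mns. m \<le> n" using assms(2) by auto
  note lc = assms(4) and nd = assms(5)
  have crit: "critical_point (ambient mns) (Gr_prod mns) (rayleigh A) Pstar"
    using nd by (simp add: nondegenerate_critical_point_def)
  then have Ps: "Pstar \<in> Gr_prod mns" by (simp add: critical_point_def)
  have "A \<in> carrier_mat (prod_list ns) (prod_list ns)" using assms(3) by (simp add: herm_def ns_def)
  from rayleigh_poly_map[OF this] obtain r r' where r: "poly_map r r'"
    "\<And>P. P \<in> cprod ns \<Longrightarrow> rayleigh A P = inner (r (emb P)) (single 0 0 0 1)" by blast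
  from polynomial_gradient[OF r(1), of ns "single 0 0 0 1"] obtain G G' where
    G: "projector_newton ns G G'"
    "\<And>x v. v \<in> herms ns \<Longrightarrow> inner (G x) v = inner (r' x v) (single 0 0 0 1)" by blast
  interpret rayleigh_newton ns G G' mns A r r' "single 0 0 0 1"
    by (intro rayleigh_newton.intro G(1) rayleigh_newton_axioms.intro)
      (use ns_def r G(2) in auto)
  define ps where "ps = emb Pstar"
  note ps = projs_D[OF Gr_projs[OF Ps], folded ns_def ps_def]
  have g0: "g ps = 0" using critical_point_rayleigh[OF crit] by (simp add: ps_def)
  have inj: "v = 0" if "v \<in> tspace ns ps" "hess ps v = 0" for v
    using nondegenerate_imp_hess_injective[OF lc nd] that by (simp add: ps_def)
  obtain c e0 where c: "c > 0" "e0 > 0" and low: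
    "\<And>p v. p * p = p \<Longrightarrow> norm (p - ps) < e0
        \<Longrightarrow> v \<in> tspace ns p \<Longrightarrow> c * norm v \<le> norm (hess p v)"
    using hess_uniformly_bounded_below[OF ps(1,2) inj] by metis
  obtain C where C: "C \<ge> 0" and quad: "\<And>p v p'. p \<in> herms ns
      \<Longrightarrow> p * p = p \<Longrightarrow> norm p = norm ps \<Longrightarrow>
    norm (p - ps) \<le> 1 \<Longrightarrow> \<forall>v\<in>tspace ns p. c * norm v \<le> norm (hess p v) \<Longrightarrow>
    v \<in> tspace ns p \<Longrightarrow> hess p v = - g p
        \<Longrightarrow> p' \<in> herms ns \<Longrightarrow> p' * p' = p' \<Longrightarrow> norm p' = norm ps \<Longrightarrow>
    p' * (p + v * p) = p + v * p \<Longrightarrow> norm (p' - ps) \<le> C * (norm (p - ps))\<^sup>2"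
    using newton_quadratic[OF ps(1,2) g0 c(1)] by blast
  \<comment> \<open>\<open>e0\<close> secures the uniform lower bound of the Hessian, 1 is the range
    of the quadratic estimate, and the last term makes a step halve the distance.\<close>
  define e where "e = min e0 (min 1 (1 / (2 * (C + 1))))"
  have "e > 0" unfolding e_def using c C by simp
  moreover have "e \<le> e0" unfolding e_def by (rule min.cobounded1)
  moreover have "e \<le> 1" unfolding e_def by (rule min.coboundedI2[OF min.cobounded1])
  moreover have "e \<le> 1 / (2 * (C + 1))" unfolding e_def by (rule min.coboundedI2[OF min.cobounded2])
  ultimately have e: "e > 0" "e \<le> e0" "e \<le> 1" "e \<le> 1 / (2 * (C + 1))" by blast+
  have dist: "tdist P Pstar = norm (emb P - ps)" if "P \<in> Gr_prod mns" for P
    using tdist_emb[OF Gr_ambient[OF that] Gr_ambient[OF Ps]] by (simp add: ps_def)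
  have step_bound: "P' \<in> Gr_prod mns \<and> frame mns \<Theta>' P' \<and> tdist P' Pstar
      \<le> C * (tdist P Pstar)\<^sup>2"
    if P: "P \<in> Gr_prod mns" "tdist P Pstar < e" and step: "nlike_step nab mns A \<Theta> P \<Theta>' P'"
    for P P' \<Theta> \<Theta>'
  proof -
    note f' = nlike_stepD(1)[OF step mn]
    note P' = frame_Gr[OF f' mn]
    obtain \<xi> where \<xi>: "newton_solution nab mns A P \<xi>"
      "emb P' * (emb P + emb \<xi> * emb P) = emb P + emb \<xi> * emb P"
      using nlike_stepD(2)[OF step mn] by blast
    have \<xi>T: "\<xi> \<in> tangent (ambient mns) (Gr_prod mns) P" and h: "hess (emb P) (emb \<xi>) = - g (emb P)"
      using \<xi>(1) newton_solution_iff[OF lc P(1)] by auto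
    note p = projs_D[OF Gr_projs[OF P(1)], folded ns_def] and p' = projs_D[OF Gr_projs[OF P'], folded ns_def]
    have near: "norm (emb P - ps) < e" using P dist by simp
    have "norm (emb P' - ps) \<le> C * (norm (emb P - ps))\<^sup>2"
    proof (rule quad)
      show "norm (emb P) = norm ps" "norm (emb P') = norm ps"
        using projs_norm Gr_projs P P' Ps unfolding ps_def by blast+
      show "\<forall>v\<in>tspace ns (emb P). c * norm v \<le> norm (hess (emb P) v)"
        using low[OF p(2)] near e(2) by auto
      show "emb \<xi> \<in> tspace ns (emb P)" using tangent_subset(2)[OF \<xi>T] by (simp add: ns_def)
    qed (use p p' near e h \<xi>(2) in auto)
    then show ?thesis using f' P' dist P(1) by simp
  qed
  have half: "C * (tdist P Pstar)\<^sup>2 \<le> tdist P Pstar / 2"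
    if "P \<in> Gr_prod mns" "tdist P Pstar < e" for P
    using contraction_halves[of "tdist P Pstar" e C] that e(4) C dist by simp
  have unique: "\<exists>!\<xi>. newton_solution nab mns A P \<xi>"
    if P: "P \<in> Gr_prod mns" "tdist P Pstar < e" for P
  proof -
    note p = projs_D[OF Gr_projs[OF P(1)], folded ns_def]
    have "c * norm v \<le> norm (hess (emb P) v)" if "v \<in> tspace ns (emb P)" for v
      using low[OF p(2) _ that] P dist e(2) by simp
    from newton_equation_solvable[OF p(1,2) c(1) this]
    obtain v where v: "v \<in> tspace ns (emb P)" "hess (emb P) v = - g (emb P)"
      and u: "\<And>w. w \<in> tspace ns (emb P)
          \<Longrightarrow> hess (emb P) w = - g (emb P) \<Longrightarrow> w = v" by auto
    note t = unemb_tangent[OF P(1) v(1)[unfolded ns_def]]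
    show ?thesis
    proof (rule ex1I)
      show "newton_solution nab mns A P (unemb (map snd mns) v)"
        using newton_solution_iff[OF lc P(1)] t v(2) by simp
      fix \<xi> assume "newton_solution nab mns A P \<xi>"
      then have \<xi>: "\<xi> \<in> tangent (ambient mns) (Gr_prod mns) P" "hess (emb P) (emb \<xi>) = - g (emb P)"
        using newton_solution_iff[OF lc P(1)] by auto
      then have "emb \<xi> = emb (unemb (map snd mns) v)"
        using u[of "emb \<xi>"] tangent_subset(2)[OF \<xi>(1)] t(2) by (simp add: ns_def)
      then show "\<xi> = unemb (map snd mns) v"
        using her_emb_inj tangent_subset(1)[OF \<xi>(1)] tangent_subset(1)[OF t(1)] ambient_iff by blast
    qed
  qed
  define V where "V = {P \<in> Gr_prod mns. tdist P Pstar < e}"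
  have stay: "P' \<in> V \<and> frame mns \<Theta>' P'"
    if "P \<in> V" "nlike_step nab mns A \<Theta> P \<Theta>' P'" for P P' \<Theta> \<Theta>'
  proof -
    have P: "P \<in> Gr_prod mns" "tdist P Pstar < e" using that(1) by (auto simp: V_def)
    have "0 \<le> tdist P Pstar" using dist P(1) by simp
    then show ?thesis using step_bound[OF P that(2)] half[OF P] P by (auto simp: V_def)
  qed
  have run_exists: "\<exists>\<Theta> P. nlike_run nab mns A \<Theta> P \<and> \<Theta> 0 = \<Theta>0 \<and> P 0 = P0"
    if P0: "P0 \<in> V" and f0: "frame mns \<Theta>0 P0" for P0 \<Theta>0
  proof -
    \<comment> \<open>Dependent choice on pairs (frame, point). The invariant guarantees that
      another step exists, and its clause for k = 0 fixes the prescribed start.\<close>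
    have "\<exists>f. \<forall>k. (snd (f k) \<in> V \<and> frame mns (fst (f k)) (snd (f k)) \<and> (k
        = 0 \<longrightarrow> f k = (\<Theta>0, P0)))
        \<and> nlike_step nab mns A (fst (f k)) (snd (f k)) (fst (f (Suc k))) (snd (f (Suc k)))"
    proof (rule dependent_nat_choice)
      show "\<exists>x. snd x \<in> V \<and> frame mns (fst x) (snd x) \<and> ((0 :: nat) = 0
          \<longrightarrow> x = (\<Theta>0, P0))"
        using P0 f0 by (intro exI[of _ "(\<Theta>0, P0)"]) simp
      fix x and k :: nat
      assume "snd x \<in> V \<and> frame mns (fst x) (snd x) \<and> (k = 0 \<longrightarrow> x = (\<Theta>0, P0))"
      then have x: "snd x \<in> V" "frame mns (fst x) (snd x)" by auto
      obtain \<Theta>' P' where s: "nlike_step nab mns A (fst x) (snd x) \<Theta>' P'"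
        using nlike_step_exists[OF x(2) mn unique] x(1) by (auto simp: V_def)
      then show "\<exists>y. (snd y \<in> V \<and> frame mns (fst y) (snd y) \<and> (Suc k
          = 0 \<longrightarrow> y = (\<Theta>0, P0)))
          \<and> nlike_step nab mns A (fst x) (snd x) (fst y) (snd y)"
        using stay[OF x(1) s] by (intro exI[of _ "(\<Theta>', P')"]) simp
    qed
    then obtain f where f: "\<And>k. nlike_step nab mns A (fst (f k)) (snd (f k)) (fst (f (Suc k))) (snd (f (Suc k)))"
      "f 0 = (\<Theta>0, P0)" by blast
    then show ?thesis
      by (intro exI[of _ "\<lambda>k. fst (f k)"] exI[of _ "\<lambda>k. snd (f k)"]) (simp add: nlike_run_def)
  qed
  have conv: "converges_quadratically P Pstar"
    if run: "nlike_run nab mns A \<Theta> P" and P0: "P 0 \<in> V" for \<Theta> P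
  proof -
    have s: "nlike_step nab mns A (\<Theta> k) (P k) (\<Theta> (Suc k)) (P (Suc k))" for k
      using run by (simp add: nlike_run_def)
    have PV: "P k \<in> V" for k
      by (induction k) (use P0 stay s in blast)+
    then have PG: "P k \<in> Gr_prod mns" "tdist (P k) Pstar < e" for k by (auto simp: V_def)
    have q: "tdist (P (Suc k)) Pstar \<le> C * (tdist (P k) Pstar)\<^sup>2" for k
      using step_bound[OF PG s] by blast
    \<comment> \<open>A quadratic estimate alone does not force convergence; halving at each step
      does.\<close>
    have geo: "tdist (P k) Pstar \<le> (1 / 2) ^ k * tdist (P 0) Pstar" for k
    proof (induction k)
      case (Suc k)
      have "tdist (P (Suc k)) Pstar \<le> tdist (P k) Pstar / 2"
        using q[of k] half[OF PG[of k]] by (rule order_trans)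
      then show ?case using Suc by simp
    qed simp
    have "(\<lambda>k. tdist (P k) Pstar) \<longlonglongrightarrow> 0"
    proof (rule tendsto_sandwich)
      show "\<forall>\<^sub>F k in sequentially. 0 \<le> tdist (P k) Pstar"
        using dist[OF PG(1)] by (intro always_eventually allI) simp
      show "\<forall>\<^sub>F k in sequentially. tdist (P k) Pstar \<le> (1 / 2) ^ k * tdist (P 0) Pstar"
        using geo by (intro always_eventually allI)
      show "(\<lambda>k. (1 / 2) ^ k * tdist (P 0) Pstar) \<longlonglongrightarrow> 0"
        by (intro tendsto_mult_left_zero LIMSEQ_power_zero) simp
    qed simp
    then show ?thesis using q unfolding converges_quadratically_def by blast
  qed
  show ?thesis
  proof (intro exI[of _ V] conjI ballI allI impI)
    show "V \<subseteq> Gr_prod mns" by (auto simp: V_def)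
    show "\<exists>e>0. \<forall>P\<in>Gr_prod mns. tdist P Pstar < e \<longrightarrow> P \<in> V"
      using e(1) by (intro exI[of _ e]) (simp add: V_def)
    fix P0 \<Theta>0 assume "P0 \<in> V" "frame mns \<Theta>0 P0"
    then show "\<exists>\<Theta> P. nlike_run nab mns A \<Theta> P \<and> \<Theta> 0 = \<Theta>0 \<and> P 0
        = P0" by (rule run_exists)
  next
    fix P0 \<Theta>0 \<Theta> P
    assume "P0 \<in> V" "nlike_run nab mns A \<Theta> P \<and> \<Theta> 0 = \<Theta>0 \<and> P 0 = P0"
    then show "converges_quadratically P Pstar" using conv by blast
  qed
qed

end
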